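(* Let $H$, $\mu$, $\alpha$, $\sigma$, $\nu$, $L$, $(M_n)$, $\{X_{nj}\}$ and $S_n=\sum_{j=1}^nX_{nj}$ be as in the context (hard truncation regime), and suppose $0<\alpha<2$. Then $$\frac{S_n}{nM_nP(\|H\|>M_n)}$$ follows the Large Deviations Principle with speed $nP(\|H\|>M_n)$ and rate function $\Lambda^*$, where $\Lambda^*(x):=\sup_{\lambda\in\mathbb R^d}\{\langle\lambda,x\rangle-\Lambda(\lambda)\}$ is the Fenchel-Legendre transform of the function $\Lambda:\mathbb R^d\to\mathbb R$ given by $$\Lambda(\lambda):=\begin{cases}\displaystyle\int_{\mathbb R^d}\left(e^{\langle\lambda,x\rangle}-1\right)\nu(dx),&0<\alpha<1,\\[2mm]\displaystyle\int_{\mathbb R^d}\left(e^{\langle\lambda,x\rangle}-1-\langle\lambda,x\rangle\right)\nu(dx),&\alpha=1,\\[2mm]\displaystyle\int_{\mathbb R^d}\left(e^{\langle\lambda,x\rangle}-1-\langle\lambda,x\rangle\right)\nu(dx)-\frac1{\alpha-1}\int_{\mathcal S}\langle\lambda,s\rangle\,\sigma(ds),&1<\alpha<2.\end{cases}$$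
   Context: Notation: $\|\cdot\|$ is the Euclidean norm and $\langle\cdot,\cdot\rangle$ the Euclidean inner product on $\mathbb R^d$; $B_r:=\{x\in\mathbb R^d:\|x\|\le r\}$, and complements of such balls are denoted $B_r^c$; $\mathcal S:=\{x\in\mathbb R^d:\|x\|=1\}$. $\overline{\mathbb R^d}$ is the compact set obtained by adding to $\mathbb R^d$ a sphere of infinite radius centered at the origin; $\stackrel{v}{\longrightarrow}$ denotes vague convergence of Radon measures. Setup: $H$ is an $\mathbb R^d$-valued random vector for which there are a non-null Radon measure $\mu$ on $\mathbb R^d\setminus\{0\}$, extended by $\mu(\overline{\mathbb R^d}\setminus\mathbb R^d)=0$, and a sequence $a_n\to\infty$ with $nP(a_n^{-1}H\in\cdot)\stackrel{v}{\longrightarrow}\mu(\cdot)$ on $\overline{\mathbb R^d}\setminus\{0\}$. Then there is $\alpha>0$ with $\mu(cA)=c^{-\alpha}\mu(A)$ for all $c>0$ and Borel $A$, and $P(\|H\|>\cdot)$ is regularly varying with index $-\alpha$. If $\alpha=1$, $H$ is assumed to have a symmetric distribution; if $\alpha>1$, $E(H)=0$. $H_1,H_2,\ldots$ are i.i.d. copies of $H$; $L,L_1,L_2,\ldots$ are i.i.d. $[0,\infty)$-valued random variables independent of $(H,H_1,H_2,\ldots)$, with $Ee^{\epsilon L}<\infty$ for some $\epsilon>0$; $(M_n)$ is a sequence of positive numbers with $M_n\to\infty$; and for $1\le j\le n$ $$X_{nj}:=H_j\mathbf 1(\|H_j\|\le M_n)+\frac{H_j}{\|H_j\|}(M_n+L_j)\mathbf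 1(\|H_j\|>M_n).$$ Hard truncation regime (standing assumption): $\lim_{n\to\infty}nP(\|H\|>M_n)=\infty$. Measures: $\sigma$ is the probability measure on $\mathcal S$ given by $\sigma(A):=\frac1{\mu(B_1^c)}\mu\left(\left\{x\in\mathbb R^d:\|x\|\ge1,\ x/\|x\|\in A\right\}\right)$, and $\nu(A):=\frac{\mu(A\cap B_1)}{\mu(B_1^c)}+\sigma(A\cap\mathcal S)$, a measure on $\mathbb R^d\setminus\{0\}$. A sequence of $\mathbb R^d$-valued random vectors $Z_n$ follows the Large Deviations Principle (LDP) with speed $c_n$ and rate function $I$ if for every Borel set $A$, $$-\inf_{x\in\mathrm{int}(A)}I(x)\le\liminf_{n\to\infty}\frac1{c_n}\log P(Z_n\in A)\le\limsup_{n\to\infty}\frac1{c_n}\log P(Z_n\in A)\le-\inf_{x\in\mathrm{cl}(A)}I(x),$$ where $\mathrm{int}$ and $\mathrm{cl}$ denote interior and closure. *)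

theory Defs
  imports "HOL-Probability.Probability"
begin

definition radon_measure_on :: "'a::topological_space set \<Rightarrow> 'a measure \<Rightarrow> bool" where
  "radon_measure_on S N \<longleftrightarrow>
     sets N = sets (restrict_space borel S) \<and>
     (\<forall>K. compact K \<and> K \<subseteq> S \<longrightarrow> emeasure N K < \<infinity>)"

definition vaguely_converges_on ::
    "'a::topological_space set \<Rightarrow> (nat \<Rightarrow> 'a measure) \<Rightarrow> 'a measure \<Rightarrow> bool" where
  "vaguely_converges_on S Ns N \<longleftrightarrow>
     (\<forall>n. radon_measure_on S (Ns n)) \<and> radon_measure_on S N \<and>
     (\<forall>(f :: 'a \<Rightarrow> real) K. continuous_on S f \<and> compact K \<and> K \<subseteq> S \<and> (\<forall>x\<in>S - K. f x = 0) \<longrightarrow>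
        (\<lambda>n. LINT x|Ns n. f x) \<longlonglongrightarrow> (LINT x|N. f x))"

text \<open>
  The compactification of \<open>\<real>\<^sup>d\<close> by a sphere of infinite radius is modelled by the closed unit
  ball: \<open>\<real>\<^sup>d\<close> is embedded as the open unit ball by \<open>x \<mapsto> x / (1 + \<parallel>x\<parallel>)\<close>, and the unit sphere
  plays the role of the points at infinity.
\<close>

definition punctured_compactification :: "'a::euclidean_space set" where
  "punctured_compactification = cball 0 1 - {0}"

definition embed_compactification :: "'a::euclidean_space \<Rightarrow> 'a" where
  "embed_compactification x = x /\<^sub>R (1 + norm x)"

text \<open>
  The extension to the punctured compactification of a measure on \<open>\<real>\<^sup>d \<setminus> {0}\<close>; the points at
  infinity get mass \<open>0\<close>.
\<close>

definition extend_measure0 :: "'a::euclidean_space measure \<Rightarrow> 'a measure" where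
  "extend_measure0 N =
     distr N (restrict_space borel punctured_compactification) embed_compactification"

text \<open>The measure \<open>n P(a\<^sup>-\<^sup>1 Y \<in> \<cdot>)\<close>, restricted to \<open>\<real>\<^sup>d \<setminus> {0}\<close>.\<close>

definition scaled_law :: "'w measure \<Rightarrow> ('w \<Rightarrow> 'a::euclidean_space) \<Rightarrow> nat \<Rightarrow> real \<Rightarrow> 'a measure" where
  "scaled_law P Y n a =
     scale_measure (of_nat n) (restrict_space (distr P borel (\<lambda>\<omega>. Y \<omega> /\<^sub>R a)) (- {0}))"

text \<open>The sigma-algebra on the sample space generated by the whole family \<open>Y\<close>.\<close>

definition generated_events :: "'w measure \<Rightarrow> (nat \<Rightarrow> 'w \<Rightarrow> 'b::topological_space) \<Rightarrow> 'w set set" where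
  "generated_events P Y =
     {(\<lambda>\<omega> j. Y j \<omega>) -` A \<inter> space P | A. A \<in> sets (PiM UNIV (\<lambda>_::nat. borel :: 'b measure))}"

definition truncate_vec :: "real \<Rightarrow> 'a::euclidean_space \<Rightarrow> real \<Rightarrow> 'a" where
  "truncate_vec m h l = (if norm h \<le> m then h else ((m + l) / norm h) *\<^sub>R h)"

definition truncated_sum ::
    "(nat \<Rightarrow> real) \<Rightarrow> (nat \<Rightarrow> 'w \<Rightarrow> 'a::euclidean_space) \<Rightarrow> (nat \<Rightarrow> 'w \<Rightarrow> real) \<Rightarrow> nat \<Rightarrow> 'w \<Rightarrow> 'a" where
  "truncated_sum M H L n \<omega> = (\<Sum>j=1..n. truncate_vec (M n) (H j \<omega>) (L j \<omega>))"

definition spectral_measure :: "'a::euclidean_space measure \<Rightarrow> 'a measure" where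
  "spectral_measure \<mu> =
     measure_of (sphere 0 1) (sets (restrict_space borel (sphere 0 1)))
       (\<lambda>A. emeasure \<mu> {x. norm x \<ge> 1 \<and> x /\<^sub>R norm x \<in> A} / emeasure \<mu> (- cball 0 1))"

definition nu_measure :: "'a::euclidean_space measure \<Rightarrow> 'a measure" where
  "nu_measure \<mu> =
     measure_of (- {0}) (sets (restrict_space borel (- {0})))
       (\<lambda>A. emeasure \<mu> (A \<inter> cball 0 1) / emeasure \<mu> (- cball 0 1)
            + emeasure (spectral_measure \<mu>) (A \<inter> sphere 0 1))"

text \<open>Only meant for \<open>0 < \<alpha> < 2\<close>; the last branch is the case \<open>1 < \<alpha> < 2\<close>.\<close>

definition Lambda :: "real \<Rightarrow> 'a::euclidean_space measure \<Rightarrow> 'a \<Rightarrow> real" where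
  "Lambda \<alpha> \<mu> l =
     (if \<alpha> < 1 then (LINT x|nu_measure \<mu>. exp (l \<bullet> x) - 1)
      else if \<alpha> = 1 then (LINT x|nu_measure \<mu>. exp (l \<bullet> x) - 1 - l \<bullet> x)
      else (LINT x|nu_measure \<mu>. exp (l \<bullet> x) - 1 - l \<bullet> x)
           - 1 / (\<alpha> - 1) * (LINT s|spectral_measure \<mu>. l \<bullet> s))"

definition fenchel_legendre :: "('a::euclidean_space \<Rightarrow> real) \<Rightarrow> 'a \<Rightarrow> ereal" where
  "fenchel_legendre F x = (SUP l. ereal (l \<bullet> x - F l))"

text \<open>Logarithm with the convention \<open>log 0 = -\<infinity>\<close> (the library has \<open>ln 0 = 0\<close>).\<close>

definition log_prob :: "real \<Rightarrow> ereal" where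
  "log_prob p = (if p = 0 then - \<infinity> else ereal (ln p))"

definition follows_LDP ::
    "'w measure \<Rightarrow> (nat \<Rightarrow> 'w \<Rightarrow> 'a::euclidean_space) \<Rightarrow> (nat \<Rightarrow> real) \<Rightarrow> ('a \<Rightarrow> ereal) \<Rightarrow> bool" where
  "follows_LDP P Z c I \<longleftrightarrow>
     (\<forall>A\<in>sets borel.
        - (INF x\<in>interior A. I x)
          \<le> liminf (\<lambda>n. ereal (1 / c n) * log_prob (measure P {\<omega>\<in>space P. Z n \<omega> \<in> A})) \<and>
        liminf (\<lambda>n. ereal (1 / c n) * log_prob (measure P {\<omega>\<in>space P. Z n \<omega> \<in> A}))
          \<le> limsup (\<lambda>n. ereal (1 / c n) * log_prob (measure P {\<omega>\<in>space P. Z n \<omega> \<in> A})) \<and>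
        limsup (\<lambda>n. ereal (1 / c n) * log_prob (measure P {\<omega>\<in>space P. Z n \<omega> \<in> A}))
          \<le> - (INF x\<in>closure A. I x))"

end

theory Submission
  imports Defs
begin

text \<open>
  Since \<open>\<Lambda>\<close> is finite and differentiable, the principle follows in the manner of Gaertner and Ellis
  once \<open>1 / (n p\<^sub>n) * ln E exp \<langle>\<lambda>, S\<^sub>n\<rangle> / M\<^sub>n\<close> is shown to converge to \<open>\<Lambda> \<lambda>\<close>, where
  \<open>p\<^sub>n = P(\<parallel>H\<parallel> > M\<^sub>n)\<close>. By independence this logarithm is \<open>n ln (1 + p\<^sub>n y\<^sub>n)\<close> with
  \<open>p\<^sub>n y\<^sub>n = E exp \<langle>\<lambda>, X\<^sub>n\<^sub>1\<rangle> / M\<^sub>n - 1\<close>, and \<open>p\<^sub>n\<close> tends to 0, so it suffices that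
  \<open>y\<^sub>n\<close> tends to \<open>\<Lambda> \<lambda>\<close>.

  Up to the negligible contribution of \<open>L\<close>, the vector \<open>X\<^sub>n\<^sub>1 / M\<^sub>n\<close> is the radial projection of
  \<open>H / M\<^sub>n\<close> onto the unit ball, a map that extends continuously to the compactification and sends
  \<open>\<mu>\<close> to a multiple of \<open>\<nu>\<close>. Vague convergence thus gives the limit of
  \<open>E F(X\<^sub>n\<^sub>1 / M\<^sub>n) / p\<^sub>n\<close> for \<open>F\<close> vanishing near 0, and Karamata-type moment bounds extend it to \<open>F\<close>
  of order \<open>\<parallel>y\<parallel>\<^sup>\<beta>\<close> at 0 with \<open>\<beta> > \<alpha>\<close>: \<open>\<beta> = 1\<close> if \<open>\<alpha> < 1\<close>, and \<open>\<beta> = 2\<close> after subtracting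
  the linear term otherwise. That linear term vanishes by symmetry if \<open>\<alpha> = 1\<close>; if \<open>\<alpha> > 1\<close>, centering
  turns it into an integral over the tail of \<open>H\<close>, the source of the factor \<open>1 / (\<alpha> - 1)\<close>.
\<close>

section \<open>A Gaertner-Ellis theorem\<close>

text \<open>Vague convergence is given only along the sequence \<open>a n\<close>, while
  \<open>M n\<close> is tied to \<open>n\<close> by nothing but the divergence of
  \<open>n P(norm H > M n)\<close>. Asymptotic statements are therefore proved for a real level
  \<open>t\<close> tending to infinity, with \<open>M n\<close> substituted at the end; the hard
  truncation condition enters only as divergence of the speed.

  Two singularities keep the exponential moments from being direct limits of test integrals: \<mu>
  is infinite at the origin, and the linear functional used for \<alpha> > 1 is unbounded at
  infinity. A cutoff near 0 and a truncation at \<open>T t\<close> remove them, with errors uniform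
  in large \<open>t\<close> that come from iterating regular variation over dyadic levels.

  The factor \<open>1 / (\<alpha> - 1)\<close> arises as follows. With zero mean, the expectation of
  \<open>l \<bullet> clip t H\<close> is minus that of \<open>l \<bullet> H / norm H\<close>
  weighted by the overshoot \<open>norm H / t - 1\<close> on \<open>norm H > t\<close>. Relative to
  \<open>P(norm H > t)\<close> the event \<open>norm H / t > u\<close> has limiting weight
  \<open>u powr (- \<alpha>)\<close>, whose integral over \<open>u > 1\<close> is
  \<open>1 / (\<alpha> - 1)\<close>.\<close>

lemma limsup_log_prob_le:
  fixes c p :: "nat \<Rightarrow> real"
  assumes c: "filterlim c at_top sequentially" and p: "\<And>n. p n \<ge> 0" and K: "K > 0"
    and bound: "\<And>\<delta>. \<delta> > 0 \<Longrightarrow> \<forall>\<^sub>F n in sequentially. p n \<le> K * exp (- c n * (a - \<delta>))"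
  shows "limsup (\<lambda>n. ereal (1 / c n) * log_prob (p n)) \<le> ereal (- a)"
proof (rule ereal_le_epsilon2)
  fix e :: real assume e: "0 < e"
  \<comment> \<open>At the scale \<open>1 / c n\<close> every constant factor disappears, so a union
    bound over a fixed finite number of events costs nothing.\<close>
  have K0: "(\<lambda>n. ln K / c n) \<longlonglongrightarrow> 0"
    by (rule tendsto_divide_0[OF tendsto_const filterlim_at_top_imp_at_infinity[OF c]])
  have "\<forall>\<^sub>F n in sequentially. ereal (1 / c n) * log_prob (p n) \<le> ereal (- a + e)"
    using bound[OF half_gt_zero[OF e]] order_tendstoD(2)[OF K0 half_gt_zero[OF e]]
      eventually_gt_at_top[of 0, THEN eventually_compose_filterlim[OF _ c]]
  proof (eventually_elim)
    case (elim n)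
    show ?case
    proof (cases "p n = 0")
      case True
      then show ?thesis using elim by (simp add: log_prob_def)
    next
      case False
      then have "p n > 0" using p[of n] by simp
      then have "ln (p n) \<le> ln (K * exp (- c n * (a - e/2)))"
        using elim e by (subst ln_le_cancel_iff) auto
      also have "\<dots> = ln K - c n * (a - e/2)"
        using K by (simp add: ln_mult)
      finally have "ln (p n) / c n \<le> (ln K - c n * (a - e/2)) / c n"
        using elim by (intro divide_right_mono) auto
      also have "\<dots> = ln K / c n - (a - e/2)"
        using elim by (simp add: field_simps)
      finally have "ln (p n) / c n \<le> - a + e" using elim(2) by linarith
      then show ?thesis using False by (simp add: log_prob_def)
    qed
  qed
  then have "limsup (\<lambda>n. ereal (1 / c n) * log_prob (p n)) \<le> ereal (- a + e)"
    by (rule Limsup_bounded)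
  then show "limsup (\<lambda>n. ereal (1 / c n) * log_prob (p n)) \<le> ereal (- a) + ereal e"
    by simp
qed

lemma liminf_log_prob_ge:
  fixes c p :: "nat \<Rightarrow> real"
  assumes c: "filterlim c at_top sequentially" and K: "K > 0"
    and bound: "\<And>\<delta>. \<delta> > 0 \<Longrightarrow> \<forall>\<^sub>F n in sequentially. p n \<ge> K * exp (- c n * (r + \<delta>))"
  shows "ereal (- r) \<le> liminf (\<lambda>n. ereal (1 / c n) * log_prob (p n))"
proof (rule ereal_le_epsilon2)
  fix e :: real assume e: "0 < e"
  have K0: "(\<lambda>n. ln K / c n) \<longlonglongrightarrow> 0"
    by (rule tendsto_divide_0[OF tendsto_const filterlim_at_top_imp_at_infinity[OF c]])
  have "\<forall>\<^sub>F n in sequentially. ereal (- r - e) \<le> ereal (1 / c n) * log_prob (p n)"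
    using bound[OF half_gt_zero[OF e]] order_tendstoD(1)[OF K0 neg_less_0_iff_less[THEN iffD2, OF half_gt_zero[OF e]]]
      eventually_gt_at_top[of 0, THEN eventually_compose_filterlim[OF _ c]]
  proof (eventually_elim)
    case (elim n)
    have pos: "0 < K * exp (- c n * (r + e/2))" using K by simp
    then have pn: "p n > 0" using elim e by linarith
    have "- (r + e/2) - e/2 \<le> - (r + e/2) + ln K / c n" using elim e by simp
    also have "\<dots> = (ln K - c n * (r + e/2)) / c n"
      using elim by (simp add: field_simps)
    also have "ln K - c n * (r + e/2) = ln (K * exp (- c n * (r + e/2)))"
      using K by (simp add: ln_mult)
    also have "\<dots> \<le> ln (p n)"
      using elim e pos pn by (subst ln_le_cancel_iff) auto
    finally have "- (r + e/2) - e/2 \<le> ln (p n) / c n"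
      using elim by (simp add: divide_right_mono)
    then show ?case using pn by (simp add: log_prob_def)
  qed
  then have "ereal (- r - e) \<le> liminf (\<lambda>n. ereal (1 / c n) * log_prob (p n))"
    by (rule Liminf_bounded)
  then have "ereal (- r - e) + ereal e \<le> liminf (\<lambda>n. ereal (1 / c n) * log_prob (p n)) + ereal e"
    by (rule add_right_mono)
  then show "ereal (- r) \<le> liminf (\<lambda>n. ereal (1 / c n) * log_prob (p n)) + ereal e"
    by simp
qed

text \<open>Integrability is asked only for large \<open>n\<close> depending on \<open>l\<close>: in
  the application \<open>L\<close> has a small exponential moment, which covers a given
  \<open>l\<close> only once \<open>norm l / M n\<close> falls below it.\<close>

locale gaertner_ellis = prob_space P for P :: "'w measure" +
  fixes Z :: "nat \<Rightarrow> 'w \<Rightarrow> 'a::euclidean_space" and c :: "nat \<Rightarrow> real" and \<Lambda> :: "'a \<Rightarrow> real"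
  assumes Z_measurable [measurable]: "\<And>n. Z n \<in> borel_measurable P"
    and speed: "filterlim c at_top sequentially"
    and mgf_integrable: "\<And>l. \<forall>\<^sub>F n in sequentially. integrable P (\<lambda>\<omega>. exp (c n * (l \<bullet> Z n \<omega>)))"
    and mgf_limit: "\<And>l. (\<lambda>n. ln (expectation (\<lambda>\<omega>. exp (c n * (l \<bullet> Z n \<omega>)))) / c n) \<longlonglongrightarrow> \<Lambda> l"
begin

definition cgf :: "nat \<Rightarrow> 'a \<Rightarrow> real" where
  "cgf n l = ln (expectation (\<lambda>\<omega>. exp (c n * (l \<bullet> Z n \<omega>)))) / c n"

lemma cgf_limit: "(\<lambda>n. cgf n l) \<longlonglongrightarrow> \<Lambda> l"
  unfolding cgf_def by (rule mgf_limit)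

lemma speed_pos: "\<forall>\<^sub>F n in sequentially. c n > 0"
  using filterlim_at_top_dense speed by blast

lemma mgf_eq:
  assumes "integrable P (\<lambda>\<omega>. exp (c n * (l \<bullet> Z n \<omega>)))" "c n > 0"
  shows "expectation (\<lambda>\<omega>. exp (c n * (l \<bullet> Z n \<omega>))) = exp (c n * cgf n l)"
proof -
  have "expectation (\<lambda>\<omega>. exp (c n * (l \<bullet> Z n \<omega>))) > 0"
  proof (rule ccontr)
    assume "\<not> ?thesis"
    then have "expectation (\<lambda>\<omega>. exp (c n * (l \<bullet> Z n \<omega>))) = 0"
      by (meson Bochner_Integration.integral_nonneg antisym_conv exp_ge_zero not_less)
    then have "AE \<omega> in P. exp (c n * (l \<bullet> Z n \<omega>)) = 0"
      by (subst (asm) integral_nonneg_eq_0_iff_AE) (use assms in auto)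
    then show False by (simp add: AE_False)
  qed
  then show ?thesis using assms by (simp add: cgf_def)
qed

lemma Lambda_zero: "\<Lambda> 0 = 0"
  using LIMSEQ_unique[OF mgf_limit[of 0]] by (auto simp: prob_space)

text \<open>Exponential Chebyshev: on the half-space the factor
  \<open>exp (c n * t * (u \<bullet> Z n \<omega> - b))\<close> is at least 1. With
  \<open>l = 0\<close> it yields the upper bound of the principle, with general \<open>l\<close> the
  concentration behind the lower bound. The tilted law is left unnormalised, so no new measure has
  to be built.\<close>

lemma tilted_halfspace_bound:
  assumes int: "integrable P (\<lambda>\<omega>. exp (c n * ((l + t *\<^sub>R u) \<bullet> Z n \<omega>)))" and c: "c n > 0" and t: "t \<ge> 0"
  shows "expectation (\<lambda>\<omega>. exp (c n * (l \<bullet> Z n \<omega>)) * indicator {\<omega>. u \<bullet> Z n \<omega> \<ge> b} \<omega>)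
           \<le> exp (c n * (cgf n (l + t *\<^sub>R u) - t * b))"
proof -
  have "expectation (\<lambda>\<omega>. exp (c n * (l \<bullet> Z n \<omega>)) * indicator {\<omega>. u \<bullet> Z n \<omega> \<ge> b} \<omega>)
      \<le> expectation (\<lambda>\<omega>. exp (- c n * t * b) * exp (c n * ((l + t *\<^sub>R u) \<bullet> Z n \<omega>)))"
  proof (rule integral_mono_AE')
    show "AE x in P. exp (c n * (l \<bullet> Z n x)) * indicator {\<omega>. b \<le> u \<bullet> Z n \<omega>} x
         \<le> exp (- c n * t * b) * exp (c n * ((l + t *\<^sub>R u) \<bullet> Z n x))"
    proof (rule AE_I2)
      fix x
      have "c n * t * b \<le> c n * t * (u \<bullet> Z n x)" if "b \<le> u \<bullet> Z n x"
        using that c t by (intro mult_left_mono) auto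
      then show "exp (c n * (l \<bullet> Z n x)) * indicator {\<omega>. b \<le> u \<bullet> Z n \<omega>} x
         \<le> exp (- c n * t * b) * exp (c n * ((l + t *\<^sub>R u) \<bullet> Z n x))"
        by (auto simp: indicator_def inner_add_left algebra_simps simp flip: exp_add)
    qed
  qed (use int in auto)
  also have "\<dots> = exp (- c n * t * b) * exp (c n * cgf n (l + t *\<^sub>R u))"
    using mgf_eq[OF int c] by simp
  also have "\<dots> = exp (c n * (cgf n (l + t *\<^sub>R u) - t * b))"
    by (simp add: algebra_simps flip: exp_add)
  finally show ?thesis .
qed

lemma halfspace_bound:
  assumes int: "integrable P (\<lambda>\<omega>. exp (c n * (l \<bullet> Z n \<omega>)))" and c: "c n > 0"
  shows "prob {\<omega>\<in>space P. l \<bullet> Z n \<omega> \<ge> b} \<le> exp (c n * (cgf n l - b))"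
proof -
  have "prob {\<omega>\<in>space P. l \<bullet> Z n \<omega> \<ge> b} = expectation (\<lambda>\<omega>. indicator {\<omega>\<in>space P. l \<bullet> Z n \<omega> \<ge> b} \<omega>)"
    by simp
  also have "\<dots> = expectation (\<lambda>\<omega>. exp (c n * (0 \<bullet> Z n \<omega>)) * indicator {\<omega>. l \<bullet> Z n \<omega> \<ge> b} \<omega>)"
    by (intro Bochner_Integration.integral_cong) (auto simp: indicator_def)
  also have "\<dots> \<le> exp (c n * (cgf n l - b))"
    using tilted_halfspace_bound[of n 0 1 l b] assms by simp
  finally show ?thesis .
qed

section \<open>Upper bound for closed sets\<close>

text \<open>The half-spaces attached to the vectors \<open>\<plusminus>e\<close> of the basis cover the complement of a box, so
  exponential tightness needs no separate argument.\<close>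

lemma finite_halfspace_cover:
  assumes F: "closed F" and a: "\<And>x. x \<in> F \<Longrightarrow> ereal a < fenchel_legendre \<Lambda> x"
  obtains T where "finite T" "F \<subseteq> (\<Union>l\<in>T. {y. l \<bullet> y - \<Lambda> l > a})"
proof -
  define B where "B = (Basis \<union> uminus ` Basis :: 'a set)"
  have finB: "finite B" by (simp add: B_def)
  define E where "E = F - (\<Union>l\<in>B. {y. l \<bullet> y - \<Lambda> l > a})"
  have op: "open {y. l \<bullet> y - \<Lambda> l > a}" for l
    by (intro open_Collect_less continuous_intros)
  have "closed E" unfolding E_def using F op by (intro closed_Diff open_UN) auto
  moreover have "bounded E"
  proof (rule boundedI)
    fix y assume y: "y \<in> E"
    have le: "\<bar>y \<bullet> e\<bar> \<le> \<bar>a + \<Lambda> e\<bar> + \<bar>a + \<Lambda> (-e)\<bar>" if e: "e \<in> Basis" for e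
    proof -
      have "e \<in> B" "-e \<in> B" using e by (auto simp: B_def)
      then have "e \<bullet> y - \<Lambda> e \<le> a" "(-e) \<bullet> y - \<Lambda> (-e) \<le> a"
        using y by (auto simp: E_def not_less)
      then show ?thesis by (auto simp: inner_commute)
    qed
    have "norm y \<le> (\<Sum>e\<in>Basis. \<bar>y \<bullet> e\<bar>)" by (rule norm_le_l1)
    also have "\<dots> \<le> (\<Sum>e\<in>Basis. \<bar>a + \<Lambda> e\<bar> + \<bar>a + \<Lambda> (-e)\<bar>)" using le by (rule sum_mono)
    finally show "norm y \<le> (\<Sum>e\<in>Basis. \<bar>a + \<Lambda> e\<bar> + \<bar>a + \<Lambda> (-e)\<bar>)" .
  qed
  ultimately have "compact E" by (simp add: compact_eq_bounded_closed)
  moreover have "E \<subseteq> (\<Union>l\<in>UNIV. {y. l \<bullet> y - \<Lambda> l > a})"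
  proof
    fix x assume "x \<in> E"
    then have "ereal a < (SUP l. ereal (l \<bullet> x - \<Lambda> l))"
      using a by (auto simp: E_def fenchel_legendre_def)
    then obtain l where "ereal a < ereal (l \<bullet> x - \<Lambda> l)" by (auto simp: less_SUP_iff)
    then show "x \<in> (\<Union>l\<in>UNIV. {y. l \<bullet> y - \<Lambda> l > a})" by auto
  qed
  ultimately obtain T where T: "finite T" "E \<subseteq> (\<Union>l\<in>T. {y. l \<bullet> y - \<Lambda> l > a})"
    using compactE_image[of E UNIV "\<lambda>l. {y. l \<bullet> y - \<Lambda> l > a}"] op by auto
  show ?thesis
  proof (rule that)
    show "finite (T \<union> B)" using T finB by simp
    show "F \<subseteq> (\<Union>l\<in>T \<union> B. {y. l \<bullet> y - \<Lambda> l > a})" using T by (auto simp: E_def)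
  qed
qed

lemma upper_bound:
  assumes F: "closed F"
  shows "limsup (\<lambda>n. ereal (1 / c n) * log_prob (prob {\<omega>\<in>space P. Z n \<omega> \<in> F}))
           \<le> - (INF x\<in>F. fenchel_legendre \<Lambda> x)"
proof -
  let ?L = "limsup (\<lambda>n. ereal (1 / c n) * log_prob (prob {\<omega>\<in>space P. Z n \<omega> \<in> F}))"
  have "(INF x\<in>F. fenchel_legendre \<Lambda> x) \<le> - ?L"
  \<comment> \<open>Working at a level strictly below the infimum makes every point of
    \<open>F\<close> fall into an open half-space and treats an infinite infimum together with a
    finite one.\<close>
  proof (rule dense_le)
    fix z assume z: "z < (INF x\<in>F. fenchel_legendre \<Lambda> x)"
    show "z \<le> - ?L"
    proof (cases z)
      case (real a)
      have "ereal a < fenchel_legendre \<Lambda> x" if "x \<in> F" for x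
        using z INF_lower[OF that, of "fenchel_legendre \<Lambda>"] real by (auto intro: less_le_trans)
      from finite_halfspace_cover[OF F this]
      obtain T where T: "finite T" "F \<subseteq> (\<Union>l\<in>T. {y. l \<bullet> y - \<Lambda> l > a})" .
      have cover: "\<exists>l\<in>T. l \<bullet> y \<ge> a + \<Lambda> l" if y: "y \<in> F" for y
      proof -
        obtain l where "l \<in> T" "l \<bullet> y - \<Lambda> l > a" using T(2) y by blast
        then show ?thesis by (intro bexI[of _ l]) auto
      qed
      have "?L \<le> ereal (- a)"
      \<comment> \<open>The summand 1 keeps the constant positive even if \<open>T\<close> is
        empty.\<close>
      proof (rule limsup_log_prob_le[OF speed, of _ "real (card T) + 1"])
        fix \<delta> :: real assume d: "\<delta> > 0"
        have "\<forall>\<^sub>F n in sequentially. \<forall>l\<in>T. integrable P (\<lambda>\<omega>. exp (c n * (l \<bullet> Z n \<omega>)))"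
          using T(1) mgf_integrable by (intro eventually_ball_finite) auto
        moreover have "\<forall>\<^sub>F n in sequentially. \<forall>l\<in>T. cgf n l < \<Lambda> l + \<delta>"
          using T(1) order_tendstoD(2)[OF cgf_limit] d by (intro eventually_ball_finite) auto
        ultimately show "\<forall>\<^sub>F n in sequentially. prob {\<omega>\<in>space P. Z n \<omega> \<in> F}
            \<le> (real (card T) + 1) * exp (- c n * (a - \<delta>))"
          using speed_pos
        proof eventually_elim
          case (elim n)
          have "prob {\<omega>\<in>space P. Z n \<omega> \<in> F} \<le> prob (\<Union>l\<in>T. {\<omega>\<in>space P. l \<bullet> Z n \<omega> \<ge> a + \<Lambda> l})"
          proof (rule finite_measure_mono)
            show "{\<omega>\<in>space P. Z n \<omega> \<in> F} \<subseteq> (\<Union>l\<in>T. {\<omega>\<in>space P. l \<bullet> Z n \<omega> \<ge> a + \<Lambda> l})"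
              using cover by blast
            show "(\<Union>l\<in>T. {\<omega>\<in>space P. l \<bullet> Z n \<omega> \<ge> a + \<Lambda> l}) \<in> events"
              using T(1) by (intro sets.finite_UN) auto
          qed
          also have "\<dots> \<le> (\<Sum>l\<in>T. prob {\<omega>\<in>space P. l \<bullet> Z n \<omega> \<ge> a + \<Lambda> l})"
            using T(1) by (intro finite_measure_subadditive_finite) auto
          also have "\<dots> \<le> (\<Sum>l\<in>T. exp (- c n * (a - \<delta>)))"
          proof (rule sum_mono)
            fix l assume l: "l \<in> T"
            have "prob {\<omega>\<in>space P. l \<bullet> Z n \<omega> \<ge> a + \<Lambda> l} \<le> exp (c n * (cgf n l - (a + \<Lambda> l)))"
              using elim l by (intro halfspace_bound) auto
            also have "c n * (cgf n l - (a + \<Lambda> l)) \<le> c n * (\<delta> - a)"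
              using elim l by (intro mult_left_mono) (auto simp: less_eq_real_def)
            finally show "prob {\<omega>\<in>space P. l \<bullet> Z n \<omega> \<ge> a + \<Lambda> l} \<le> exp (- c n * (a - \<delta>))"
              by (simp add: algebra_simps)
          qed
          also have "\<dots> \<le> (real (card T) + 1) * exp (- c n * (a - \<delta>))"
            by (simp add: algebra_simps)
          finally show ?case .
        qed
      qed auto
      from ereal_minus_le_minus[THEN iffD2, OF this] show ?thesis using real by simp
    qed (use z in auto)
  qed
  from ereal_minus_le_minus[THEN iffD2, OF this] show ?thesis by simp
qed

section \<open>Lower bound for open sets\<close>

text \<open>Maximising \<open>\<langle>l, x\<rangle> - \<Lambda> l - \<epsilon> \<parallel>l\<parallel>\<^sup>2 / 2\<close> yields a maximiser \<open>l\<close> at which \<open>\<Lambda>\<close> has gradient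
  \<open>x - \<epsilon> l\<close>. As \<open>\<epsilon>\<close> tends to 0 these points tend to \<open>x\<close>, and their rate is at most that of \<open>x\<close>;
  this replaces Rockafellar's lemma on exposed points.\<close>

lemma exposed_point_approx:
  assumes cont: "continuous_on UNIV \<Lambda>"
    and diff: "\<And>l u. (\<lambda>t. \<Lambda> (l + t *\<^sub>R u)) differentiable (at 0)"
    and x: "fenchel_legendre \<Lambda> x = ereal r" and d: "d > 0"
  obtains l y where "dist y x < d" "l \<bullet> y - \<Lambda> l \<le> r"
    "\<And>u. ((\<lambda>t. \<Lambda> (l + t *\<^sub>R u)) has_real_derivative u \<bullet> y) (at 0)"
proof -
  have le_r: "l \<bullet> x - \<Lambda> l \<le> r" for l
  proof -
    have "ereal (l \<bullet> x - \<Lambda> l) \<le> fenchel_legendre \<Lambda> x"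
      unfolding fenchel_legendre_def by (rule SUP_upper) simp
    then show ?thesis using x by simp
  qed
  have r0: "r \<ge> 0" using le_r[of 0] Lambda_zero by simp
  \<comment> \<open>Maximality will give that \<open>(\<epsilon> * norm l)\<^sup>2\<close> is at
    most \<open>2 * \<epsilon> * r\<close>, which with this \<epsilon> equals
    \<open>d\<^sup>2 * (r / (2 * r + 1))\<close> and so stays below \<open>d\<^sup>2\<close>. The
    added 1 keeps the denominator positive at \<open>r = 0\<close>.\<close>
  define \<epsilon> where "\<epsilon> = d\<^sup>2 / (2 * (2 * r + 1))"
  have e: "\<epsilon> > 0" using d r0 by (simp add: \<epsilon>_def)
  define f where "f l = l \<bullet> x - \<Lambda> l - \<epsilon> / 2 * (norm l)\<^sup>2" for l
  \<comment> \<open>Beyond this radius the quadratic penalty exceeds \<open>r\<close>, the largest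
    value of the unpenalised part. There \<open>f\<close> is at most \<open>0 = f 0\<close>, and a
    maximiser on the ball is a global one.\<close>
  define R where "R = sqrt (2 * r / \<epsilon>)"
  have R0: "R \<ge> 0" using r0 e by (simp add: R_def)
  have "continuous_on (cball 0 R) f"
    unfolding f_def by (intro continuous_intros continuous_on_subset[OF cont]) auto
  then obtain l where l: "l \<in> cball 0 R" "\<And>k. k \<in> cball 0 R \<Longrightarrow> f k \<le> f l"
    using continuous_attains_sup[of "cball 0 R" f] R0 by auto
  have f0: "f 0 = 0" by (simp add: f_def Lambda_zero)
  have max: "f k \<le> f l" for k
  proof (cases "norm k \<le> R")
    case False
    then have "R\<^sup>2 \<le> (norm k)\<^sup>2" using R0 by (intro power_mono) auto
    then have "2 * r / \<epsilon> \<le> (norm k)\<^sup>2" using r0 e by (simp add: R_def)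
    then have "r \<le> \<epsilon> / 2 * (norm k)\<^sup>2" using e by (simp add: field_simps)
    then have "f k \<le> 0" using le_r[of k] by (simp add: f_def)
    also have "0 \<le> f l" using l(2)[of 0] R0 f0 by simp
    finally show ?thesis .
  qed (use l in auto)
  define y where "y = x - \<epsilon> *\<^sub>R l"
  have fl: "0 \<le> f l" using max[of 0] f0 by simp
  then have "\<epsilon> / 2 * (norm l)\<^sup>2 \<le> r" using le_r[of l] by (simp add: f_def)
  then have "\<epsilon> * (\<epsilon> / 2 * (norm l)\<^sup>2) \<le> \<epsilon> * r" using e by (intro mult_left_mono) auto
  then have "(\<epsilon> * norm l)\<^sup>2 \<le> 2 * \<epsilon> * r" by (simp add: power2_eq_square algebra_simps)
  also have "\<dots> = d\<^sup>2 * (r / (2 * r + 1))" unfolding \<epsilon>_def using r0 by (simp add: divide_simps)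
  also have "\<dots> < d\<^sup>2 * 1" using d r0 by (intro mult_strict_left_mono) (auto simp: field_simps)
  finally have "\<epsilon> * norm l < d" using d by (simp add: power_less_imp_less_base)
  then have dist: "dist y x < d" using e by (simp add: y_def dist_norm)
  have "l \<bullet> y - \<Lambda> l = l \<bullet> x - \<Lambda> l - \<epsilon> * (l \<bullet> l)"
    by (simp add: y_def inner_diff_right)
  also have "\<dots> \<le> r" using le_r[of l] e by (smt (verit) inner_ge_zero mult_nonneg_nonneg)
  finally have le: "l \<bullet> y - \<Lambda> l \<le> r" .
  have der: "((\<lambda>t. \<Lambda> (l + t *\<^sub>R u)) has_real_derivative u \<bullet> y) (at 0)" for u
  proof -
    from diff[of l u] obtain D where D: "((\<lambda>t. \<Lambda> (l + t *\<^sub>R u)) has_real_derivative D) (at 0)"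
      using real_differentiable_def by blast
    define h where "h t = f (l + t *\<^sub>R u)" for t
    have h_eq: "h = (\<lambda>t. l \<bullet> x + t * (u \<bullet> x) - \<Lambda> (l + t *\<^sub>R u)
        - \<epsilon> / 2 * (l \<bullet> l + 2 * t * (l \<bullet> u) + t\<^sup>2 * (u \<bullet> u)))"
      unfolding h_def f_def power2_norm_eq_inner
      by (auto simp: fun_eq_iff inner_add_left inner_add_right
          inner_commute power2_eq_square algebra_simps)
    have "(h has_real_derivative u \<bullet> x - D - \<epsilon> * (l \<bullet> u)) (at 0)"
      unfolding h_eq by (auto intro!: derivative_eq_intros D)
    then have "u \<bullet> x - D - \<epsilon> * (l \<bullet> u) = 0"
      by (rule DERIV_local_max[of _ _ _ 1]) (auto simp: h_def max)
    then have "D = u \<bullet> y" by (simp add: y_def inner_diff_right inner_commute)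
    then show ?thesis using D by simp
  qed
  show ?thesis using that[OF dist le der] .
qed

text \<open>Under the law tilted by \<open>l\<close> the vector \<open>Z n\<close> concentrates at
  the gradient \<open>y\<close>. For small \<open>t > 0\<close> the difference quotient of \<Lambda>
  in direction \<open>u\<close> is below \<open>u \<bullet> y + \<rho> / 2\<close>; tilting further
  by \<open>t *\<^sub>R u\<close> therefore bounds the mass of the half-space by the total mass
  times \<open>exp (- c n * t * \<rho> / 2)\<close>, eventually smaller than any fraction
  \<open>k\<close>.\<close>

lemma tilted_concentration:
  assumes der: "((\<lambda>t. \<Lambda> (l + t *\<^sub>R u)) has_real_derivative u \<bullet> y) (at 0)"
    and \<rho>: "\<rho> > 0" and k: "k > 0"
  shows "\<forall>\<^sub>F n in sequentially.
    expectation (\<lambda>\<omega>. exp (c n * (l \<bullet> Z n \<omega>)) * indicator {\<omega>. u \<bullet> Z n \<omega> \<ge> u \<bullet> y + \<rho>} \<omega>)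
      \<le> k * exp (c n * cgf n l)"
proof -
  have "((\<lambda>t. (\<Lambda> (l + t *\<^sub>R u) - \<Lambda> l) / t) \<longlongrightarrow> u \<bullet> y) (at_right 0)"
    using der filterlim_at_split by (fastforce simp: has_field_derivative_iff)
  then have "\<forall>\<^sub>F t in at_right 0. (\<Lambda> (l + t *\<^sub>R u) - \<Lambda> l) / t < u \<bullet> y + \<rho> / 2"
    using \<rho> by (intro order_tendstoD(2)) auto
  then have "\<forall>\<^sub>F t in at_right 0. (\<Lambda> (l + t *\<^sub>R u) - \<Lambda> l) / t < u \<bullet> y + \<rho> / 2 \<and> t > 0"
    by (intro eventually_conj) (auto simp: eventually_at_right_less)
  then obtain t where t: "(\<Lambda> (l + t *\<^sub>R u) - \<Lambda> l) / t < u \<bullet> y + \<rho> / 2" "t > 0"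
    using eventually_happens[of _ "at_right (0::real)"] by force
  then have t': "\<Lambda> (l + t *\<^sub>R u) - \<Lambda> l - t * (u \<bullet> y + \<rho>) < - t * \<rho> / 2"
    by (simp add: field_simps)
  have "(\<lambda>n. cgf n (l + t *\<^sub>R u) - cgf n l - t * (u \<bullet> y + \<rho>)) \<longlonglongrightarrow>
      \<Lambda> (l + t *\<^sub>R u) - \<Lambda> l - t * (u \<bullet> y + \<rho>)"
    by (intro tendsto_intros cgf_limit)
  note ev = order_tendstoD(2)[OF this t']
  have "t * \<rho> / 2 > 0" using t \<rho> by simp
  \<comment> \<open>From this level on, \<open>exp (- c n * t * \<rho> / 2)\<close> is at most
    \<open>k\<close>.\<close>
  have "\<forall>\<^sub>F n in sequentially. c n \<ge> - ln k / (t * \<rho> / 2)"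
    using speed by (simp add: filterlim_at_top)
  then show ?thesis
    using ev speed_pos mgf_integrable[of "l + t *\<^sub>R u"]
  proof eventually_elim
    case (elim n)
    have "- ln k \<le> c n * (t * \<rho> / 2)"
      using elim(1) \<open>t * \<rho> / 2 > 0\<close> by (simp only: pos_divide_le_eq)
    have "expectation (\<lambda>\<omega>. exp (c n * (l \<bullet> Z n \<omega>)) * indicator {\<omega>. u \<bullet> Z n \<omega> \<ge> u \<bullet> y + \<rho>} \<omega>)
        \<le> exp (c n * (cgf n (l + t *\<^sub>R u) - t * (u \<bullet> y + \<rho>)))"
      using elim t by (intro tilted_halfspace_bound) auto
    also have "c n * (cgf n (l + t *\<^sub>R u) - t * (u \<bullet> y + \<rho>)) \<le> c n * (cgf n l - t * \<rho> / 2)"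
      using elim by (intro mult_left_mono) auto
    also have "\<dots> \<le> ln k + c n * cgf n l"
      using \<open>- ln k \<le> c n * (t * \<rho> / 2)\<close> by (simp add: algebra_simps)
    finally show ?case using k by (simp add: exp_add)
  qed
qed

text \<open>Change of measure. The total tilted mass is \<open>exp (c n * cgf n l)\<close>; finitely
  many half-spaces covering the complement of the ball hold at most half of it. On the ball the
  tilting factor is at most \<open>exp (c n * (l \<bullet> y + \<rho> * norm l))\<close>, and
  dividing by it returns to the original probability.\<close>

lemma lower_bound_ball:
  assumes der: "\<And>u. ((\<lambda>t. \<Lambda> (l + t *\<^sub>R u)) has_real_derivative u \<bullet> y) (at 0)"
    and \<rho>: "\<rho> > 0"
  shows "\<forall>\<^sub>F n in sequentially. prob {\<omega>\<in>space P. Z n \<omega> \<in> ball y \<rho>}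
           \<ge> 1 / 2 * exp (- c n * (l \<bullet> y - cgf n l + \<rho> * norm l))"
proof -
  define B where "B = (Basis \<union> uminus ` Basis :: 'a set)"
  have finB: "finite B" by (simp add: B_def)
  have cB: "card B > 0" using finB by (simp add: B_def card_gt_0_iff)
  \<comment> \<open>A point outside all the half-spaces differs from \<open>y\<close> by at most
    \<rho>' in each coordinate, hence by at most \<open>\<rho> / 2\<close> in the sum norm, which
    keeps it strictly inside the ball.\<close>
  define \<rho>' where "\<rho>' = \<rho> / (2 * DIM('a))"
  have \<rho>': "\<rho>' > 0" using \<rho> by (simp add: \<rho>'_def)
  have cover: "z \<in> ball y \<rho> \<or> (\<exists>u\<in>B. u \<bullet> z \<ge> u \<bullet> y + \<rho>')" for z
  proof (rule ccontr)
    assume "\<not> ?thesis"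
    then have zb: "z \<notin> ball y \<rho>" and zB: "\<And>u. u \<in> B \<Longrightarrow> u \<bullet> z < u \<bullet> y + \<rho>'"
      by (auto simp: not_le)
    have "\<bar>(z - y) \<bullet> e\<bar> \<le> \<rho>'" if "e \<in> Basis" for e
      using zB[of e] zB[of "-e"] that by (auto simp: B_def inner_diff_left inner_diff_right inner_commute)
    then have "(\<Sum>e\<in>Basis. \<bar>(z - y) \<bullet> e\<bar>) \<le> real DIM('a) * \<rho>'"
      by (rule sum_bounded_above)
    then have "norm (z - y) \<le> \<rho> / 2"
      using norm_le_l1[of "z - y"] by (simp add: \<rho>'_def)
    then show False using zb \<rho> by (simp add: dist_norm norm_minus_commute)
  qed
  have "\<forall>\<^sub>F n in sequentially. \<forall>u\<in>B.
    expectation (\<lambda>\<omega>. exp (c n * (l \<bullet> Z n \<omega>)) * indicator {\<omega>. u \<bullet> Z n \<omega> \<ge> u \<bullet> y + \<rho>'} \<omega>)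
      \<le> 1 / (2 * card B) * exp (c n * cgf n l)"
    using finB cB \<rho>' by (intro eventually_ball_finite ballI tilted_concentration der) auto
  then show ?thesis using speed_pos mgf_integrable[of l]
  proof eventually_elim
    case (elim n)
    let ?e = "\<lambda>\<omega>. exp (c n * (l \<bullet> Z n \<omega>))"
    let ?b = "\<lambda>\<omega>. indicator {\<omega>. Z n \<omega> \<in> ball y \<rho>} \<omega> :: real" and ?h = "\<lambda>u \<omega>. indicator {\<omega>. u \<bullet> Z n \<omega> \<ge> u \<bullet> y + \<rho>'} \<omega> :: real"
    let ?p = "prob {\<omega>\<in>space P. Z n \<omega> \<in> ball y \<rho>}" and ?m = "exp (c n * (l \<bullet> y + \<rho> * norm l))"
    have ind_int: "integrable P (\<lambda>\<omega>. ?e \<omega> * ?h u \<omega>)" for u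
      by (rule Bochner_Integration.integrable_bound[OF elim(3)]) (auto simp: indicator_def)
    have ball_int: "integrable P (\<lambda>\<omega>. ?e \<omega> * ?b \<omega>)"
    proof (rule Bochner_Integration.integrable_bound[OF elim(3)])
      have "(\<lambda>\<omega>. indicator (ball y \<rho>) (Z n \<omega>) :: real) \<in> borel_measurable P"
        by (rule measurable_compose[OF Z_measurable borel_measurable_indicator]) simp
      then show "(\<lambda>\<omega>. ?e \<omega> * ?b \<omega>) \<in> borel_measurable P"
        by (simp add: indicator_def)
    qed (auto simp: indicator_def)
    have "exp (c n * cgf n l) = expectation ?e" using mgf_eq elim by simp
    also have "\<dots> \<le> expectation (\<lambda>\<omega>. ?e \<omega> * ?b \<omega>
         + (\<Sum>u\<in>B. ?e \<omega> * ?h u \<omega>))"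
    proof (rule integral_mono)
      show "integrable P (\<lambda>\<omega>. ?e \<omega> * ?b \<omega>
         + (\<Sum>u\<in>B. ?e \<omega> * ?h u \<omega>))"
        using ball_int ind_int by auto
      fix \<omega>
      show "?e \<omega> \<le> ?e \<omega> * ?b \<omega>
         + (\<Sum>u\<in>B. ?e \<omega> * ?h u \<omega>)"
      proof (cases "Z n \<omega> \<in> ball y \<rho>")
        case True
        then show ?thesis by (auto intro!: sum_nonneg)
      next
        case False
        then obtain u where u: "u \<in> B" "u \<bullet> Z n \<omega> \<ge> u \<bullet> y + \<rho>'" using cover by blast
        have "?e \<omega> * ?h u \<omega>
            \<le> (\<Sum>u\<in>B. ?e \<omega> * ?h u \<omega>)"
          using finB u by (intro member_le_sum) auto
        then show ?thesis using u False by simp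
      qed
    qed (use elim in auto)
    also have "\<dots> = expectation (\<lambda>\<omega>. ?e \<omega> * ?b \<omega>)
        + (\<Sum>u\<in>B. expectation (\<lambda>\<omega>. ?e \<omega> * ?h u \<omega>))"
      using ball_int ind_int by (subst Bochner_Integration.integral_add) auto
    also have "(\<Sum>u\<in>B. expectation (\<lambda>\<omega>. ?e \<omega> * ?h u \<omega>))
        \<le> (\<Sum>u\<in>B. 1 / (2 * card B) * exp (c n * cgf n l))"
      using elim by (intro sum_mono) auto
    also have "\<dots> = 1 / 2 * exp (c n * cgf n l)" using cB by simp
    also have "expectation (\<lambda>\<omega>. ?e \<omega> * ?b \<omega>)
        \<le> expectation (\<lambda>\<omega>. ?m * indicator {\<omega>\<in>space P. Z n \<omega> \<in> ball y \<rho>} \<omega>)"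
    proof (rule integral_mono_AE'[OF _ AE_I2])
      fix \<omega> assume "\<omega> \<in> space P"
      have "l \<bullet> Z n \<omega> \<le> l \<bullet> y + \<rho> * norm l" if "Z n \<omega> \<in> ball y \<rho>"
      proof -
        have "l \<bullet> (Z n \<omega> - y) \<le> norm l * norm (Z n \<omega> - y)" by (rule norm_cauchy_schwarz)
        also have "\<dots> \<le> norm l * \<rho>"
          using that by (intro mult_left_mono) (auto simp: dist_norm norm_minus_commute)
        finally show ?thesis by (simp add: inner_diff_right algebra_simps)
      qed
      then show "?e \<omega> * ?b \<omega>
          \<le> ?m * indicator {\<omega>\<in>space P. Z n \<omega> \<in> ball y \<rho>} \<omega>"
        using elim \<open>\<omega> \<in> space P\<close> by (auto simp: indicator_def)
    qed (auto intro!: integrable_real_indicator simp: emeasure_eq_measure)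
    also have "\<dots> = ?m * ?p"
      by simp
    finally have *: "1 / 2 * exp (c n * cgf n l)
        \<le> ?m * ?p"
      by simp
    have "1 / 2 * exp (- c n * (l \<bullet> y - cgf n l + \<rho> * norm l))
        = exp (- (c n * (l \<bullet> y + \<rho> * norm l))) * (1 / 2 * exp (c n * cgf n l))"
      by (simp add: algebra_simps flip: exp_add)
    also have "\<dots> \<le> exp (- (c n * (l \<bullet> y + \<rho> * norm l))) *
        (?m * ?p)"
      using * by (intro mult_left_mono) auto
    also have "\<dots> = ?p"
      by (simp add: exp_minus)
    finally show ?case .
  qed
qed

lemma lower_bound:
  assumes cont: "continuous_on UNIV \<Lambda>"
    and diff: "\<And>l u. (\<lambda>t. \<Lambda> (l + t *\<^sub>R u)) differentiable (at 0)"
    and G: "open G"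
  shows "- (INF x\<in>G. fenchel_legendre \<Lambda> x)
           \<le> liminf (\<lambda>n. ereal (1 / c n) * log_prob (prob {\<omega>\<in>space P. Z n \<omega> \<in> G}))"
proof -
  let ?L = "liminf (\<lambda>n. ereal (1 / c n) * log_prob (prob {\<omega>\<in>space P. Z n \<omega> \<in> G}))"
  have "- ?L \<le> fenchel_legendre \<Lambda> x" if x: "x \<in> G" for x
  proof (cases "fenchel_legendre \<Lambda> x")
    case (real r)
    have "ereal (- r) \<le> ?L"
    proof (rule liminf_log_prob_ge[OF speed, of "1/2"])
      fix \<delta> :: real assume d: "\<delta> > 0"
      obtain d where d: "d > 0" "ball x d \<subseteq> G" using G x openE by blast
      obtain l y where ly: "dist y x < d" "l \<bullet> y - \<Lambda> l \<le> r"
        "\<And>u. ((\<lambda>t. \<Lambda> (l + t *\<^sub>R u)) has_real_derivative u \<bullet> y) (at 0)"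
        using exposed_point_approx[OF cont diff real d(1)] by metis
      \<comment> \<open>The radius is fixed after \<open>l\<close> and \<open>y\<close>: the first
        entry keeps the ball inside \<open>G\<close>, the second limits the loss
        \<open>\<rho> * norm l\<close> in the exponent to \<open>\<delta> / 2\<close>, the other
        half being spent on the convergence of \<open>cgf n l\<close>.\<close>
      define \<rho> where "\<rho> = min (d - dist y x) (\<delta> / 2 / (norm l + 1))"
      have \<rho>: "\<rho> > 0" using ly \<open>\<delta> > 0\<close> by (simp add: \<rho>_def add_nonneg_pos)
      have "\<rho> * norm l \<le> \<rho> * (norm l + 1)" using \<rho> by simp
      also have "\<dots> \<le> \<delta> / 2 / (norm l + 1) * (norm l + 1)"
        by (intro mult_right_mono) (auto simp: \<rho>_def)
      also have "\<dots> = \<delta> / 2"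
        using norm_ge_zero[of l] by (smt (verit) nonzero_eq_divide_eq)
      finally have \<rho>l: "\<rho> * norm l \<le> \<delta> / 2" .
      have sub: "ball y \<rho> \<subseteq> G"
      proof -
        have "ball y \<rho> \<subseteq> ball x d"
        proof
          fix z assume "z \<in> ball y \<rho>"
          then have "dist y z < d - dist y x" by (simp add: \<rho>_def)
          then show "z \<in> ball x d" using dist_triangle[of x z y] by (simp add: dist_commute)
        qed
        then show ?thesis using d by blast
      qed
      have "\<forall>\<^sub>F n in sequentially. cgf n l > \<Lambda> l - \<delta> / 2"
        using \<open>\<delta> > 0\<close> by (intro order_tendstoD(1)[OF cgf_limit]) auto
      then show "\<forall>\<^sub>F n in sequentially. prob {\<omega>\<in>space P. Z n \<omega> \<in> G} \<ge> 1 / 2 * exp (- c n * (r + \<delta>))"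
        using lower_bound_ball[OF ly(3) \<rho>] speed_pos
      proof eventually_elim
        case (elim n)
        have "c n * (l \<bullet> y - cgf n l + \<rho> * norm l) \<le> c n * (r + \<delta>)"
          using elim ly \<rho>l by (intro mult_left_mono) auto
        then have "1 / 2 * exp (- c n * (r + \<delta>)) \<le> 1 / 2 * exp (- c n * (l \<bullet> y - cgf n l + \<rho> * norm l))"
          by simp
        also have "\<dots> \<le> prob {\<omega>\<in>space P. Z n \<omega> \<in> ball y \<rho>}" by (rule elim)
        also have "\<dots> \<le> prob {\<omega>\<in>space P. Z n \<omega> \<in> G}"
          using sub G by (intro finite_measure_mono measurable_sets_Collect[OF Z_measurable]) auto
        finally show ?case .
      qed
    qed auto
    then show ?thesis using real by (simp add: ereal_uminus_le_reorder)
  next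
    case MInf
    have "ereal (0 \<bullet> x - \<Lambda> 0) \<le> fenchel_legendre \<Lambda> x"
      unfolding fenchel_legendre_def by (rule SUP_upper) simp
    then show ?thesis using MInf by simp
  qed auto
  then have "- ?L \<le> (INF x\<in>G. fenchel_legendre \<Lambda> x)" by (rule INF_greatest)
  then show ?thesis by (simp add: ereal_uminus_le_reorder)
qed

theorem LDP:
  assumes cont: "continuous_on UNIV \<Lambda>"
    and diff: "\<And>l u. (\<lambda>t. \<Lambda> (l + t *\<^sub>R u)) differentiable (at 0)"
  shows "follows_LDP P Z c (fenchel_legendre \<Lambda>)"
proof -
  let ?v = "\<lambda>A n. ereal (1 / c n) * log_prob (prob {\<omega>\<in>space P. Z n \<omega> \<in> A})"
  have mono: "\<forall>\<^sub>F n in sequentially. ?v A n \<le> ?v B n"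
    if "A \<subseteq> B" "A \<in> sets borel" "B \<in> sets borel" for A B
    using speed_pos
  proof eventually_elim
    case (elim n)
    have "prob {\<omega>\<in>space P. Z n \<omega> \<in> A} \<le> prob {\<omega>\<in>space P. Z n \<omega> \<in> B}"
      using that by (intro finite_measure_mono) (auto intro: measurable_sets_Collect)
    then have "log_prob (prob {\<omega>\<in>space P. Z n \<omega> \<in> A}) \<le> log_prob (prob {\<omega>\<in>space P. Z n \<omega> \<in> B})"
      using measure_nonneg[of P "{\<omega>\<in>space P. Z n \<omega> \<in> A}"] by (auto simp: log_prob_def less_eq_real_def)
    then show ?case using elim by (intro ereal_mult_left_mono) auto
  qed
  show ?thesis
    unfolding follows_LDP_def
  proof (intro ballI conjI)
    fix A :: "'a set" assume A: "A \<in> sets borel"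
    show "- (INF x\<in>interior A. fenchel_legendre \<Lambda> x) \<le> liminf (?v A)"
      using lower_bound[OF cont diff open_interior, of A]
        Liminf_mono[OF mono[OF interior_subset _ A]]
      by (meson borel_open open_interior order_trans)
    show "limsup (?v A) \<le> - (INF x\<in>closure A. fenchel_legendre \<Lambda> x)"
      using upper_bound[OF closed_closure, of A]
        Limsup_mono[OF mono[OF closure_subset A]]
      by (meson borel_closed closed_closure order_trans)
    show "liminf (?v A) \<le> limsup (?v A)" by (rule Liminf_le_Limsup) simp
  qed
qed

end

section \<open>Regular variation\<close>

text \<open>An interchange of limits: the approximants may depend on \<open>e\<close>, so a cutoff
  or truncation level can be chosen first and the convergence in \<open>t\<close> used afterwards at
  that fixed level.\<close>

lemma tendsto_by_approximation:
  fixes A :: "'b \<Rightarrow> real"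
  assumes "\<And>e. e > 0 \<Longrightarrow> \<exists>A' B'. (A' \<longlongrightarrow> B') F \<and> (\<forall>\<^sub>F t in F. \<bar>A t - A' t\<bar> \<le> e) \<and> \<bar>B - B'\<bar> \<le> e"
  shows "(A \<longlongrightarrow> B) F"
proof (rule tendstoI)
  fix e :: real assume e: "e > 0"
  obtain A' B' where A: "(A' \<longlongrightarrow> B') F" "\<forall>\<^sub>F t in F. \<bar>A t - A' t\<bar> \<le> e / 4" "\<bar>B - B'\<bar> \<le> e / 4"
    using assms[of "e/4"] e by auto
  have "\<forall>\<^sub>F t in F. dist (A' t) B' < e / 4" using A(1) e by (intro tendstoD) auto
  with A(2) show "\<forall>\<^sub>F t in F. dist (A t) B < e"
  proof eventually_elim
    case (elim t)
    then show ?case using A(3) e unfolding dist_real_def abs_le_iff abs_less_iff by linarith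
  qed
qed

lemma abs_diff_divide: "c > 0 \<Longrightarrow> \<bar>x / c - y / c\<bar> = \<bar>x - y\<bar> / c" for c x y :: real
  by (simp add: abs_divide flip: diff_divide_distrib)

lemma scale_measure_eq_density: "scale_measure r M = density M (\<lambda>_. r)"
  by (rule measure_eqI) (simp_all add: emeasure_density_const)

lemma integral_scale_measure:
  fixes f :: "'b \<Rightarrow> real"
  assumes "c \<ge> 0" "f \<in> borel_measurable M"
  shows "integral\<^sup>L (scale_measure (ennreal c) M) f = c * integral\<^sup>L M f"
  unfolding scale_measure_eq_density using assms by (subst integral_density) auto

text \<open>\<open>measure_of\<close> falls back to the zero measure when its set function is not
  countably additive. Agreement with an existing measure settles additivity and the values at once;
  this is how the spectral measure and \<nu> become push-forwards of \<mu>.\<close>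

lemma measure_of_restrict_borel_eq:
  assumes M: "space M = S" "sets M = sets (restrict_space borel S)"
    and f: "\<And>A. A \<in> sets M \<Longrightarrow> f A = emeasure M A"
  shows "measure_of S (sets (restrict_space borel S)) f = M"
proof -
  have "measure_of (space M) (sets M) f = measure_of (space M) (sets M) (emeasure M)"
    using f by (intro measure_of_eq sets.space_closed) (simp add: sets.sigma_sets_eq)
  also have "\<dots> = M" by (rule measure_of_of_measure)
  finally show ?thesis unfolding M .
qed

section \<open>Radial clipping\<close>

text \<open>The radial projection of \<open>x / s\<close> onto the closed unit ball. Written as one
  division by a maximum, it is visibly continuous and needs no case distinction at
  \<open>norm x = s\<close>.\<close>

definition clip :: "real \<Rightarrow> 'a::real_normed_vector \<Rightarrow> 'a" where
  "clip s x = x /\<^sub>R max s (norm x)"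

lemma norm_clip: "s > 0 \<Longrightarrow> norm (clip s x) = norm x / max s (norm x)"
  by (simp add: clip_def divide_inverse)

lemma norm_clip_le_1: "s > 0 \<Longrightarrow> norm (clip s x) \<le> 1"
  by (auto simp: norm_clip divide_simps)

lemma norm_clip_le: "s > 0 \<Longrightarrow> norm (clip s x) \<le> norm x / s"
  by (auto simp: norm_clip intro!: divide_left_mono)

lemma norm_clip_eq_min: "s > 0 \<Longrightarrow> norm (clip s x) = min (norm x) s / s"
  by (auto simp: norm_clip min_def max_def)

lemma clip_inside: "s > 0 \<Longrightarrow> norm x \<le> s \<Longrightarrow> clip s x = x /\<^sub>R s"
  by (simp add: clip_def max_def)

lemma clip_outside: "s > 0 \<Longrightarrow> norm x \<ge> s \<Longrightarrow> clip s x = x /\<^sub>R norm x"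
  by (simp add: clip_def max_def)

lemma clip_zero [simp]: "clip s 0 = 0"
  by (simp add: clip_def)

lemma clip_minus: "clip s (- x) = - clip s x"
  by (simp add: clip_def)

lemma clip_scale: "a > 0 \<Longrightarrow> s > 0 \<Longrightarrow> clip (a * s) x = clip s (x /\<^sub>R a)"
proof -
  assume a: "a > 0" "s > 0"
  have "max s (norm x / a) * a = max (a * s) (norm x)"
    using a by (auto simp: max_def field_simps)
  then show ?thesis using a by (simp add: clip_def divide_inverse mult.commute flip: inverse_mult_distrib)
qed

lemma continuous_on_clip: "s > 0 \<Longrightarrow> continuous_on A (clip s)"
  unfolding clip_def by (intro continuous_intros) (auto simp: max_def)

lemma borel_measurable_clip [measurable]:
  "(clip s :: 'a::euclidean_space \<Rightarrow> 'a) \<in> borel_measurable borel"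
  unfolding clip_def by measurable

text \<open>The bound is uniform in \<open>x\<close>, so a scale that converges with
  \<open>t\<close> may be replaced by its limit inside an integral.\<close>

lemma clip_diff_le:
  assumes "s > 0" "r > 0"
  shows "norm (clip s x - clip r x) \<le> \<bar>s - r\<bar> / r"
proof -
  have "clip s x - clip r x = (inverse (max s (norm x)) - inverse (max r (norm x))) *\<^sub>R x"
    by (simp add: clip_def algebra_simps)
  also have "norm \<dots> = \<bar>max r (norm x) - max s (norm x)\<bar> / max r (norm x) * (norm x / max s (norm x))"
    using assms by (auto simp: inverse_diff_inverse abs_mult max_def divide_simps)
  also have "\<dots> \<le> \<bar>max r (norm x) - max s (norm x)\<bar> / max r (norm x) * 1"
    using assms by (intro mult_left_mono) (auto simp: divide_simps)
  also have "\<dots> \<le> \<bar>s - r\<bar> / r"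
    using assms by (simp, intro frac_le) (auto simp: max_def)
  finally show ?thesis .
qed

text \<open>The limit of the one-step generating function depends on \<open>H\<close> only through
  its law, so the sample space is dropped here and the random vector becomes the identity on the
  Euclidean space.\<close>

locale regularly_varying_law = prob_space N for N :: "'a::euclidean_space measure" +
  fixes \<mu> :: "'a measure" and a :: "nat \<Rightarrow> real" and \<alpha> :: real
  assumes sets_N [simp, measurable_cong]: "sets N = sets borel"
    and mu_radon: "radon_measure_on (- {0}) \<mu>"
    and mu_nonnull: "emeasure \<mu> (space \<mu>) \<noteq> 0"
    and a_lim: "filterlim a at_top sequentially"
    and vague: "vaguely_converges_on punctured_compactification
                  (\<lambda>n. extend_measure0 (scaled_law N (\<lambda>h. h) n (a n))) (extend_measure0 \<mu>)"
    and alpha_pos: "0 < \<alpha>"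
    and mu_scaling: "\<And>c A. c > 0 \<Longrightarrow> A \<in> sets \<mu> \<Longrightarrow>
                  emeasure \<mu> ((*\<^sub>R) c ` A) = ennreal (c powr (- \<alpha>)) * emeasure \<mu> A"
begin

lemma space_N [simp]: "space N = UNIV"
  using sets_eq_imp_space_eq[OF sets_N] by simp

lemma prob_UNIV [simp]: "prob UNIV = 1"
  using prob_space by simp

lemma sets_mu: "sets \<mu> = sets (restrict_space borel (- {0}))"
  using mu_radon by (simp add: radon_measure_on_def)

lemma space_mu: "space \<mu> = - {0}"
  using sets_eq_imp_space_eq[OF sets_mu] by (simp add: space_restrict_space)

lemma in_sets_mu: "A \<in> sets \<mu> \<longleftrightarrow> A \<in> sets borel \<and> 0 \<notin> A"
  unfolding sets_mu by (subst sets_restrict_space_iff) auto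

lemma measurable_mu: "f \<in> measurable borel M \<Longrightarrow> f \<in> measurable \<mu> M"
  using measurable_cong_sets[OF sets_mu refl] measurable_restrict_space1 by blast

definition U :: "real \<Rightarrow> real" where
  "U t = prob {h. norm h > t}"

definition mass :: real where
  "mass = measure \<mu> (- cball 0 1)"

section \<open>Tails and scaling of the limit measure\<close>

lemma measurable_embed: "embed_compactification \<in> measurable borel borel"
  unfolding embed_compactification_def by measurable

lemma embed_in: "x \<noteq> 0 \<Longrightarrow> embed_compactification x \<in> punctured_compactification"
  using norm_ge_zero[of x]
  by (auto simp: embed_compactification_def punctured_compactification_def divide_simps
      add_nonneg_eq_0_iff simp del: norm_ge_zero)

lemma measurable_embed_restrict:
  assumes "sets M = sets (restrict_space borel (- {0}))"
  shows "embed_compactification \<in> measurable M (restrict_space borel punctured_compactification)"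
proof (rule measurable_restrict_space2)
  have "space M = - {0}" using sets_eq_imp_space_eq[OF assms] by (simp add: space_restrict_space)
  then show "embed_compactification \<in> space M \<rightarrow> punctured_compactification" using embed_in by auto
  show "embed_compactification \<in> borel_measurable M"
    using measurable_cong_sets[OF assms refl] measurable_restrict_space1[OF measurable_embed] by blast
qed

lemma integral_extend_measure0:
  fixes f :: "'a \<Rightarrow> real"
  assumes "sets M = sets (restrict_space borel (- {0}))" "continuous_on punctured_compactification f"
  shows "integral\<^sup>L (extend_measure0 M) f = (LINT x|M. f (embed_compactification x))"
  unfolding extend_measure0_def
  using assms by (intro integral_distr measurable_embed_restrict borel_measurable_continuous_on_restrict)

text \<open>The Radon property is used on the compactification: there the complement of a ball,
  together with the sphere at infinity, is compact. On the punctured space itself it would bound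
  only shells of finite radius.\<close>

lemma mu_tail_finite:
  assumes s: "s > 0"
  shows "emeasure \<mu> {x. norm x \<ge> s} < \<infinity>"
proof -
  \<comment> \<open>The embedding sends the sphere of radius \<open>s\<close> to the sphere of
    radius \<open>s / (1 + s)\<close>.\<close>
  define K :: "'a set" where "K = cball 0 1 - ball 0 (s / (1 + s))"
  have "s / (1 + s) > 0" using s by simp
  then have K: "compact K" "K \<subseteq> punctured_compactification"
    unfolding K_def punctured_compactification_def by (auto intro!: compact_diff)
  then have fin: "emeasure (extend_measure0 \<mu>) K < \<infinity>"
    using vague by (auto simp: vaguely_converges_on_def radon_measure_on_def)
  have "emeasure (extend_measure0 \<mu>) K = emeasure \<mu> (embed_compactification -` K \<inter> space \<mu>)"
    unfolding extend_measure0_def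
  proof (rule emeasure_distr[OF measurable_embed_restrict[OF sets_mu]])
    have "K \<in> sets borel" using K(1) by (simp add: compact_imp_closed)
    then show "K \<in> sets (restrict_space borel punctured_compactification)"
      using K(2) by (subst sets_restrict_space_iff) (auto simp: punctured_compactification_def)
  qed
  also have "embed_compactification -` K \<inter> space \<mu> = {x. norm x \<ge> s}"
  proof -
    have "embed_compactification x \<in> K \<longleftrightarrow> norm x \<ge> s" for x :: 'a
    proof -
      have pos: "1 + norm x > 0" "1 + s > 0" using s by (auto simp: add_pos_nonneg)
      have "norm (embed_compactification x) = norm x / (1 + norm x)"
        by (simp add: embed_compactification_def divide_inverse)
      moreover have "norm x / (1 + norm x) \<le> 1" using pos by simp
      moreover have "s / (1 + s) \<le> norm x / (1 + norm x) \<longleftrightarrow> s \<le> norm x"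
        using pos by (simp add: divide_le_eq le_divide_eq) (simp add: field_simps)
      ultimately show ?thesis by (auto simp: K_def)
    qed
    then show ?thesis using s by (auto simp: space_mu)
  qed
  finally show ?thesis using fin by simp
qed

lemma mu_open_tail_finite: "s > 0 \<Longrightarrow> emeasure \<mu> {x. norm x > s} < \<infinity>"
  by (rule le_less_trans[OF emeasure_mono mu_tail_finite[of s]]) (auto simp: in_sets_mu)

lemma mu_image_scale:
  assumes s: "s > 0" and A: "A \<in> sets borel" "0 \<notin> A"
  shows "emeasure \<mu> {x. x /\<^sub>R s \<in> A} = ennreal (s powr (- \<alpha>)) * emeasure \<mu> A"
proof -
  have "(*\<^sub>R) s ` A = {x. x /\<^sub>R s \<in> A}"
  proof (intro set_eqI iffI)
    fix x assume "x \<in> {x. x /\<^sub>R s \<in> A}"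
    then show "x \<in> (*\<^sub>R) s ` A" using s by (intro image_eqI[of _ _ "x /\<^sub>R s"]) auto
  qed (use s in auto)
  then show ?thesis using mu_scaling[of s A] A s by (simp add: in_sets_mu)
qed

lemma emeasure_mu_unit_tail: "emeasure \<mu> {x. norm x > 1} = ennreal mass"
proof -
  have *: "- cball 0 1 = {x::'a. norm x > 1}" by auto
  show ?thesis
    unfolding mass_def * using mu_open_tail_finite[of 1] by (intro emeasure_eq_ennreal_measure) simp
qed

lemma emeasure_mu_tail:
  assumes s: "s > 0"
  shows "emeasure \<mu> {x. norm x > s} = ennreal (mass * s powr (- \<alpha>))"
proof -
  have "{x::'a. norm x > s} = {x. x /\<^sub>R s \<in> {x. norm x > 1}}"
    using s by (auto simp: field_simps)
  then have "emeasure \<mu> {x. norm x > s} = ennreal (s powr (- \<alpha>)) * ennreal mass"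
    using mu_image_scale[OF s, of "{x. norm x > 1}"] by (simp add: emeasure_mu_unit_tail)
  also have "\<dots> = ennreal (mass * s powr (- \<alpha>))"
    by (simp add: ennreal_mult'' mass_def mult.commute)
  finally show ?thesis .
qed

text \<open>By scaling, a vanishing mass outside the unit ball would make every tail null, and
  countably many tails exhaust the punctured space.\<close>

lemma mass_pos: "mass > 0"
proof (rule ccontr)
  assume "\<not> mass > 0"
  then have m0: "mass = 0" using measure_nonneg[of \<mu> "- cball 0 1"] by (simp add: mass_def)
  have "emeasure \<mu> (\<Union>n::nat. {x. norm x > 1 / real (Suc n)}) = 0"
  proof (rule emeasure_UN_eq_0)
    fix n :: nat
    show "emeasure \<mu> {x. norm x > 1 / real (Suc n)} = 0"
      using emeasure_mu_tail[of "1 / real (Suc n)"] m0 by simp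
    show "range (\<lambda>n::nat. {x::'a. norm x > 1 / real (Suc n)}) \<subseteq> sets \<mu>"
      by (auto simp: in_sets_mu)
  qed
  moreover have "(\<Union>n::nat. {x. norm x > 1 / real (Suc n)}) = - {0::'a}"
  proof (intro set_eqI iffI)
    fix x :: 'a assume "x \<in> - {0}"
    then obtain n :: nat where "inverse (real (Suc n)) < norm x"
      using reals_Archimedean[of "norm x"] by auto
    then show "x \<in> (\<Union>n::nat. {x. norm x > 1 / real (Suc n)})"
      by (auto simp: divide_inverse)
  next
    fix x :: 'a assume "x \<in> (\<Union>n::nat. {x. norm x > 1 / real (Suc n)})"
    then obtain n :: nat where "norm x > 1 / real (Suc n)" by auto
    moreover have "1 / real (Suc n) > 0" by simp
    ultimately have "norm x > 0" by linarith
    then show "x \<in> - {0}" by simp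
  qed
  ultimately show False using mu_nonnull by (simp add: space_mu)
qed

lemma integral_mu_scale:
  fixes f :: "'a \<Rightarrow> real"
  assumes s: "s > 0" and f: "f \<in> borel_measurable borel"
  shows "(LINT x|\<mu>. f (x /\<^sub>R s)) = s powr (- \<alpha>) * (LINT x|\<mu>. f x)"
proof -
  have meas: "(\<lambda>x. x /\<^sub>R s) \<in> measurable \<mu> \<mu>"
  proof -
    have "(\<lambda>x. x /\<^sub>R s) \<in> measurable \<mu> (restrict_space borel (- {0}))"
    proof (rule measurable_restrict_space2)
      show "(\<lambda>x. x /\<^sub>R s) \<in> space \<mu> \<rightarrow> - {0}" using s by (auto simp: space_mu)
      show "(\<lambda>x. x /\<^sub>R s) \<in> borel_measurable \<mu>" by (rule measurable_mu) measurable
    qed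
    then show ?thesis using measurable_cong_sets[OF refl sets_mu, of \<mu>] by simp
  qed
  have eq: "distr \<mu> \<mu> (\<lambda>x. x /\<^sub>R s) = scale_measure (ennreal (s powr (- \<alpha>))) \<mu>"
  proof (rule measure_eqI)
    fix A assume "A \<in> sets (distr \<mu> \<mu> (\<lambda>x. x /\<^sub>R s))"
    then have A: "A \<in> sets \<mu>" by simp
    have "emeasure (distr \<mu> \<mu> (\<lambda>x. x /\<^sub>R s)) A = emeasure \<mu> ((\<lambda>x. x /\<^sub>R s) -` A \<inter> space \<mu>)"
      using meas A by (rule emeasure_distr)
    also have "(\<lambda>x. x /\<^sub>R s) -` A \<inter> space \<mu> = {x. x /\<^sub>R s \<in> A}"
      using A s by (auto simp: space_mu in_sets_mu)
    also have "emeasure \<mu> \<dots> = ennreal (s powr (- \<alpha>)) * emeasure \<mu> A"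
      using A s by (intro mu_image_scale) (auto simp: in_sets_mu)
    finally show "emeasure (distr \<mu> \<mu> (\<lambda>x. x /\<^sub>R s)) A
        = emeasure (scale_measure (ennreal (s powr (- \<alpha>))) \<mu>) A" by simp
  qed simp
  have "(LINT x|\<mu>. f (x /\<^sub>R s)) = integral\<^sup>L (distr \<mu> \<mu> (\<lambda>x. x /\<^sub>R s)) f"
    using measurable_mu[OF f] by (intro integral_distr[symmetric] meas)
  also have "\<dots> = s powr (- \<alpha>) * (LINT x|\<mu>. f x)"
    unfolding eq using measurable_mu[OF f] by (intro integral_scale_measure) auto
  finally show ?thesis .
qed

section \<open>Limits along the normalising sequence\<close>

lemma integral_scaled_law:
  fixes f :: "'a \<Rightarrow> real"
  assumes f: "f \<in> borel_measurable borel" "f 0 = 0"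
  shows "integral\<^sup>L (scaled_law N (\<lambda>h. h) n b) f = real n * (LINT h|N. f (h /\<^sub>R b))"
proof -
  let ?D = "distr N borel (\<lambda>h. h /\<^sub>R b)"
  have m: "(\<lambda>h. h /\<^sub>R b) \<in> measurable N borel" by measurable
  have fm: "f \<in> borel_measurable (restrict_space ?D (- {0}))"
    by (rule measurable_restrict_space1) (simp add: f)
  have "integral\<^sup>L (scaled_law N (\<lambda>h. h) n b) f = real n * integral\<^sup>L (restrict_space ?D (- {0})) f"
    unfolding scaled_law_def ennreal_of_nat_eq_real_of_nat
    using fm by (intro integral_scale_measure) auto
  also have "integral\<^sup>L (restrict_space ?D (- {0})) f = (LINT h|?D. indicator (- {0}) h *\<^sub>R f h)"
    by (rule integral_restrict_space) simp
  also have "\<dots> = (LINT h|?D. f h)"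
    using f by (intro Bochner_Integration.integral_cong) (auto simp: indicator_def)
  also have "\<dots> = (LINT h|N. f (h /\<^sub>R b))"
    by (rule integral_distr[OF m f(1)])
  finally show ?thesis .
qed

text \<open>Composed with a clipping map, such a function extends continuously to the
  compactification and vanishes near the origin, which is what vague convergence asks for. Only its
  values on the closed unit ball matter, so no growth condition is imposed.\<close>

definition test_function :: "('a \<Rightarrow> real) \<Rightarrow> bool" where
  "test_function F \<longleftrightarrow> continuous_on UNIV F \<and> (\<exists>\<delta>>0. \<forall>y. norm y \<le> \<delta> \<longrightarrow> F y = 0)"

lemma test_function_measurable:
  "test_function F \<Longrightarrow> F \<in> borel_measurable borel"
  by (simp add: test_function_def borel_measurable_continuous_onI)

text \<open>On the closed unit ball modelling the compactification, the clipping map \<open>clip s\<close> becomes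
  \<open>y \<mapsto> y / max (s (1 - \<parallel>y\<parallel>)) \<parallel>y\<parallel>\<close>, which is continuous up to the sphere at infinity.\<close>

lemma vague_test_function:
  assumes F: "test_function F" and s: "s > 0"
  shows "(\<lambda>n. real n * (LINT h|N. F (clip s (h /\<^sub>R a n)))) \<longlonglongrightarrow> (LINT x|\<mu>. F (clip s x))"
proof -
  from F obtain \<delta> where F: "continuous_on UNIV F" and d: "\<delta> > 0" "\<And>y. norm y \<le> \<delta> \<Longrightarrow> F y = 0"
    by (auto simp: test_function_def)
  have [measurable]: "F \<in> borel_measurable borel"
    using F by (rule borel_measurable_continuous_onI)
  define G where "G y = y /\<^sub>R max (s * (1 - norm y)) (norm y)" for y :: 'a
  define f where "f y = F (G y)" for y
  have f_embed: "f (embed_compactification x) = F (clip s x)" for x :: 'a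
  proof -
    have p: "1 + norm x > 0" by (simp add: add_pos_nonneg)
    have n: "norm (embed_compactification x) = norm x / (1 + norm x)"
      by (simp add: embed_compactification_def divide_inverse)
    have "1 - norm x / (1 + norm x) = 1 / (1 + norm x)" using p by (simp add: field_simps)
    then have "max (s * (1 - norm x / (1 + norm x))) (norm x / (1 + norm x))
        = max s (norm x) / (1 + norm x)"
      using p by (simp add: max_def divide_le_cancel)
    then have "G (embed_compactification x) = clip s x"
      unfolding G_def n clip_def using p by (simp add: embed_compactification_def divide_inverse)
    then show ?thesis by (simp add: f_def)
  qed
  \<comment> \<open>The embedded radius of the sphere \<open>norm x = s * \<delta>\<close>; inside
    it the clipped vector has norm at most \<delta>, where \<open>F\<close> vanishes.\<close>
  define \<eta> where "\<eta> = s * \<delta> / (1 + s * \<delta>)"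
  have e: "\<eta> > 0" using s d by (simp add: \<eta>_def add_pos_pos)
  define K :: "'a set" where "K = cball 0 1 - ball 0 \<eta>"
  have cont: "continuous_on punctured_compactification f"
    unfolding f_def
  proof (rule continuous_on_compose2[OF F])
    show "continuous_on punctured_compactification G"
      unfolding G_def using s
      by (intro continuous_intros) (auto simp: punctured_compactification_def max_def)
  qed simp
  have K: "compact K" "K \<subseteq> punctured_compactification"
    unfolding K_def punctured_compactification_def using e by (auto intro!: compact_diff)
  have vanish: "f y = 0" if "y \<in> punctured_compactification - K" for y
  proof -
    have y: "norm y < \<eta>" "y \<noteq> 0" using that by (auto simp: punctured_compactification_def K_def)
    have sd: "1 + s * \<delta> > 0" using s d by (simp add: add_pos_pos)
    have "norm y * (1 + s * \<delta>) \<le> s * \<delta>" using y sd by (simp add: \<eta>_def field_simps)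
    then have "norm y \<le> \<delta> * (s * (1 - norm y))" by (simp add: algebra_simps)
    also have "\<dots> \<le> \<delta> * max (s * (1 - norm y)) (norm y)" using d by (intro mult_left_mono) auto
    finally have "norm y / max (s * (1 - norm y)) (norm y) \<le> \<delta>"
      using y by (subst pos_divide_le_eq) (auto simp: less_max_iff_disj)
    moreover have "norm (G y) = norm y / max (s * (1 - norm y)) (norm y)"
      using y by (simp add: G_def divide_inverse abs_of_nonneg le_max_iff_disj)
    ultimately show ?thesis unfolding f_def by (intro d) simp
  qed
  have "(\<lambda>n. integral\<^sup>L (extend_measure0 (scaled_law N (\<lambda>h. h) n (a n))) f)
      \<longlonglongrightarrow> integral\<^sup>L (extend_measure0 \<mu>) f"
    using vague cont K vanish unfolding vaguely_converges_on_def by blast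
  moreover have "integral\<^sup>L (extend_measure0 \<mu>) f = (LINT x|\<mu>. F (clip s x))"
    using integral_extend_measure0[OF sets_mu cont] by (simp add: f_embed)
  moreover have "integral\<^sup>L (extend_measure0 (scaled_law N (\<lambda>h. h) n (a n))) f
      = real n * (LINT h|N. F (clip s (h /\<^sub>R a n)))" for n
  proof -
    have "sets (scaled_law N (\<lambda>h. h) n (a n)) = sets (restrict_space borel (- {0}))"
      unfolding scaled_law_def by (simp add: sets_restrict_space)
    from integral_extend_measure0[OF this cont]
    have "integral\<^sup>L (extend_measure0 (scaled_law N (\<lambda>h. h) n (a n))) f
        = (LINT x|scaled_law N (\<lambda>h. h) n (a n). F (clip s x))" by (simp add: f_embed)
    also have "\<dots> = real n * (LINT h|N. F (clip s (h /\<^sub>R a n)))"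
      using d by (intro integral_scaled_law) auto
    finally show ?thesis .
  qed
  ultimately show ?thesis by simp
qed

lemma U_nonneg: "U t \<ge> 0"
  by (simp add: U_def)

lemma U_antimono: "s \<le> t \<Longrightarrow> U t \<le> U s"
  unfolding U_def by (intro finite_measure_mono) auto

lemma a_pos: "\<forall>\<^sub>F n in sequentially. a n > 0"
  using a_lim by (simp add: filterlim_at_top_dense)

text \<open>A continuous stand-in for tail indicators: clipping at \<open>s\<close> gives norm 1 to
  every vector of norm at least \<open>s\<close>, so the ramp of the clipped vector lies between the
  indicators of \<open>norm x > s\<close> and \<open>norm x > s * u\<close>.\<close>

definition ramp :: "real \<Rightarrow> 'a \<Rightarrow> real" where
  "ramp u y = max 0 (min 1 ((norm y - u) / (1 - u)))"

lemma ramp_test_function: "0 < u \<Longrightarrow> u < 1 \<Longrightarrow> test_function (ramp u)"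
  unfolding test_function_def ramp_def
  by (intro conjI continuous_intros exI[of _ u]) (auto simp: max_def min_def divide_simps)

lemma ramp_bounds: "0 \<le> ramp u y" "ramp u y \<le> 1"
  by (auto simp: ramp_def)

lemma ramp_one: "u < 1 \<Longrightarrow> norm y \<ge> 1 \<Longrightarrow> ramp u y = 1"
  by (auto simp: ramp_def min_def max_def divide_simps)

lemma ramp_zero: "u < 1 \<Longrightarrow> norm y \<le> u \<Longrightarrow> ramp u y = 0"
  by (auto simp: ramp_def min_def max_def divide_simps)

lemma norm_clip_one: "s > 0 \<Longrightarrow> norm x \<ge> s \<Longrightarrow> norm (clip s x) = 1"
  by (auto simp: norm_clip max_def)

lemma ramp_clip_le:
  assumes "0 < u" "u < 1" "s > 0"
  shows "ramp u (clip s x) \<le> indicator {x. norm x > s * u} x"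
proof (cases "norm x > s * u")
  case False
  have "norm (clip s x) \<le> norm x / s" using assms by (intro norm_clip_le)
  also have "\<dots> \<le> u" using False assms by (simp add: field_simps)
  finally show ?thesis using False assms by (simp add: ramp_zero)
qed (simp add: ramp_bounds)

lemma le_ramp_clip:
  assumes "0 < u" "u < 1" "s > 0"
  shows "indicator {x. norm x > s} x \<le> ramp u (clip s x)"
  using assms by (auto simp: indicator_def ramp_bounds norm_clip_one ramp_one)

lemma integrable_mu_indicator:
  "s > 0 \<Longrightarrow> integrable \<mu> (indicator {x. norm x > s} :: 'a \<Rightarrow> real)"
  using mu_open_tail_finite[of s] by (auto simp: in_sets_mu)

lemma integral_mu_indicator:
  "s > 0 \<Longrightarrow> (LINT x|\<mu>. indicator {x. norm x > s} x) = mass * s powr (- \<alpha>)"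
proof -
  assume s: "s > 0"
  have "{x::'a. norm x > s} \<inter> space \<mu> = {x. norm x > s}" using s by (auto simp: space_mu)
  then show ?thesis using emeasure_mu_tail[OF s] mass_pos by (simp add: measure_def)
qed

lemma integrable_mu_bounded:
  fixes f :: "'a \<Rightarrow> real"
  assumes "f \<in> borel_measurable borel" "s > 0" "\<And>x. \<bar>f x\<bar> \<le> C * indicator {x. norm x > s} x"
  shows "integrable \<mu> f"
proof (rule Bochner_Integration.integrable_bound)
  show "integrable \<mu> (\<lambda>x. C * indicator {x. norm x > s} x :: real)"
    using integrable_mu_indicator[OF assms(2)] by (rule integrable_mult_right)
  have "\<bar>f x\<bar> \<le> \<bar>C * indicator {x. norm x > s} x\<bar>" for x using assms(3)[of x] by linarith
  then show "AE x in \<mu>. norm (f x) \<le> norm (C * indicator {x. norm x > s} x :: real)" by auto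
qed (rule measurable_mu[OF assms(1)])

lemma integrable_ramp_mu:
  assumes "0 < u" "u < 1" "s > 0"
  shows "integrable \<mu> (\<lambda>x. ramp u (clip s x))"
proof (rule integrable_mu_bounded[where s = "s * u" and C = 1])
  have [measurable]: "ramp u \<in> borel_measurable borel"
    using assms by (intro test_function_measurable ramp_test_function)
  show "(\<lambda>x. ramp u (clip s x)) \<in> borel_measurable borel" by measurable
qed (use assms ramp_clip_le ramp_bounds in auto)

lemma integrable_N_bounded:
  fixes f :: "'a \<Rightarrow> real"
  assumes "f \<in> borel_measurable borel" "\<And>x. \<bar>f x\<bar> \<le> C"
  shows "integrable N f"
  using assms by (intro integrable_const_bound[of _ C]) auto

lemma integral_N_indicator: "(LINT h|N. indicator {h. norm h > t} h) = U t"
  by (simp add: U_def)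

text \<open>A portmanteau argument. The ramp at scale \<open>s\<close> bounds the tail from above
  and leads to \<open>mass * (s * u) powr (- \<alpha>)\<close>; the ramp at scale
  \<open>s / u\<close> bounds it from below and leads to
  \<open>mass * (s / u) powr (- \<alpha>)\<close>. Both agree in the limit as \<open>u\<close> tends
  to 1.\<close>

lemma scaled_tail_limit:
  assumes s: "s > 0"
  shows "(\<lambda>n. real n * U (a n * s)) \<longlonglongrightarrow> mass * s powr (- \<alpha>)"
proof -
  have rm: "ramp u \<in> borel_measurable borel" if "0 < u" "u < 1" for u
    using that by (intro test_function_measurable ramp_test_function)
  have upper: "\<forall>\<^sub>F n in sequentially. real n * U (a n * s) < y"
    if u: "0 < u" "u < 1" and y: "mass * (s * u) powr (- \<alpha>) < y" for u y
  proof -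
    note [measurable] = rm[OF u]
    have "(LINT x|\<mu>. ramp u (clip s x)) \<le> (LINT x|\<mu>. indicator {x. norm x > s * u} x)"
      using u s by (intro integral_mono integrable_ramp_mu integrable_mu_indicator ramp_clip_le) auto
    also have "\<dots> < y" using u s y by (subst integral_mu_indicator) auto
    finally have "\<forall>\<^sub>F n in sequentially. real n * (LINT h|N. ramp u (clip s (h /\<^sub>R a n))) < y"
      using vague_test_function[OF ramp_test_function[OF u] s] order_tendstoD(2) by blast
    then show ?thesis using a_pos
    proof eventually_elim
      case (elim n)
      have "U (a n * s) \<le> (LINT h|N. ramp u (clip s (h /\<^sub>R a n)))"
        unfolding integral_N_indicator[symmetric]
      proof (rule integral_mono)
        show "indicator {h. a n * s < norm h} x \<le> ramp u (clip s (x /\<^sub>R a n))" for x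
          using le_ramp_clip[OF u s, of "x /\<^sub>R a n"] elim by (auto simp: indicator_def field_simps)
        show "integrable N (\<lambda>h. ramp u (clip s (h /\<^sub>R a n)))"
          using ramp_bounds by (intro integrable_N_bounded[of _ 1]) auto
      qed (auto intro!: integrable_N_bounded[of _ 1])
      then have "real n * U (a n * s) \<le> real n * (LINT h|N. ramp u (clip s (h /\<^sub>R a n)))"
        by (rule mult_left_mono) simp
      then show ?case using elim by linarith
    qed
  qed
  have lower: "\<forall>\<^sub>F n in sequentially. y < real n * U (a n * s)"
    if u: "0 < u" "u < 1" and y: "y < mass * (s / u) powr (- \<alpha>)" for u y
  proof -
    note [measurable] = rm[OF u]
    have su: "s / u > 0" using s u by simp
    have "y < (LINT x|\<mu>. indicator {x. norm x > s / u} x)"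
      using su y by (subst integral_mu_indicator) auto
    also have "\<dots> \<le> (LINT x|\<mu>. ramp u (clip (s / u) x))"
      using u su by (intro integral_mono integrable_ramp_mu integrable_mu_indicator le_ramp_clip) auto
    finally have "\<forall>\<^sub>F n in sequentially. y < real n * (LINT h|N. ramp u (clip (s / u) (h /\<^sub>R a n)))"
      using vague_test_function[OF ramp_test_function[OF u] su] order_tendstoD(1) by blast
    then show ?thesis using a_pos
    proof eventually_elim
      case (elim n)
      have "(LINT h|N. ramp u (clip (s / u) (h /\<^sub>R a n))) \<le> U (a n * s)"
        unfolding integral_N_indicator[symmetric]
      proof (rule integral_mono)
        show "ramp u (clip (s / u) (x /\<^sub>R a n)) \<le> indicator {h. a n * s < norm h} x" for x
          using ramp_clip_le[OF u su, of "x /\<^sub>R a n"] elim u by (auto simp: indicator_def field_simps)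
        show "integrable N (\<lambda>h. ramp u (clip (s / u) (h /\<^sub>R a n)))"
          using ramp_bounds by (intro integrable_N_bounded[of _ 1]) auto
      qed (auto intro!: integrable_N_bounded[of _ 1])
      then have "real n * (LINT h|N. ramp u (clip (s / u) (h /\<^sub>R a n))) \<le> real n * U (a n * s)"
        by (rule mult_left_mono) simp
      then show ?case using elim by linarith
    qed
  qed
  have pick: "\<exists>u. 0 < u \<and> u < 1 \<and> P u" if "\<forall>\<^sub>F u in at_left 1. P u" for P :: "real \<Rightarrow> bool"
  proof -
    have "\<forall>\<^sub>F u in at_left (1::real). P u \<and> u \<in> {0<..<1}"
      using that eventually_at_left_real[OF zero_less_one] by eventually_elim auto
    then show ?thesis using eventually_happens[of _ "at_left (1::real)"] by force
  qed
  show ?thesis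
  proof (rule order_tendstoI)
    fix y assume y: "y < mass * s powr (- \<alpha>)"
    have "((\<lambda>u. mass * (s / u) powr (- \<alpha>)) \<longlongrightarrow> mass * (s / 1) powr (- \<alpha>)) (at_left 1)"
      using s by (intro tendsto_intros) auto
    then have "\<forall>\<^sub>F u in at_left 1. y < mass * (s / u) powr (- \<alpha>)"
      using y by (intro order_tendstoD(1)) auto
    then show "\<forall>\<^sub>F n in sequentially. y < real n * U (a n * s)"
      using pick lower by blast
  next
    fix y assume y: "mass * s powr (- \<alpha>) < y"
    have "((\<lambda>u. mass * (s * u) powr (- \<alpha>)) \<longlongrightarrow> mass * (s * 1) powr (- \<alpha>)) (at_left 1)"
      using s by (intro tendsto_intros) auto
    then have "\<forall>\<^sub>F u in at_left 1. mass * (s * u) powr (- \<alpha>) < y"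
      using y by (intro order_tendstoD(2)) auto
    then show "\<forall>\<^sub>F n in sequentially. real n * U (a n * s) < y"
      using pick upper by blast
  qed
qed

text \<open>Since \<open>U\<close> is monotone, the varying ratio can be traded for a fixed
  \<open>s\<close> just beyond the limit \<open>r\<close> on either side, and the power law is
  continuous at \<open>r\<close>.\<close>

lemma scaled_tail_limit_varying:
  assumes k: "filterlim k sequentially F" and \<rho>: "(\<rho> \<longlongrightarrow> r) F" and r: "r > 0"
  shows "((\<lambda>t. real (k t) * U (a (k t) * \<rho> t)) \<longlongrightarrow> mass * r powr (- \<alpha>)) F"
proof -
  have lim: "((\<lambda>t. real (k t) * U (a (k t) * s)) \<longlongrightarrow> mass * s powr (- \<alpha>)) F" if "s > 0" for s
    using filterlim_compose[OF scaled_tail_limit[OF that] k] by simp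
  have ak: "\<forall>\<^sub>F t in F. a (k t) > 0" using eventually_compose_filterlim[OF a_pos k] .
  have cont: "((\<lambda>s. mass * s powr (- \<alpha>)) \<longlongrightarrow> mass * r powr (- \<alpha>)) (at r)"
    using r by (intro tendsto_intros) auto
  show ?thesis
  proof (rule order_tendstoI)
    fix y assume y: "y < mass * r powr (- \<alpha>)"
    have "\<forall>\<^sub>F s in at_right r. y < mass * s powr (- \<alpha>)"
      using order_tendstoD(1)[OF cont y] by (simp add: eventually_at_split)
    then have "\<forall>\<^sub>F s in at_right r. y < mass * s powr (- \<alpha>) \<and> r < s"
      by (intro eventually_conj) (auto simp: eventually_at_right_less)
    then obtain s where s: "y < mass * s powr (- \<alpha>)" "r < s"
      using eventually_happens[of _ "at_right r"] by force
    have "\<forall>\<^sub>F t in F. y < real (k t) * U (a (k t) * s)"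
      using s r by (intro order_tendstoD(1)[OF lim]) auto
    moreover have "\<forall>\<^sub>F t in F. \<rho> t < s" using order_tendstoD(2)[OF \<rho> s(2)] .
    ultimately show "\<forall>\<^sub>F t in F. y < real (k t) * U (a (k t) * \<rho> t)" using ak
    proof eventually_elim
      case (elim t)
      have "real (k t) * U (a (k t) * s) \<le> real (k t) * U (a (k t) * \<rho> t)"
        using elim by (intro mult_left_mono U_antimono) auto
      then show ?case using elim by linarith
    qed
  next
    fix y assume y: "mass * r powr (- \<alpha>) < y"
    have "\<forall>\<^sub>F s in at_left r. mass * s powr (- \<alpha>) < y"
      using order_tendstoD(2)[OF cont y] by (simp add: eventually_at_split)
    then have "\<forall>\<^sub>F s in at_left r. mass * s powr (- \<alpha>) < y \<and> s \<in> {0<..<r}"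
      using eventually_at_left_real[OF r] by eventually_elim auto
    then obtain s where s: "mass * s powr (- \<alpha>) < y" "s < r" "0 < s"
      using eventually_happens[of _ "at_left r"] by force
    have "\<forall>\<^sub>F t in F. real (k t) * U (a (k t) * s) < y"
      using s r by (intro order_tendstoD(2)[OF lim]) auto
    moreover have "\<forall>\<^sub>F t in F. s < \<rho> t" using order_tendstoD(1)[OF \<rho> s(2)] .
    ultimately show "\<forall>\<^sub>F t in F. real (k t) * U (a (k t) * \<rho> t) < y" using ak
    proof eventually_elim
      case (elim t)
      have "real (k t) * U (a (k t) * \<rho> t) \<le> real (k t) * U (a (k t) * s)"
        using elim by (intro mult_left_mono U_antimono) auto
      then show ?case using elim by linarith
    qed
  qed
qed

section \<open>Regular variation at real levels\<close>

lemma U_pos: "U t > 0"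
proof -
  have "\<forall>\<^sub>F n in sequentially. real n * U (a n * 1) > 0"
    using mass_pos by (intro order_tendstoD(1)[OF scaled_tail_limit]) auto
  moreover have "\<forall>\<^sub>F n in sequentially. a n \<ge> t"
    using a_lim by (simp add: filterlim_at_top)
  ultimately have "\<forall>\<^sub>F n in sequentially. U t > 0"
  proof eventually_elim
    case (elim n)
    then have "0 < U (a n)" using U_nonneg[of "a n"] by (cases "U (a n) = 0") auto
    also have "\<dots> \<le> U t" using elim by (intro U_antimono)
    finally show ?case .
  qed
  then show ?thesis by simp
qed

lemma U_tendsto_0: "(U \<longlongrightarrow> 0) at_top"
proof (rule order_tendstoI)
  fix y :: real assume y: "0 < y"
  have "(\<lambda>n. prob {h. norm h > real n}) \<longlonglongrightarrow> prob (\<Inter>n::nat. {h. norm h > real n})"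
    by (rule finite_Lim_measure_decseq) (auto simp: decseq_def)
  also have "(\<Inter>n::nat. {h::'a. norm h > real n}) = {}"
  proof (intro set_eqI iffI)
    fix h :: 'a assume "h \<in> (\<Inter>n::nat. {h. norm h > real n})"
    moreover obtain n :: nat where "norm h < real n" using reals_Archimedean2 by blast
    ultimately show "h \<in> {}" by (auto dest: spec[of _ n])
  qed simp
  finally have "\<forall>\<^sub>F n in sequentially. U (real n) < y"
    using y by (intro order_tendstoD(2)[of _ 0]) (auto simp: U_def)
  then obtain n :: nat where n: "U (real n) < y" using eventually_happens[of _ sequentially] by force
  show "\<forall>\<^sub>F t in at_top. U t < y"
    using eventually_ge_at_top[of "real n"]
    by eventually_elim (use n U_antimono in \<open>fastforce intro: le_less_trans\<close>)
next
  fix y :: real assume "y < 0"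
  then show "\<forall>\<^sub>F t in at_top. y < U t"
    using U_pos by (intro always_eventually allI) (rule less_trans)
qed

text \<open>The sequence \<open>a\<close> need not be monotone, so a level \<open>t\<close> is matched with the index \<open>k t\<close>
  at which \<open>k t * U t\<close> is about 1; then \<open>t / a (k t)\<close> converges.\<close>

definition k :: "real \<Rightarrow> nat" where
  "k t = nat \<lfloor>1 / U t\<rfloor>"

lemma k_le: "real (k t) \<le> 1 / U t" and k_ge: "1 / U t - 1 \<le> real (k t)"
proof -
  have "real (k t) = of_int \<lfloor>1 / U t\<rfloor>"
    using U_nonneg[of t] unfolding k_def by (simp add: of_nat_nat)
  then show "real (k t) \<le> 1 / U t" "1 / U t - 1 \<le> real (k t)" by linarith+
qed

lemma k_U: "((\<lambda>t. real (k t) * U t) \<longlongrightarrow> 1) at_top"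
proof (rule real_tendsto_sandwich)
  show "\<forall>\<^sub>F t in at_top. 1 - U t \<le> real (k t) * U t"
  proof (rule always_eventually, rule allI)
    fix t
    have "(1 / U t - 1) * U t \<le> real (k t) * U t"
      using k_ge U_nonneg by (rule mult_right_mono)
    then show "1 - U t \<le> real (k t) * U t" using U_pos[of t] by (simp add: algebra_simps)
  qed
  show "\<forall>\<^sub>F t in at_top. real (k t) * U t \<le> 1"
  proof (rule always_eventually, rule allI)
    fix t
    have "real (k t) * U t \<le> 1 / U t * U t"
      using k_le U_nonneg by (rule mult_right_mono)
    then show "real (k t) * U t \<le> 1" using U_pos[of t] by simp
  qed
  show "((\<lambda>t. 1 - U t) \<longlongrightarrow> 1) at_top" using tendsto_diff[OF tendsto_const U_tendsto_0, of 1] by simp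
qed simp

lemma k_lim: "filterlim k sequentially at_top"
proof -
  have "filterlim (\<lambda>t. inverse (U t)) at_top at_top"
    by (rule filterlim_inverse_at_top[OF U_tendsto_0]) (simp add: U_pos)
  then have "filterlim (\<lambda>t. - 1 + inverse (U t)) at_top at_top"
    by (rule filterlim_tendsto_add_at_top[OF tendsto_const])
  then have "filterlim (\<lambda>t. real (k t)) at_top at_top"
  proof (rule filterlim_at_top_mono, intro always_eventually allI)
    fix t show "- 1 + inverse (U t) \<le> real (k t)" using k_ge[of t] by (simp add: divide_inverse)
  qed
  then show ?thesis
    by (simp add: filterlim_sequentially_iff_filterlim_real)
qed

text \<open>The solution of \<open>mass * r powr (- \<alpha>) = 1\<close>: the radius at which the
  limiting scaled tail is 1, hence the only possible limit of \<open>t / a (k t)\<close> given that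
  \<open>k t * U t\<close> tends to 1.\<close>

definition r :: real where
  "r = mass powr (1 / \<alpha>)"

lemma r_pos: "r > 0"
  using mass_pos by (simp add: r_def)

lemma r_powr: "mass * r powr (- \<alpha>) = 1"
  using mass_pos alpha_pos by (simp add: r_def powr_powr powr_minus)

lemma a_k_pos: "\<forall>\<^sub>F t in at_top. a (k t) > 0"
  using eventually_compose_filterlim[OF a_pos k_lim] .

text \<open>The monotone tail is inverted. For \<open>y > r\<close> the scaled tail at
  \<open>a (k t) * y\<close> eventually lies below some \<open>m < 1\<close>, while
  \<open>k t * U t\<close> exceeds \<open>m\<close>; thus \<open>U\<close> is smaller at
  \<open>a (k t) * y\<close> than at \<open>t\<close>, which puts \<open>t\<close> below that level.
  The other side is symmetric, with \<open>m > 1\<close>.\<close>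

lemma ratio_limit: "((\<lambda>t. t / a (k t)) \<longlongrightarrow> r) at_top"
proof -
  have lim: "((\<lambda>t. real (k t) * U (a (k t) * s)) \<longlongrightarrow> mass * s powr (- \<alpha>)) at_top" if "s > 0" for s
    using filterlim_compose[OF scaled_tail_limit[OF that] k_lim] by simp
  show ?thesis
  proof (rule order_tendstoI)
    fix y assume y: "r < y"
    have "mass * y powr (- \<alpha>) < mass * r powr (- \<alpha>)"
      using mass_pos y r_pos alpha_pos by (simp add: powr_less_mono2_neg)
    then obtain m where m: "mass * y powr (- \<alpha>) < m" "m < 1" using r_powr dense by metis
    have "\<forall>\<^sub>F t in at_top. real (k t) * U (a (k t) * y) < m"
      using lim[of y] y r_pos m by (intro order_tendstoD(2)) auto
    moreover have "\<forall>\<^sub>F t in at_top. real (k t) * U t > m"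
      using order_tendstoD(1)[OF k_U m(2)] .
    ultimately show "\<forall>\<^sub>F t in at_top. t / a (k t) < y" using a_k_pos
    proof eventually_elim
      case (elim t)
      then have "U (a (k t) * y) < U t"
        by (meson less_trans mult_less_cancel_left_disj of_nat_0_le_iff not_less)
      then have "t < a (k t) * y" using U_antimono[of "a (k t) * y" t] by (meson not_le)
      then show ?case using elim by (simp add: field_simps)
    qed
  next
    fix y0 assume y0: "y0 < r"
    obtain y where y: "max 0 y0 < y" "y < r" using y0 r_pos dense[of "max 0 y0" r] by auto
    have "mass * r powr (- \<alpha>) < mass * y powr (- \<alpha>)"
      using mass_pos y r_pos alpha_pos by (simp add: powr_less_mono2_neg)
    then obtain m where m: "m < mass * y powr (- \<alpha>)" "1 < m" using r_powr dense by metis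
    have "\<forall>\<^sub>F t in at_top. real (k t) * U (a (k t) * y) > m"
      using lim[of y] y r_pos m by (intro order_tendstoD(1)) auto
    moreover have "\<forall>\<^sub>F t in at_top. real (k t) * U t < m"
      using order_tendstoD(2)[OF k_U m(2)] .
    ultimately show "\<forall>\<^sub>F t in at_top. y0 < t / a (k t)" using a_k_pos
    proof eventually_elim
      case (elim t)
      then have "U t < U (a (k t) * y)"
        by (meson less_trans mult_less_cancel_left_disj of_nat_0_le_iff not_less)
      then have "a (k t) * y < t" using U_antimono[of t "a (k t) * y"] by (meson not_le)
      then have "y < t / a (k t)" using elim by (simp add: field_simps)
      then show ?case using y by simp
    qed
  qed
qed

lemma U_regularly_varying:
  assumes x: "x > 0"
  shows "((\<lambda>t. U (x * t) / U t) \<longlongrightarrow> x powr (- \<alpha>)) at_top"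
proof -
  have "((\<lambda>t. real (k t) * U (a (k t) * (x * (t / a (k t)))) / (real (k t) * U t))
      \<longlongrightarrow> mass * (x * r) powr (- \<alpha>) / 1) at_top"
    using x r_pos
    by (intro tendsto_divide scaled_tail_limit_varying k_lim k_U tendsto_mult tendsto_const ratio_limit) auto
  also have "mass * (x * r) powr (- \<alpha>) / 1 = x powr (- \<alpha>)"
    using x r_pos r_powr by (simp add: powr_mult)
  finally show ?thesis
  proof (rule Lim_transform_eventually)
    have "\<forall>\<^sub>F t in at_top. k t > 0"
      using k_lim by (simp add: eventually_compose_filterlim[OF eventually_gt_at_top])
    then show "\<forall>\<^sub>F t in at_top. real (k t) * U (a (k t) * (x * (t / a (k t)))) / (real (k t) * U t)
        = U (x * t) / U t"
      using a_k_pos by eventually_elim auto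
  qed
qed

text \<open>Replacing the varying ratio \<open>t / a (k t)\<close> by its limit costs little, since \<open>F \<circ> clip s\<close>
  depends on \<open>s\<close> uniformly continuously.\<close>

lemma test_function_limit:
  assumes F: "test_function F"
  shows "((\<lambda>t. (LINT h|N. F (clip t h)) / U t) \<longlongrightarrow> (LINT x|\<mu>. F (clip 1 x)) / mass) at_top"
proof -
  have [measurable]: "F \<in> borel_measurable borel" using F by (rule test_function_measurable)
  from F obtain \<delta> where contF: "continuous_on UNIV F" and d: "\<delta> > 0" "\<And>y. norm y \<le> \<delta> \<Longrightarrow> F y = 0"
    by (auto simp: test_function_def)
  have "bounded (F ` cball 0 1)"
    by (intro compact_imp_bounded compact_continuous_image continuous_on_subset[OF contF]) auto
  then obtain C where C: "\<And>y. norm y \<le> 1 \<Longrightarrow> \<bar>F y\<bar> \<le> C"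
    by (fastforce simp: bounded_iff)
  have int: "integrable N (\<lambda>h. F (clip s (h /\<^sub>R b)))" if "s > 0" for s b
    using C norm_clip_le_1[OF that] by (intro integrable_N_bounded[of _ C]) auto
  \<comment> \<open>For \<open>norm (h /\<^sub>R a (k t))\<close> up to this value, and any scale
    above \<open>r / 2\<close>, the clipped vector has norm at most \<delta>, so both terms of the
    difference vanish.\<close>
  define s where "s = \<delta> * r / 2"
  have s: "s > 0" using d r_pos by (simp add: s_def)
  \<comment> \<open>An eventual bound for \<open>k t * U (a (k t) * s)\<close>, the scaled weight of
    the region where the difference is not zero; hence the tolerance \<open>e / D\<close> for the
    oscillation of \<open>F\<close>.\<close>
  define D where "D = mass * s powr (- \<alpha>) + 1"
  have D: "D > 0" using mass_pos by (simp add: D_def add_nonneg_pos)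
  let ?A = "\<lambda>t. LINT h|N. F (clip t h)" and ?B = "\<lambda>t. LINT h|N. F (clip r (h /\<^sub>R a (k t)))"
  let ?I = "LINT x|\<mu>. F (clip r x)" and ?x = "\<lambda>t h. h /\<^sub>R a (k t)"
  have "((\<lambda>t. real (k t) * ?A t) \<longlongrightarrow> ?I) at_top"
  proof (rule tendsto_by_approximation)
    fix e :: real assume e: "e > 0"
    have "uniformly_continuous_on (cball 0 1) F"
      by (intro compact_uniformly_continuous continuous_on_subset[OF contF]) auto
    then obtain \<eta> where eta: "\<eta> > 0" "\<And>y z. norm y \<le> 1 \<Longrightarrow> norm z \<le> 1 \<Longrightarrow> dist z y < \<eta> \<Longrightarrow> \<bar>F z - F y\<bar> < e / D"
      using e D unfolding uniformly_continuous_on_def dist_real_def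
      by (metis (full_types) divide_pos_pos mem_cball_0)
    have "((\<lambda>t. real (k t) * ?B t) \<longlongrightarrow> ?I) at_top"
      using filterlim_compose[OF vague_test_function[OF F r_pos] k_lim] by simp
    moreover have "\<forall>\<^sub>F t in at_top. \<bar>real (k t) * ?A t
        - real (k t) * ?B t\<bar> \<le> e"
    proof -
      have "\<forall>\<^sub>F t in at_top. \<bar>t / a (k t) - r\<bar> < min (\<eta> * r) (r / 2)"
        using tendstoD[OF ratio_limit, of "min (\<eta> * r) (r / 2)"] eta r_pos by (simp add: dist_real_def)
      moreover have "\<forall>\<^sub>F t in at_top. real (k t) * U (a (k t) * s) < D"
        using filterlim_compose[OF scaled_tail_limit[OF s] k_lim]
        by (intro order_tendstoD(2)[of _ "mass * s powr (- \<alpha>)"]) (auto simp: D_def)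
      ultimately show ?thesis using a_k_pos eventually_gt_at_top[of 0]
      proof eventually_elim
        case (elim t)
        define \<rho> where "\<rho> = t / a (k t)"
        have \<rho>: "\<bar>\<rho> - r\<bar> < \<eta> * r" "\<rho> > r / 2" "\<rho> > 0"
        proof -
          have *: "\<bar>\<rho> - r\<bar> < \<eta> * r" "\<bar>\<rho> - r\<bar> < r / 2" using elim by (simp_all add: \<rho>_def)
          then show "\<bar>\<rho> - r\<bar> < \<eta> * r" "\<rho> > r / 2" by linarith+
          then show "\<rho> > 0" using r_pos by linarith
        qed
        have clip_t: "clip t h = clip \<rho> (h /\<^sub>R a (k t))" for h :: 'a
          using clip_scale[of "a (k t)" \<rho> h] elim \<rho> by (simp add: \<rho>_def)
        have "\<bar>?A t - ?B t\<bar>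
            = \<bar>LINT h|N. F (clip \<rho> (?x t h)) - F (clip r (?x t h))\<bar>"
          unfolding clip_t using int \<rho> r_pos by (subst Bochner_Integration.integral_diff) auto
        also have "\<dots> \<le> (LINT h|N. \<bar>F (clip \<rho> (?x t h)) - F (clip r (?x t h))\<bar>)"
          by (rule integral_abs_bound)
        also have "\<dots> \<le> (LINT h|N. e / D * indicator {h. norm h > a (k t) * s} h)"
        proof (rule integral_mono)
          show "integrable N (\<lambda>h. \<bar>F (clip \<rho> (?x t h)) - F (clip r (?x t h))\<bar>)"
            using int \<rho> r_pos by auto
          show "integrable N (\<lambda>h. e / D * indicator {h. norm h > a (k t) * s} h)"
            by (intro integrable_mult_right integrable_N_bounded[of _ 1]) auto
          fix h :: 'a
          show "\<bar>F (clip \<rho> (?x t h)) - F (clip r (?x t h))\<bar> \<le> e / D * indicator {h. norm h > a (k t) * s} h"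
          proof (cases "norm h > a (k t) * s")
            case True
            have "dist (clip \<rho> (?x t h)) (clip r (?x t h)) \<le> \<bar>\<rho> - r\<bar> / r"
              unfolding dist_norm using \<rho> r_pos by (intro clip_diff_le)
            also have "\<dots> < \<eta>" using \<rho> r_pos by (simp add: divide_less_eq)
            finally show ?thesis
              using True \<rho> r_pos by (auto intro!: less_imp_le eta norm_clip_le_1)
          next
            case False
            have nx: "norm (?x t h) \<le> s" using False elim by (simp add: field_simps)
            have "norm (clip \<rho> (?x t h)) \<le> norm (?x t h) / \<rho>" using \<rho> by (intro norm_clip_le)
            also have "\<dots> \<le> s / (r / 2)" using nx \<rho> r_pos s by (intro frac_le) auto
            also have "\<dots> = \<delta>" using r_pos by (simp add: s_def)
            finally have 1: "norm (clip \<rho> (?x t h)) \<le> \<delta>" .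
            have "norm (clip r (?x t h)) \<le> norm (?x t h) / r" using r_pos by (intro norm_clip_le)
            also have "\<dots> \<le> s / (r / 2)" using nx r_pos s by (intro frac_le) auto
            also have "\<dots> = \<delta>" using r_pos by (simp add: s_def)
            finally have 2: "norm (clip r (?x t h)) \<le> \<delta>" .
            show ?thesis using False d(2)[OF 1] d(2)[OF 2] by simp
          qed
        qed
        also have "\<dots> = e / D * U (a (k t) * s)" by (simp add: U_def)
        finally have "real (k t) * \<bar>?A t - ?B t\<bar>
            \<le> real (k t) * (e / D * U (a (k t) * s))"
          by (rule mult_left_mono) simp
        also have "\<dots> = e / D * (real (k t) * U (a (k t) * s))" by simp
        also have "\<dots> \<le> e / D * D" using elim e D by (intro mult_left_mono) auto
        also have "\<dots> = e" using D by simp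
        finally show ?case by (simp add: abs_mult flip: right_diff_distrib)
      qed
    qed
    ultimately show "\<exists>A' B'. (A' \<longlongrightarrow> B') at_top
        \<and> (\<forall>\<^sub>F t in at_top. \<bar>real (k t) * ?A t - A' t\<bar> \<le> e)
        \<and> \<bar>?I - B'\<bar> \<le> e"
      using e by (intro exI conjI) auto
  qed
  then have "((\<lambda>t. real (k t) * ?A t / (real (k t) * U t))
      \<longlongrightarrow> ?I / 1) at_top"
    by (intro tendsto_divide k_U) auto
  also have "?I / 1 = (LINT x|\<mu>. F (clip 1 (x /\<^sub>R r)))"
  proof -
    have "clip r x = clip 1 (x /\<^sub>R r)" for x :: 'a
      using clip_scale[of r 1 x] r_pos by simp
    then show ?thesis by simp
  qed
  also have "\<dots> = r powr (- \<alpha>) * (LINT x|\<mu>. F (clip 1 x))"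
    by (rule integral_mu_scale[OF r_pos]) measurable
  also have "\<dots> = (LINT x|\<mu>. F (clip 1 x)) / mass"
    using r_powr mass_pos by (simp add: field_simps)
  finally show ?thesis
  proof (rule Lim_transform_eventually)
    have "\<forall>\<^sub>F t in at_top. k t > 0"
      using k_lim by (simp add: eventually_compose_filterlim[OF eventually_gt_at_top])
    then show "\<forall>\<^sub>F t in at_top. real (k t) * ?A t / (real (k t) * U t)
        = ?A t / U t"
      by eventually_elim auto
  qed
qed

section \<open>Karamata-type bounds and clipped moments\<close>

text \<open>Raising the truncation level from \<open>s\<close> to \<open>2 * s\<close> adds at most
  \<open>(2 * s) ^ \<beta> * U s\<close> to the moment, and regular variation bounds
  \<open>U s\<close> by \<open>q * 2 ^ \<beta> * U (2 * s)\<close> with \<open>q < 1\<close>,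
  because \<open>2 powr (\<alpha> - \<beta>) < 1\<close>. The bound thus reproduces itself under
  doubling.\<close>

lemma trunc_moment_bound:
  assumes \<beta>: "\<alpha> < real \<beta>"
  obtains C t0 where "C > 0" "t0 > 0"
    "\<And>t. t \<ge> t0 \<Longrightarrow> (LINT h|N. min (norm h) t ^ \<beta>) \<le> C * t ^ \<beta> * U t"
proof -
  define K where "K t = (LINT h|N. min (norm h) t ^ \<beta>)" for t
  have int: "integrable N (\<lambda>h. min (norm h) t ^ \<beta>)" if "t \<ge> 0" for t
    using that by (intro integrable_N_bounded[of _ "t ^ \<beta>"]) (auto simp: min_def intro!: power_mono)
  have "(2::real) powr (\<alpha> - \<beta>) < 1" using \<beta> by (simp add: powr_less_one)
  then obtain q where q: "2 powr (\<alpha> - \<beta>) < q" "q < 1" using dense by blast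
  have q0: "q > 0" using q(1) powr_gt_zero[of 2 "\<alpha> - \<beta>"] by linarith
  have "(1 / q) / 2 ^ \<beta> < 2 powr (- \<alpha>)"
  proof -
    have "2 powr (\<alpha> - \<beta>) = 2 powr \<alpha> / 2 ^ \<beta>" by (simp add: powr_diff powr_realpow)
    then have "2 powr \<alpha> < q * 2 ^ \<beta>" using q by (simp add: divide_less_eq)
    then show ?thesis using q0 by (simp add: powr_minus field_simps)
  qed
  then have "\<forall>\<^sub>F t in at_top. (1 / q) / 2 ^ \<beta> < U (2 * t) / U t"
    by (intro order_tendstoD(1)[OF U_regularly_varying]) auto
  then obtain t1 where t1: "\<And>t. t \<ge> t1 \<Longrightarrow> (1 / q) / 2 ^ \<beta> < U (2 * t) / U t"
    by (auto simp: eventually_at_top_linorder)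
  define t0 where "t0 = max 1 t1"
  have t0: "t0 > 0" by (simp add: t0_def)
  have doubling: "U t \<le> q * 2 ^ \<beta> * U (2 * t)" if "t \<ge> t0" for t
    using t1[of t] that q0 U_pos[of t] by (simp add: t0_def field_simps)
  \<comment> \<open>The first entry serves the base range up to \<open>2 * t0\<close>; the second
    makes \<open>(C + 2 ^ \<beta>) * q\<close> at most \<open>C\<close>, which closes the
    induction.\<close>
  define C where "C = max (1 / U (2 * t0)) (q * 2 ^ \<beta> / (1 - q))"
  have C0: "C > 0" using U_pos[of "2 * t0"] by (simp add: C_def less_max_iff_disj)
  have Cq: "(C + 2 ^ \<beta>) * q \<le> C"
  proof -
    have "q * 2 ^ \<beta> / (1 - q) \<le> C" by (simp add: C_def)
    then have "q * 2 ^ \<beta> \<le> C * (1 - q)" using q by (simp add: divide_le_eq)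
    then show ?thesis by (simp add: algebra_simps)
  qed
  have main: "t0 \<le> t \<Longrightarrow> t \<le> 2 ^ Suc n * t0 \<Longrightarrow> K t \<le> C * t ^ \<beta> * U t" for n t
  proof (induction n arbitrary: t)
    case 0
    then have t: "t > 0" "t \<le> 2 * t0" using t0 by auto
    have "K t \<le> (LINT h|N. t ^ \<beta>)"
      unfolding K_def using t int by (intro integral_mono power_mono) auto
    also have "\<dots> = t ^ \<beta>" by (simp add: prob_space)
    also have "\<dots> \<le> t ^ \<beta> * (C * U t)"
    proof -
      have "1 \<le> U t / U (2 * t0)" using U_antimono[OF t(2)] U_pos[of "2 * t0"] by simp
      also have "\<dots> = 1 / U (2 * t0) * U t" by simp
      also have "\<dots> \<le> C * U t" using U_nonneg by (intro mult_right_mono) (auto simp: C_def)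
      finally show ?thesis using t by (simp add: mult_le_cancel_left1)
    qed
    finally show ?case by (simp add: mult_ac)
  next
    case (Suc n)
    show ?case
    proof (cases "t \<le> 2 ^ Suc n * t0")
      case True
      then show ?thesis using Suc by blast
    next
      case False
      define s where "s = t / 2"
      have "2 ^ Suc n * t0 \<ge> 2 * t0" using t0 by (intro mult_right_mono) auto
      then have s: "s \<ge> t0" "s \<le> 2 ^ Suc n * t0" using False Suc.prems by (auto simp: s_def)
      have s0: "s > 0" using s t0 by linarith
      have "K (2 * s) \<le> (LINT h|N. min (norm h) s ^ \<beta> + (2 * s) ^ \<beta> * indicator {h. norm h > s} h)"
        unfolding K_def
      proof (rule integral_mono)
        show "integrable N (\<lambda>h. min (norm h) s ^ \<beta> + (2 * s) ^ \<beta> * indicator {h. norm h > s} h)"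
          using int s0 by (intro Bochner_Integration.integrable_add integrable_mult_right
            integrable_N_bounded[of "indicator {h. norm h > s}" 1]) auto
        fix h :: 'a
        show "min (norm h) (2 * s) ^ \<beta> \<le> min (norm h) s ^ \<beta> + (2 * s) ^ \<beta> * indicator {h. norm h > s} h"
        proof (cases "norm h > s")
          case True
          have "min (norm h) (2 * s) ^ \<beta> \<le> (2 * s) ^ \<beta>" using s0 by (intro power_mono) auto
          moreover have "0 \<le> min (norm h) s ^ \<beta>" using s0 by auto
          ultimately show ?thesis using True by simp
        qed (use s0 in \<open>auto simp: min_def\<close>)
      qed (use int s0 in auto)
      also have "\<dots> = K s + (2 * s) ^ \<beta> * U s"
        unfolding K_def using int s0 by (subst Bochner_Integration.integral_add)
          (auto intro!: integrable_mult_right integrable_N_bounded[of _ 1] simp: U_def)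
      also have "\<dots> \<le> C * s ^ \<beta> * U s + (2 * s) ^ \<beta> * U s" using Suc.IH[OF s] by simp
      also have "\<dots> = (C + 2 ^ \<beta>) * s ^ \<beta> * U s" by (simp add: power_mult_distrib algebra_simps)
      also have "\<dots> \<le> (C + 2 ^ \<beta>) * s ^ \<beta> * (q * 2 ^ \<beta> * U (2 * s))"
        using C0 s0 by (intro mult_left_mono doubling s(1)) auto
      also have "\<dots> = (C + 2 ^ \<beta>) * q * ((2 * s) ^ \<beta> * U (2 * s))"
        by (simp add: power_mult_distrib mult_ac)
      also have "\<dots> \<le> C * ((2 * s) ^ \<beta> * U (2 * s))"
        using Cq s0 U_nonneg by (intro mult_right_mono) auto
      finally show ?thesis by (simp add: s_def mult_ac)
    qed
  qed
  have "K t \<le> C * t ^ \<beta> * U t" if "t \<ge> t0" for t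
  proof -
    obtain n :: nat where "t / t0 < 2 ^ n" using real_arch_pow[of 2 "t / t0"] by auto
    then have "t \<le> 2 ^ n * t0" using t0 by (simp add: divide_less_eq)
    also have "\<dots> \<le> 2 ^ Suc n * t0" using t0 by simp
    finally show ?thesis using main that by blast
  qed
  then show ?thesis using that C0 t0 unfolding K_def by blast
qed

section \<open>Clipped integrals of functions of higher order at the origin\<close>

definition cutoff :: "real \<Rightarrow> 'a \<Rightarrow> real" where
  "cutoff \<epsilon> y = max 0 (min 1 (norm y / \<epsilon> - 1))"

lemma cutoff_bounds: "0 \<le> cutoff \<epsilon> y" "cutoff \<epsilon> y \<le> 1"
  by (auto simp: cutoff_def)

lemma cutoff_one: "\<epsilon> > 0 \<Longrightarrow> norm y \<ge> 2 * \<epsilon> \<Longrightarrow> cutoff \<epsilon> y = 1"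
  by (auto simp: cutoff_def min_def max_def divide_simps)

lemma cutoff_zero: "\<epsilon> > 0 \<Longrightarrow> norm y \<le> \<epsilon> \<Longrightarrow> cutoff \<epsilon> y = 0"
  by (auto simp: cutoff_def min_def max_def divide_simps)

lemma cutoff_test_function:
  assumes "\<epsilon> > 0" "continuous_on UNIV \<Phi>"
  shows "test_function (\<lambda>y. \<Phi> y * cutoff \<epsilon> y)"
  unfolding test_function_def
proof (intro conjI exI[of _ \<epsilon>])
  show "continuous_on UNIV (\<lambda>y. \<Phi> y * cutoff \<epsilon> y)"
    unfolding cutoff_def using assms by (intro continuous_intros) auto
qed (use assms in \<open>auto simp: cutoff_zero\<close>)

lemma cutoff_tendsto_1:
  assumes "\<epsilon> \<longlonglongrightarrow> 0" "\<And>n. \<epsilon> n > 0" "y \<noteq> 0 \<or> z = 0"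
  shows "(\<lambda>n. z * cutoff (\<epsilon> n) y) \<longlonglongrightarrow> z"
proof (cases "z = 0")
  case False
  then have "norm y / 2 > 0" using assms by simp
  then have "\<forall>\<^sub>F n in sequentially. \<epsilon> n < norm y / 2" using order_tendstoD(2)[OF assms(1)] by blast
  then have "\<forall>\<^sub>F n in sequentially. z = z * cutoff (\<epsilon> n) y"
    by eventually_elim (use assms in \<open>simp add: cutoff_one\<close>)
  then show ?thesis by (rule Lim_transform_eventually[OF tendsto_const])
qed simp

text \<open>The truncated moment bound for the law passes to \<mu>: cut off near 0, the power is a
  test function, so its integral is a limit of quotients bounded by \<open>C\<close>. Removing the
  cutoff is Fatou's lemma.\<close>

lemma integrable_mu_clip_power:
  assumes \<beta>: "\<alpha> < real \<beta>"
  shows "integrable \<mu> (\<lambda>x. norm (clip 1 x) ^ \<beta>)"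
proof -
  obtain C t0 where C: "C > 0" "t0 > 0"
    "\<And>t. t \<ge> t0 \<Longrightarrow> (LINT h|N. min (norm h) t ^ \<beta>) \<le> C * t ^ \<beta> * U t"
    using trunc_moment_bound[OF \<beta>] by metis
  have \<beta>0: "\<beta> > 0" using \<beta> alpha_pos by (cases \<beta>) auto
  define \<epsilon> :: "nat \<Rightarrow> real" where "\<epsilon> n = 1 / real (Suc n)" for n
  have e: "\<epsilon> n > 0" for n by (simp add: \<epsilon>_def)
  have e0: "\<epsilon> \<longlonglongrightarrow> 0" unfolding \<epsilon>_def by (rule LIMSEQ_Suc[OF lim_1_over_n])
  define F where "F n y = norm y ^ \<beta> * cutoff (\<epsilon> n) y" for n and y :: 'a
  have F: "test_function (F n)" for n
    unfolding F_def using e by (intro cutoff_test_function continuous_intros)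
  have F0: "0 \<le> F n y" for n y using cutoff_bounds by (simp add: F_def)
  have Fle: "F n y \<le> norm y ^ \<beta>" for n y
    unfolding F_def using cutoff_bounds by (simp add: mult_left_le)
  have [measurable]: "F n \<in> borel_measurable borel" for n using F by (rule test_function_measurable)
  have intF: "integrable \<mu> (\<lambda>x. F n (clip 1 x))" for n
  proof -
    have "F n (clip 1 x) \<le> 1 * indicator {x. norm x > \<epsilon> n / 2} x" for x
    proof (cases "norm x > \<epsilon> n / 2")
      case True
      have "F n (clip 1 x) \<le> norm (clip 1 x) ^ \<beta>" by (rule Fle)
      also have "\<dots> \<le> 1" by (intro power_le_one norm_clip_le_1) auto
      finally show ?thesis using True by simp
    next
      case False
      have "norm (clip 1 x) \<le> norm x" using norm_clip_le[of 1 x] by simp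
      also have "\<dots> \<le> \<epsilon> n" using False e[of n] by simp
      finally show ?thesis using False e[of n] by (simp add: F_def cutoff_zero)
    qed
    then show ?thesis using F0 e
      by (intro integrable_mu_bounded[where s = "\<epsilon> n / 2" and C = 1]) auto
  qed
  have bound: "(LINT x|\<mu>. F n (clip 1 x)) \<le> C * mass" for n
  proof -
    have "(LINT x|\<mu>. F n (clip 1 x)) / mass \<le> C"
    proof (rule tendsto_upperbound[OF test_function_limit[OF F]])
      show "\<forall>\<^sub>F t in at_top. (LINT h|N. F n (clip t h)) / U t \<le> C"
        using eventually_ge_at_top[of t0]
      proof eventually_elim
        case (elim t)
        then have t: "t > 0" using C by linarith
        have int: "integrable N (\<lambda>h. min (norm h) t ^ \<beta>)"
          using t by (intro integrable_N_bounded[of _ "t ^ \<beta>"]) (auto simp: min_def intro!: power_mono)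
        have "(LINT h|N. F n (clip t h)) \<le> (LINT h|N. min (norm h) t ^ \<beta> / t ^ \<beta>)"
        proof (rule integral_mono)
          show "F n (clip t h) \<le> min (norm h) t ^ \<beta> / t ^ \<beta>" for h
            using Fle[of n "clip t h"] t by (simp add: norm_clip_eq_min power_divide)
          then show "integrable N (\<lambda>h. F n (clip t h))"
            using Fle[of n] norm_clip_le_1[OF t] F0
            by (intro integrable_N_bounded[of _ 1]) (auto intro!: order_trans[OF Fle] power_le_one)
        qed (use int in auto)
        also have "\<dots> = (LINT h|N. min (norm h) t ^ \<beta>) / t ^ \<beta>" by simp
        also have "\<dots> \<le> C * U t" using C(3)[OF elim] t by (simp add: divide_le_eq mult_ac)
        finally show ?case using U_pos[of t] by (simp add: divide_le_eq)
      qed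
    qed simp
    then show ?thesis using mass_pos by (simp add: divide_le_eq)
  qed
  have lim: "(\<lambda>n. F n (clip 1 x)) \<longlonglongrightarrow> norm (clip 1 x) ^ \<beta>" for x
    unfolding F_def using e0 e \<beta>0 by (intro cutoff_tendsto_1) auto
  have "(\<integral>\<^sup>+x. ennreal (norm (clip 1 x) ^ \<beta>) \<partial>\<mu>) = (\<integral>\<^sup>+x. liminf (\<lambda>n. ennreal (F n (clip 1 x))) \<partial>\<mu>)"
    using lim by (intro nn_integral_cong lim_imp_Liminf[symmetric] tendsto_ennrealI) auto
  also have "\<dots> \<le> liminf (\<lambda>n. \<integral>\<^sup>+x. ennreal (F n (clip 1 x)) \<partial>\<mu>)"
    by (intro nn_integral_liminf measurable_mu) measurable
  also have "\<dots> \<le> limsup (\<lambda>n. \<integral>\<^sup>+x. ennreal (F n (clip 1 x)) \<partial>\<mu>)"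
    by (rule Liminf_le_Limsup) simp
  also have "\<dots> \<le> ennreal (C * mass)"
  proof (intro Limsup_bounded always_eventually allI)
    fix n
    have "(\<integral>\<^sup>+x. ennreal (F n (clip 1 x)) \<partial>\<mu>) = ennreal (LINT x|\<mu>. F n (clip 1 x))"
      using intF F0 by (intro nn_integral_eq_integral) auto
    then show "(\<integral>\<^sup>+x. ennreal (F n (clip 1 x)) \<partial>\<mu>) \<le> ennreal (C * mass)"
      using bound by (simp add: ennreal_leI)
  qed
  finally have "(\<integral>\<^sup>+x. ennreal (norm (clip 1 x) ^ \<beta>) \<partial>\<mu>) < \<infinity>"
    using le_less_trans by fastforce
  then show ?thesis
    by (intro integrableI_nonneg) (auto intro!: measurable_mu)
qed

lemma integrable_mu_clip:
  fixes \<Phi> :: "'a \<Rightarrow> real"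
  assumes \<Phi>: "continuous_on UNIV \<Phi>" "\<And>y. norm y \<le> 1 \<Longrightarrow> \<bar>\<Phi> y\<bar> \<le> B * norm y ^ \<beta>" and \<beta>: "\<alpha> < real \<beta>"
  shows "integrable \<mu> (\<lambda>x. \<Phi> (clip 1 x))"
proof (rule Bochner_Integration.integrable_bound)
  show "integrable \<mu> (\<lambda>x. B * norm (clip 1 x) ^ \<beta>)"
    using integrable_mu_clip_power[OF \<beta>] by auto
  have [measurable]: "\<Phi> \<in> borel_measurable borel" using \<Phi>(1) by (rule borel_measurable_continuous_onI)
  show "(\<lambda>x. \<Phi> (clip 1 x)) \<in> borel_measurable \<mu>" by (rule measurable_mu) measurable
  have "\<bar>\<Phi> (clip 1 x)\<bar> \<le> \<bar>B * norm (clip 1 x) ^ \<beta>\<bar>" for x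
    using \<Phi>(2)[of "clip 1 x"] norm_clip_le_1[of 1 x] by linarith
  then show "AE x in \<mu>. norm (\<Phi> (clip 1 x)) \<le> norm (B * norm (clip 1 x) ^ \<beta>)" by auto
qed

text \<open>The cutoff at \<epsilon> changes the integrand only for
  \<open>norm h < 2 * \<epsilon> * t\<close>, by at most \<open>B * (norm h / t) ^ \<beta>\<close>.
  The moment bound at level \<open>2 * \<epsilon> * t\<close> and regular variation make this error,
  relative to \<open>U t\<close>, at most a constant times
  \<open>(2 * \<epsilon>) powr (\<beta> - \<alpha>)\<close>, uniformly in large
  \<open>t\<close>.\<close>

lemma clip_limit:
  fixes \<Phi> :: "'a \<Rightarrow> real"
  assumes \<Phi>: "continuous_on UNIV \<Phi>" "\<And>y. norm y \<le> 1 \<Longrightarrow> \<bar>\<Phi> y\<bar> \<le> B * norm y ^ \<beta>" and \<beta>: "\<alpha> < real \<beta>"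
  shows "((\<lambda>t. (LINT h|N. \<Phi> (clip t h)) / U t) \<longlongrightarrow> (LINT x|\<mu>. \<Phi> (clip 1 x)) / mass) at_top"
proof (rule tendsto_by_approximation)
  fix e :: real assume e: "e > 0"
  obtain C t0 where C: "C > 0" "t0 > 0"
    "\<And>t. t \<ge> t0 \<Longrightarrow> (LINT h|N. min (norm h) t ^ \<beta>) \<le> C * t ^ \<beta> * U t"
    using trunc_moment_bound[OF \<beta>] by metis
  have \<beta>0: "\<beta> > 0" using \<beta> alpha_pos by (cases \<beta>) auto
  have [measurable]: "\<Phi> \<in> borel_measurable borel" using \<Phi>(1) by (rule borel_measurable_continuous_onI)
  have \<Phi>0: "\<Phi> 0 = 0" using \<Phi>(2)[of 0] \<beta>0 by (simp add: zero_power)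
  obtain b :: 'a where b: "b \<in> Basis" using nonempty_Basis by blast
  have B0: "B \<ge> 0" using \<Phi>(2)[of b] b by (simp add: norm_Basis)
  \<comment> \<open>The final factor 1/2 ensures \<open>2 * E n \<le> 1\<close>, so wherever the
    cutoff differs from 1 the vector is not actually clipped and \<open>clip t h\<close> is
    \<open>h / t\<close>.\<close>
  define E :: "nat \<Rightarrow> real" where "E n = 1 / real (Suc n) / 2" for n
  let ?I = "LINT x|\<mu>. \<Phi> (clip 1 x)" and ?C = "\<lambda>n. LINT x|\<mu>. \<Phi> (clip 1 x) * cutoff (E n) (clip 1 x)"
  let ?P = "\<lambda>t. LINT h|N. \<Phi> (clip t h)"
  have E: "E n > 0" for n by (simp add: E_def)
  have E0: "E \<longlonglongrightarrow> 0" unfolding E_def using tendsto_divide[OF LIMSEQ_Suc[OF lim_1_over_n] tendsto_const[of 2]] by simp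
  have cut_meas [measurable]: "cutoff \<epsilon> \<in> borel_measurable borel" for \<epsilon>
    unfolding cutoff_def by measurable
  have int\<Phi>: "integrable \<mu> (\<lambda>x. \<Phi> (clip 1 x))"
    using \<Phi> \<beta> by (rule integrable_mu_clip)
  have "(\<lambda>n. ?C n) \<longlonglongrightarrow> ?I"
  proof (rule integral_dominated_convergence[where w = "\<lambda>x. \<bar>\<Phi> (clip 1 x)\<bar>"])
    show "AE x in \<mu>. (\<lambda>n. \<Phi> (clip 1 x) * cutoff (E n) (clip 1 x)) \<longlonglongrightarrow> \<Phi> (clip 1 x)"
      using \<Phi>0 E E0 by (intro AE_I2 cutoff_tendsto_1) auto
    show "AE x in \<mu>. norm (\<Phi> (clip 1 x) * cutoff (E n) (clip 1 x)) \<le> \<bar>\<Phi> (clip 1 x)\<bar>" for n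
      using cutoff_bounds by (intro AE_I2) (auto simp: abs_mult intro!: mult_left_le)
  qed (use int\<Phi> in \<open>auto intro!: measurable_mu\<close>)
  then have "(\<lambda>n. ?C n / mass) \<longlonglongrightarrow> ?I / mass"
    by (rule tendsto_divide) (use mass_pos in auto)
  then have ev1: "\<forall>\<^sub>F n in sequentially. \<bar>?I / mass
      - ?C n / mass\<bar> < e"
    using e by (auto dest!: tendstoD[where e = e] simp: dist_real_def abs_minus_commute)
  have "(\<lambda>n. B * C * 2 * (2 * E n) powr (\<beta> - \<alpha>)) \<longlonglongrightarrow> B * C * 2 * (2 * 0) powr (\<beta> - \<alpha>)"
    using \<beta> E by (intro tendsto_intros E0 tendsto_powr') (auto simp: less_imp_le)
  then have ev2: "\<forall>\<^sub>F n in sequentially. B * C * 2 * (2 * E n) powr (\<beta> - \<alpha>) < e"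
    using e by (intro order_tendstoD(2)) auto
  have "\<forall>\<^sub>F n in sequentially. \<bar>?I / mass
      - ?C n / mass\<bar> < e
      \<and> B * C * 2 * (2 * E n) powr (\<beta> - \<alpha>) < e"
    using ev1 ev2 by eventually_elim simp
  then obtain n where n: "\<bar>?I / mass
      - ?C n / mass\<bar> < e"
      "B * C * 2 * (2 * E n) powr (\<beta> - \<alpha>) < e"
    using eventually_happens[of _ sequentially] by force
  define \<epsilon> where "\<epsilon> = E n"
  have eps: "\<epsilon> > 0" "2 * \<epsilon> \<le> 1" using E by (auto simp: \<epsilon>_def E_def)
  define F where "F y = \<Phi> y * cutoff \<epsilon> y" for y
  have F: "test_function F" unfolding F_def using eps \<Phi>(1) by (intro cutoff_test_function)
  have [measurable]: "F \<in> borel_measurable borel" using F by (rule test_function_measurable)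
  let ?F = "\<lambda>t. LINT h|N. F (clip t h)"
  have err: "\<forall>\<^sub>F t in at_top. \<bar>?P t / U t - ?F t / U t\<bar> \<le> e"
  proof -
    \<comment> \<open>The factor 2 gives room to use the limit of the tail ratio as an inequality
      for large \<open>t\<close>.\<close>
    have "(2 * \<epsilon>) powr (- \<alpha>) < 2 * (2 * \<epsilon>) powr (- \<alpha>)" using eps by simp
    then have "\<forall>\<^sub>F t in at_top. U (2 * \<epsilon> * t) / U t < 2 * (2 * \<epsilon>) powr (- \<alpha>)"
      using eps by (intro order_tendstoD(2)[OF U_regularly_varying]) auto
    then show ?thesis
      using eventually_ge_at_top[of "t0 / (2 * \<epsilon>)"] eventually_gt_at_top[of 0]
    proof eventually_elim
      case (elim t)
      define s where "s = 2 * \<epsilon> * t"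
      have t: "t > 0" by (rule elim)
      have s: "s \<ge> t0" "s > 0" "s \<le> t" using elim eps by (auto simp: s_def field_simps)
      have b1: "\<bar>\<Phi> (clip t h)\<bar> \<le> B" for h
      proof -
        have "\<bar>\<Phi> (clip t h)\<bar> \<le> B * norm (clip t h) ^ \<beta>" using t by (intro \<Phi>(2) norm_clip_le_1)
        also have "\<dots> \<le> B * 1" using B0 t by (intro mult_left_mono power_le_one norm_clip_le_1) auto
        finally show ?thesis by simp
      qed
      have b2: "\<bar>F (clip t h)\<bar> \<le> B" for h
        using b1[of h] cutoff_bounds[of \<epsilon> "clip t h"] unfolding F_def abs_mult
        by (smt (verit, best) mult_left_le abs_ge_zero)
      have i1: "integrable N (\<lambda>h. \<Phi> (clip t h))" "integrable N (\<lambda>h. F (clip t h))"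
        using b1 b2 by (auto intro!: integrable_N_bounded[of _ B])
      have "\<bar>?P t - ?F t\<bar> = \<bar>LINT h|N. \<Phi> (clip t h) - F (clip t h)\<bar>"
        using i1 by simp
      also have "\<dots> \<le> (LINT h|N. \<bar>\<Phi> (clip t h) - F (clip t h)\<bar>)" by (rule integral_abs_bound)
      also have "\<dots> \<le> (LINT h|N. B / t ^ \<beta> * min (norm h) s ^ \<beta>)"
      proof (rule integral_mono)
        show "integrable N (\<lambda>h. B / t ^ \<beta> * min (norm h) s ^ \<beta>)"
          using s by (intro integrable_mult_right integrable_N_bounded[of _ "s ^ \<beta>"])
            (auto simp: min_def intro!: power_mono)
        fix h :: 'a
        show "\<bar>\<Phi> (clip t h) - F (clip t h)\<bar> \<le> B / t ^ \<beta> * min (norm h) s ^ \<beta>"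
        proof (cases "norm (clip t h) \<ge> 2 * \<epsilon>")
          case True
          then have "F (clip t h) = \<Phi> (clip t h)" using eps by (simp add: F_def cutoff_one)
          then show ?thesis using B0 t s by simp
        next
          case False
          have lt: "norm (clip t h) < 1" using False eps by linarith
          have ht: "norm h < t"
          proof (rule ccontr)
            assume "\<not> norm h < t"
            then show False using norm_clip_one[OF t, of h] lt by simp
          qed
          then have nc: "norm (clip t h) = norm h / t" using t by (simp add: norm_clip max_def)
          have hs: "norm h \<le> s" using False nc t by (simp add: s_def field_simps)
          have "\<Phi> (clip t h) - F (clip t h) = \<Phi> (clip t h) * (1 - cutoff \<epsilon> (clip t h))"
            by (simp add: F_def algebra_simps)
          then have "\<bar>\<Phi> (clip t h) - F (clip t h)\<bar> = \<bar>\<Phi> (clip t h)\<bar> * (1 - cutoff \<epsilon> (clip t h))"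
            using cutoff_bounds[of \<epsilon> "clip t h"] by (simp add: abs_mult)
          also have "\<dots> \<le> \<bar>\<Phi> (clip t h)\<bar>"
            using cutoff_bounds[of \<epsilon> "clip t h"] by (intro mult_left_le) auto
          also have "\<dots> \<le> B * norm (clip t h) ^ \<beta>" using t by (intro \<Phi>(2) norm_clip_le_1)
          also have "\<dots> = B / t ^ \<beta> * min (norm h) s ^ \<beta>" using hs by (simp add: nc power_divide)
          finally show ?thesis .
        qed
      qed (use i1 in auto)
      also have "\<dots> = B / t ^ \<beta> * (LINT h|N. min (norm h) s ^ \<beta>)" by simp
      also have "\<dots> \<le> B / t ^ \<beta> * (C * s ^ \<beta> * U s)"
        using B0 t by (intro mult_left_mono C(3) s) auto
      also have "\<dots> = B * C * (2 * \<epsilon>) ^ \<beta> * U s" using t by (simp add: s_def power_mult_distrib)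
      also have "\<dots> \<le> B * C * (2 * \<epsilon>) ^ \<beta> * (2 * (2 * \<epsilon>) powr (- \<alpha>) * U t)"
        using elim(1) B0 C eps U_pos[of t] by (intro mult_left_mono) (auto simp: s_def divide_less_eq)
      also have "\<dots> = B * C * 2 * (2 * \<epsilon>) powr (\<beta> - \<alpha>) * U t"
        using eps by (simp add: powr_diff powr_minus powr_realpow divide_inverse)
      also have "\<dots> \<le> e * U t"
        using n(2) U_nonneg by (intro mult_right_mono) (auto simp: \<epsilon>_def)
      finally have "\<bar>?P t - ?F t\<bar> \<le> e * U t" .
      then show ?case using U_pos[of t] by (simp add: abs_diff_divide pos_divide_le_eq)
    qed
  qed
  show "\<exists>A' B'. (A' \<longlongrightarrow> B') at_top
      \<and> (\<forall>\<^sub>F t in at_top. \<bar>?P t / U t - A' t\<bar> \<le> e)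
      \<and> \<bar>?I / mass - B'\<bar> \<le> e"
    using test_function_limit[OF F] err n(1) unfolding \<epsilon>_def[symmetric]
    by (intro exI[of _ "\<lambda>t. ?F t / U t"] exI[of _ "(LINT x|\<mu>. F (clip 1 x)) / mass"])
      (auto simp: F_def)
qed

section \<open>The linear term for index above 1\<close>

text \<open>The outward counterpart of the truncated moment bound: the shell between
  \<open>t\<close> and \<open>2 * t\<close> contributes at most \<open>2 * t * U t\<close>, and
  \<open>2 * U (2 * t)\<close> is at most \<open>q * U t\<close> with \<open>q < 1\<close> since
  \<alpha> > 1. The constant solves \<open>2 + C * q = C\<close>, and the remainder at
  \<open>2 ^ n * t\<close> vanishes by dominated convergence.\<close>

lemma tail_moment_bound:
  assumes \<alpha>: "1 < \<alpha>" and int: "integrable N (\<lambda>h. norm h)"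
  obtains C t0 where "C > 0" "t0 > 0"
    "\<And>t. t \<ge> t0 \<Longrightarrow> (LINT h|N. norm h * indicator {h. norm h > t} h) \<le> C * t * U t"
proof -
  define J where "J t = (LINT h|N. norm h * indicator {h. norm h > t} h)" for t
  have intJ: "integrable N (\<lambda>h. norm h * indicator {h. norm h > t} h)" for t
    by (rule Bochner_Integration.integrable_bound[OF int]) (auto simp: indicator_def)
  have "(2::real) powr (1 - \<alpha>) < 1" using \<alpha> by (simp add: powr_less_one)
  then obtain q where q: "2 powr (1 - \<alpha>) < q" "q < 1" using dense by blast
  have q0: "q > 0" using q(1) powr_gt_zero[of 2 "1 - \<alpha>"] by linarith
  have "2 powr (- \<alpha>) < q / 2"
  proof -
    have "(2::real) powr (1 - \<alpha>) = 2 * 2 powr (- \<alpha>)" using powr_add[of "2::real" 1 "- \<alpha>"] by simp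
    then show ?thesis using q by simp
  qed
  then have "\<forall>\<^sub>F t in at_top. U (2 * t) / U t < q / 2"
    by (intro order_tendstoD(2)[OF U_regularly_varying]) auto
  then obtain t1 where t1: "\<And>t. t \<ge> t1 \<Longrightarrow> U (2 * t) / U t < q / 2"
    by (auto simp: eventually_at_top_linorder)
  define t0 where "t0 = max 1 t1"
  have t0: "t0 > 0" by (simp add: t0_def)
  have halving: "2 * U (2 * t) \<le> q * U t" if "t \<ge> t0" for t
    using t1[of t] that U_pos[of t] by (simp add: t0_def field_simps)
  define C where "C = 2 / (1 - q)"
  have C: "C > 0" "2 + C * q = C" using q by (auto simp: C_def field_simps)
  have i2: "integrable N (\<lambda>h. 2 * t * indicator {h. norm h > t} h)" for t
    by (intro integrable_mult_right integrable_N_bounded[of _ 1]) auto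
  have step: "J t \<le> 2 * t * U t + J (2 * t)" if "t > 0" for t
  proof -
    have "J t \<le> (LINT h|N. 2 * t * indicator {h. norm h > t} h + norm h * indicator {h. norm h > 2 * t} h)"
      unfolding J_def
    proof (rule integral_mono)
      show "integrable N (\<lambda>h. 2 * t * indicator {h. norm h > t} h + norm h * indicator {h. norm h > 2 * t} h)"
        by (intro Bochner_Integration.integrable_add i2 intJ)
      show "norm h * indicator {h. norm h > t} h
          \<le> 2 * t * indicator {h. norm h > t} h + norm h * indicator {h. norm h > 2 * t} h" for h :: 'a
        using that by (auto simp: indicator_def)
    qed (rule intJ)
    also have "\<dots> = 2 * t * U t + J (2 * t)"
      unfolding J_def Bochner_Integration.integral_add[OF i2 intJ] by (simp add: U_def)
    finally show ?thesis .
  qed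
  have main: "J t \<le> C * t * U t + J (2 ^ n * t)" if "t \<ge> t0" for n t
    using that
  proof (induction n arbitrary: t)
    case 0
    then show ?case using C t0 U_nonneg[of t] by simp
  next
    case (Suc n)
    have t: "t > 0" using Suc.prems t0 by linarith
    have "J t \<le> 2 * t * U t + J (2 * t)" using t by (rule step)
    also have "J (2 * t) \<le> C * (2 * t) * U (2 * t) + J (2 ^ n * (2 * t))"
      using Suc.prems t by (intro Suc.IH) auto
    also have "C * (2 * t) * U (2 * t) = C * t * (2 * U (2 * t))" by simp
    also have "\<dots> \<le> C * t * (q * U t)"
      using C t Suc.prems by (intro mult_left_mono halving) auto
    also have "2 * t * U t + (C * t * (q * U t) + J (2 ^ n * (2 * t))) = (2 + C * q) * t * U t + J (2 ^ Suc n * t)"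
      by (simp add: algebra_simps)
    finally show ?case using C by simp
  qed
  have "J t \<le> C * t * U t" if t: "t \<ge> t0" for t
  proof -
    have t': "t > 0" using t t0 by linarith
    have "(\<lambda>n. J (2 ^ n * t)) \<longlonglongrightarrow> (LINT h|N. 0)"
      unfolding J_def
    proof (rule integral_dominated_convergence[where w = "\<lambda>h. norm h"])
      show "AE h in N. (\<lambda>n. norm h * indicator {h. norm h > 2 ^ n * t} h) \<longlonglongrightarrow> 0"
      proof (rule AE_I2)
        fix h :: 'a
        obtain m :: nat where m: "norm h / t < 2 ^ m" using real_arch_pow[of 2 "norm h / t"] by auto
        have "\<forall>\<^sub>F n in sequentially. 0 = norm h * indicator {h. norm h > 2 ^ n * t} h"
          using eventually_ge_at_top[of m]
        proof eventually_elim
          case (elim n)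
          have "norm h < 2 ^ m * t" using m t' by (simp add: divide_less_eq)
          also have "\<dots> \<le> 2 ^ n * t" using elim t' by (intro mult_right_mono power_increasing) auto
          finally show ?case by simp
        qed
        then show "(\<lambda>n. norm h * indicator {h. norm h > 2 ^ n * t} h) \<longlonglongrightarrow> 0"
          by (rule Lim_transform_eventually[OF tendsto_const])
      qed
    qed (use int in \<open>auto simp: indicator_def\<close>)
    then have "(\<lambda>n. C * t * U t + J (2 ^ n * t)) \<longlonglongrightarrow> C * t * U t + 0"
      by (intro tendsto_intros) simp
    then show ?thesis using main[OF t] by (intro LIMSEQ_le_const[of _ "C * t * U t"]) auto
  qed
  then show ?thesis using that C t0 unfolding J_def by blast
qed

text \<open>Scaling gives \<open>excess l (S T) = excess l S + S\<^sup>1\<^sup>-\<^sup>\<alpha> excess l T\<close>, and by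
  symmetry in \<open>S\<close> and \<open>T\<close> this determines \<open>excess l\<close> up to its derivative at \<open>T = 1\<close>, which is
  \<open>direction_integral l\<close>. No polar decomposition of \<open>\<mu>\<close> is needed.\<close>

definition excess :: "'a \<Rightarrow> real \<Rightarrow> real" where
  "excess l T = (LINT x|\<mu>. l \<bullet> (T *\<^sub>R clip T x - clip 1 x))"

definition direction_integral :: "'a \<Rightarrow> real" where
  "direction_integral l = (LINT x|\<mu>. indicator {x. norm x > 1} x * (l \<bullet> (x /\<^sub>R norm x)))"

lemma integrable_excess:
  assumes T: "T \<ge> 1"
  shows "integrable \<mu> (\<lambda>x. l \<bullet> (T *\<^sub>R clip T x - clip 1 x))"
proof (rule integrable_mu_bounded[where s = "1/2" and C = "norm l * (T + 1)"])
  fix x :: 'a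
  show "\<bar>l \<bullet> (T *\<^sub>R clip T x - clip 1 x)\<bar> \<le> norm l * (T + 1) * indicator {x. norm x > 1 / 2} x"
  proof (cases "norm x > 1 / 2")
    case True
    have "\<bar>l \<bullet> (T *\<^sub>R clip T x - clip 1 x)\<bar> \<le> norm l * norm (T *\<^sub>R clip T x - clip 1 x)"
      by (rule Cauchy_Schwarz_ineq2)
    also have "norm (T *\<^sub>R clip T x - clip 1 x) \<le> T * norm (clip T x) + norm (clip 1 x)"
      using norm_triangle_ineq4[of "T *\<^sub>R clip T x" "clip 1 x"] T by simp
    also have "\<dots> \<le> T * 1 + 1" using T by (intro add_mono mult_left_mono norm_clip_le_1) auto
    finally show ?thesis using True by (simp add: mult_left_mono)
  next
    case False
    then show ?thesis using T by (simp add: clip_inside)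
  qed
qed auto

text \<open>\<open>T *\<^sub>R clip T x\<close> projects onto the ball of radius \<open>T\<close>.
  Dividing by \<open>S\<close> turns the step from radius \<open>S\<close> to \<open>S * T\<close>
  into the step from 1 to \<open>T\<close>; vectors contribute a factor \<open>S\<close> and \<mu> a
  factor \<open>S powr (- \<alpha>)\<close>.\<close>

lemma excess_mult:
  assumes "S \<ge> 1" "T \<ge> 1"
  shows "excess l (S * T) = excess l S + S powr (1 - \<alpha>) * excess l T"
proof -
  have ST: "S * T \<ge> 1" using assms by (metis mult_mono' mult_1 zero_le_one)
  have eq: "(S * T) *\<^sub>R clip (S * T) x - S *\<^sub>R clip S x
      = S *\<^sub>R (T *\<^sub>R clip T (x /\<^sub>R S) - clip 1 (x /\<^sub>R S))" for x :: 'a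
    using clip_scale[of S T x] clip_scale[of S 1 x] assms by (simp add: algebra_simps)
  have "excess l (S * T) - excess l S
      = (LINT x|\<mu>. l \<bullet> ((S * T) *\<^sub>R clip (S * T) x - clip 1 x) - l \<bullet> (S *\<^sub>R clip S x - clip 1 x))"
    unfolding excess_def using assms ST
    by (intro Bochner_Integration.integral_diff[symmetric] integrable_excess) auto
  also have "\<dots> = (LINT x|\<mu>. S * (l \<bullet> (T *\<^sub>R clip T (x /\<^sub>R S) - clip 1 (x /\<^sub>R S))))"
  proof (rule Bochner_Integration.integral_cong[OF refl])
    fix x
    have "l \<bullet> ((S * T) *\<^sub>R clip (S * T) x - clip 1 x) - l \<bullet> (S *\<^sub>R clip S x - clip 1 x)
        = l \<bullet> ((S * T) *\<^sub>R clip (S * T) x - S *\<^sub>R clip S x)"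
      by (simp add: inner_diff_right)
    then show "l \<bullet> ((S * T) *\<^sub>R clip (S * T) x - clip 1 x) - l \<bullet> (S *\<^sub>R clip S x - clip 1 x)
        = S * (l \<bullet> (T *\<^sub>R clip T (x /\<^sub>R S) - clip 1 (x /\<^sub>R S)))"
      unfolding eq by simp
  qed
  also have "\<dots> = S * (S powr (- \<alpha>) * excess l T)"
    unfolding excess_def using assms
    by (subst integral_mu_scale[symmetric]) auto
  also have "\<dots> = S powr (1 - \<alpha>) * excess l T"
    using assms by (simp add: powr_diff powr_minus divide_inverse)
  finally show ?thesis by simp
qed

text \<open>The sphere lies between the tails at \<open>s < 1\<close> and at 1, whose masses differ
  by \<open>mass * (s powr (- \<alpha>) - 1)\<close>, which tends to 0. It reconciles
  \<open>norm x \<ge> 1\<close> in the spectral measure with the open complement of the ball in its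
  normalisation and in \<nu>.\<close>

lemma AE_norm_neq_1: "AE x in \<mu>. norm x \<noteq> 1"
proof -
  have fin: "emeasure \<mu> (sphere 0 1) < \<infinity>"
    by (rule le_less_trans[OF emeasure_mono mu_open_tail_finite[of "1/2"]]) (auto simp: in_sets_mu)
  have "measure \<mu> (sphere 0 1) \<le> mass * s powr (- \<alpha>) - mass" if "0 < s" "s < 1" for s
  proof -
    have "measure \<mu> (sphere 0 1) + measure \<mu> {x. norm x > 1} = measure \<mu> (sphere 0 1 \<union> {x. norm x > 1})"
      using fin mu_open_tail_finite[of 1]
      by (intro measure_Union[symmetric]) (auto simp: in_sets_mu)
    also have "\<dots> \<le> measure \<mu> {x. norm x > s}"
      using that mu_open_tail_finite[of s]
      by (intro measure_mono_fmeasurable) (auto simp: in_sets_mu fmeasurable_def)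
    finally show ?thesis
      using emeasure_mu_tail[of s] emeasure_mu_tail[of 1] that mass_pos by (simp add: measure_def)
  qed
  then have "\<forall>\<^sub>F s in at_left 1. measure \<mu> (sphere 0 1) \<le> mass * s powr (- \<alpha>) - mass"
    using eventually_at_left_real[OF zero_less_one] by (auto elim!: eventually_mono)
  moreover have "((\<lambda>s. mass * s powr (- \<alpha>) - mass) \<longlongrightarrow> mass * 1 powr (- \<alpha>) - mass) (at_left 1)"
    by (intro tendsto_intros) auto
  ultimately have "measure \<mu> (sphere 0 1) \<le> mass * 1 powr (- \<alpha>) - mass"
    by (intro tendsto_lowerbound) auto
  then have "measure \<mu> (sphere 0 1) = 0" using measure_nonneg[of \<mu> "sphere 0 1"] by simp
  then have "sphere 0 1 \<in> null_sets \<mu>"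
    using fin by (intro null_setsI) (auto simp: emeasure_eq_ennreal_measure in_sets_mu)
  then have "AE x in \<mu>. x \<notin> sphere 0 1" by (rule AE_not_in)
  then show ?thesis by simp
qed

text \<open>Outside the unit ball the integrand is the unit vector of \<open>x\<close>, paired with
  \<open>l\<close>, times \<open>min (norm x) (T n) - 1\<close>. Multiplied by \<open>Suc n\<close>
  this weight never exceeds 1 and equals 1 once \<open>T n < norm x\<close>.\<close>

lemma excess_derivative: "(\<lambda>n. real (Suc n) * excess l (1 + 1 / real (Suc n))) \<longlonglongrightarrow> direction_integral l"
proof -
  define T where "T n = 1 + 1 / real (Suc n)" for n
  have T: "T n > 1" "real (Suc n) * (T n - 1) = 1" for n by (auto simp: T_def)
  have T1: "T \<longlonglongrightarrow> 1" unfolding T_def using tendsto_add[OF tendsto_const LIMSEQ_Suc[OF lim_1_over_n], of 1] by simp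
  let ?f = "\<lambda>n x. real (Suc n) * (l \<bullet> (T n *\<^sub>R clip (T n) x - clip 1 x))"
  have val: "T s *\<^sub>R clip (T s) x - clip 1 x = (min (norm x) (T s) - 1) *\<^sub>R (x /\<^sub>R norm x)" if "norm x > 1" for x :: 'a and s
  proof (cases "norm x \<le> T s")
    case True
    then have "T s *\<^sub>R clip (T s) x = x" using T(1)[of s] by (simp add: clip_inside)
    moreover have "clip 1 x = x /\<^sub>R norm x" using that by (simp add: clip_outside)
    moreover have "x = norm x *\<^sub>R (x /\<^sub>R norm x)"
    proof -
      have "norm x \<noteq> 0" using that by linarith
      then show ?thesis by (simp add: right_inverse)
    qed
    ultimately show ?thesis using True by (metis min.absorb1 scaleR_left_diff_distrib scaleR_one)
  next
    case False
    then have "T s *\<^sub>R clip (T s) x = T s *\<^sub>R (x /\<^sub>R norm x)" "clip 1 x = x /\<^sub>R norm x"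
      using T(1)[of s] that by (simp_all add: clip_outside)
    then show ?thesis using False by (simp only: scaleR_left_diff_distrib scaleR_one min_def if_False)
  qed
  have bound: "\<bar>?f n x\<bar> \<le> norm l * indicator {x. norm x > 1} x" for n x
  proof (cases "norm x > 1")
    case True
    have "\<bar>?f n x\<bar> = real (Suc n) * (min (norm x) (T n) - 1) * \<bar>l \<bullet> (x /\<^sub>R norm x)\<bar>"
      unfolding val[OF True] using True T(1)[of n] by (simp add: abs_mult)
    also have "\<dots> \<le> real (Suc n) * (T n - 1) * norm l"
    proof (intro mult_mono)
      show "\<bar>l \<bullet> (x /\<^sub>R norm x)\<bar> \<le> norm l"
      proof -
        have "x \<noteq> 0" using True by auto
        then show ?thesis using Cauchy_Schwarz_ineq2[of l "x /\<^sub>R norm x"] by simp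
      qed
    qed (use True T(1)[of n] in auto)
    also have "\<dots> = norm l" using T(2)[of n] by simp
    finally show ?thesis using True by simp
  next
    case False
    then show ?thesis using T(1)[of n] by (simp add: clip_inside)
  qed
  have "(\<lambda>n. LINT x|\<mu>. ?f n x) \<longlonglongrightarrow> (LINT x|\<mu>. indicator {x. norm x > 1} x * (l \<bullet> (x /\<^sub>R norm x)))"
  proof (rule integral_dominated_convergence[where w = "\<lambda>x. norm l * indicator {x. norm x > 1} x"])
    show "AE x in \<mu>. (\<lambda>n. ?f n x) \<longlonglongrightarrow> indicator {x. norm x > 1} x * (l \<bullet> (x /\<^sub>R norm x))"
    proof (rule AE_I2)
      fix x :: 'a
      show "(\<lambda>n. ?f n x) \<longlonglongrightarrow> indicator {x. norm x > 1} x * (l \<bullet> (x /\<^sub>R norm x))"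
      proof (cases "norm x > 1")
        case True
        then have "\<forall>\<^sub>F n in sequentially. T n < norm x" using order_tendstoD(2)[OF T1] by blast
        then have "\<forall>\<^sub>F n in sequentially. indicator {x. norm x > 1} x * (l \<bullet> (x /\<^sub>R norm x)) = ?f n x"
        proof eventually_elim
          case (elim n)
          have "?f n x = real (Suc n) * (T n - 1) * (l \<bullet> (x /\<^sub>R norm x))"
            unfolding val[OF True] using elim by simp
          then show ?case using T(2)[of n] True by simp
        qed
        then show ?thesis by (rule Lim_transform_eventually[OF tendsto_const])
      next
        case False
        then have "?f n x = 0" for n using T(1)[of n] by (simp add: clip_inside)
        then show ?thesis using False by simp
      qed
    qed
    show "AE x in \<mu>. norm (?f n x) \<le> norm l * indicator {x. norm x > 1} x" for n
      using bound by (intro AE_I2) auto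
  qed (auto intro!: integrable_mult_right integrable_mu_indicator measurable_mu)
  then show ?thesis unfolding excess_def direction_integral_def T_def by simp
qed

lemma excess_eq:
  assumes \<alpha>: "1 < \<alpha>" and T: "T \<ge> 1"
  shows "excess l T = (1 - T powr (1 - \<alpha>)) / (\<alpha> - 1) * direction_integral l"
proof -
  define w where "w = excess l 2 / (1 - 2 powr (1 - \<alpha>))"
  have p: "(2::real) powr (1 - \<alpha>) < 1" using \<alpha> by (simp add: powr_less_one)
  have w: "excess l T = w * (1 - T powr (1 - \<alpha>))" if "T \<ge> 1" for T
  proof -
    \<comment> \<open>Both sides expand the excess at \<open>2 * T\<close>, with the two factors
      taken in either order. Any fixed factor above 1 could replace 2.\<close>
    have "excess l T + T powr (1 - \<alpha>) * excess l 2 = excess l 2 + 2 powr (1 - \<alpha>) * excess l T"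
      using excess_mult[of T 2 l] excess_mult[of 2 T l] that by (simp add: mult.commute)
    then have "excess l T * (1 - 2 powr (1 - \<alpha>)) = excess l 2 * (1 - T powr (1 - \<alpha>))"
      by (simp add: algebra_simps)
    then have "excess l T = excess l 2 * (1 - T powr (1 - \<alpha>)) / (1 - 2 powr (1 - \<alpha>))"
      using p by (subst nonzero_eq_divide_eq) auto
    then show ?thesis by (simp add: w_def)
  qed
  have "((\<lambda>x::real. x powr (1 - \<alpha>)) has_real_derivative (1 - \<alpha>) * 1 powr (1 - \<alpha> - 1)) (at 1)"
    by (rule has_real_derivative_powr) simp
  then have "((\<lambda>h. ((1 + h) powr (1 - \<alpha>) - 1) / h) \<longlongrightarrow> 1 - \<alpha>) (at 0)"
    by (simp add: DERIV_def)
  moreover have "filterlim (\<lambda>n. 1 / real (Suc n)) (at 0) sequentially"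
    by (rule filterlim_atI[OF LIMSEQ_Suc[OF lim_1_over_n]]) auto
  ultimately have "(\<lambda>n. ((1 + 1 / real (Suc n)) powr (1 - \<alpha>) - 1) / (1 / real (Suc n))) \<longlonglongrightarrow> 1 - \<alpha>"
    by (rule filterlim_compose)
  then have "(\<lambda>n. - w * (((1 + 1 / real (Suc n)) powr (1 - \<alpha>) - 1) / (1 / real (Suc n)))) \<longlonglongrightarrow> - w * (1 - \<alpha>)"
    by (intro tendsto_intros)
  also have "(\<lambda>n. - w * (((1 + 1 / real (Suc n)) powr (1 - \<alpha>) - 1) / (1 / real (Suc n))))
      = (\<lambda>n. real (Suc n) * excess l (1 + 1 / real (Suc n)))"
    by (subst w) (auto simp: fun_eq_iff algebra_simps)
  finally have "direction_integral l = - w * (1 - \<alpha>)"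
    using excess_derivative LIMSEQ_unique by blast
  then have "w = direction_integral l / (\<alpha> - 1)" using \<alpha> by (simp add: field_simps)
  then show ?thesis using w[OF T] by simp
qed

text \<open>Projecting onto a larger ball loses nothing for a later projection onto a smaller one.
  Hence the step between the radii \<open>t\<close> and \<open>T * t\<close> is a function of
  \<open>clip (T * t) h\<close> alone.\<close>

lemma clip_clip: "T \<ge> 1 \<Longrightarrow> t > 0 \<Longrightarrow> clip 1 (T *\<^sub>R clip (T * t) h) = clip t h"
proof (cases "norm h \<le> T * t")
  case True
  assume T: "T \<ge> 1" "t > 0"
  then have "T *\<^sub>R clip (T * t) h = h /\<^sub>R t" using True by (simp add: clip_inside)
  then show ?thesis using clip_scale[of t 1 h] T by simp
next
  case False
  assume T: "T \<ge> 1" "t > 0"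
  then have "t \<le> T * t" by simp
  then have h: "norm h > t" "norm h > 0" using False T by linarith+
  let ?y = "T *\<^sub>R (h /\<^sub>R norm h)"
  have "T *\<^sub>R clip (T * t) h = ?y" using False T by (simp add: clip_outside)
  moreover have n: "norm ?y = T" using h T by simp
  have "clip 1 ?y = ?y /\<^sub>R norm ?y" by (rule clip_outside) (use n T in linarith)+
  then have "clip 1 ?y = h /\<^sub>R norm h" unfolding n using T by simp
  moreover have "clip t h = h /\<^sub>R norm h" using h T by (simp add: clip_outside)
  ultimately show ?thesis by simp
qed

text \<open>Seen at scale \<open>T * t\<close> the step is a test function, vanishing on the ball of
  radius \<open>1 / T\<close>. The factor \<open>T powr (- \<alpha>)\<close> from
  \<open>U (T * t) / U t\<close> is absorbed by rescaling \<mu>.\<close>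

lemma excess_limit:
  assumes T: "T \<ge> 1"
  shows "((\<lambda>t. (LINT h|N. l \<bullet> (T *\<^sub>R clip (T * t) h - clip t h)) / U t) \<longlongrightarrow> excess l T / mass) at_top"
proof -
  define F where "F y = l \<bullet> (T *\<^sub>R y - clip 1 (T *\<^sub>R y))" for y
  have F: "test_function F"
    unfolding test_function_def
  proof (intro conjI exI[of _ "1 / T"] allI impI)
    show "continuous_on UNIV F" unfolding F_def
      by (intro continuous_intros continuous_on_compose2[OF continuous_on_clip[of 1 UNIV]]) auto
    fix y :: 'a assume "norm y \<le> 1 / T"
    then have "norm (T *\<^sub>R y) \<le> 1" using T by (simp add: field_simps)
    then show "F y = 0" by (simp add: F_def clip_inside)
  qed (use T in auto)
  have [measurable]: "F \<in> borel_measurable borel" using F by (rule test_function_measurable)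
  have Tt: "filterlim (\<lambda>t. T * t) at_top at_top"
    using T by (intro filterlim_tendsto_pos_mult_at_top[OF tendsto_const]) (auto simp: filterlim_ident)
  have "((\<lambda>t. (LINT h|N. F (clip (T * t) h)) / U (T * t) * (U (T * t) / U t))
      \<longlongrightarrow> (LINT x|\<mu>. F (clip 1 x)) / mass * T powr (- \<alpha>)) at_top"
    using T by (intro tendsto_mult filterlim_compose[OF test_function_limit[OF F] Tt] U_regularly_varying) auto
  also have "(LINT x|\<mu>. F (clip 1 x)) / mass * T powr (- \<alpha>) = (LINT x|\<mu>. F (clip 1 (x /\<^sub>R T))) / mass"
    using T by (subst integral_mu_scale) auto
  also have "(LINT x|\<mu>. F (clip 1 (x /\<^sub>R T))) = excess l T"
  proof -
    have "F (clip 1 (x /\<^sub>R T)) = l \<bullet> (T *\<^sub>R clip T x - clip 1 x)" for x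
      using clip_scale[of T 1 x] clip_clip[of T 1 x] T by (simp add: F_def)
    then show ?thesis by (simp add: excess_def)
  qed
  finally show ?thesis
  proof (rule Lim_transform_eventually)
    show "\<forall>\<^sub>F t in at_top. (LINT h|N. F (clip (T * t) h)) / U (T * t) * (U (T * t) / U t)
        = (LINT h|N. l \<bullet> (T *\<^sub>R clip (T * t) h - clip t h)) / U t"
      using eventually_gt_at_top[of 0]
    proof eventually_elim
      case (elim t)
      have "F (clip (T * t) h) = l \<bullet> (T *\<^sub>R clip (T * t) h - clip t h)" for h
        using clip_clip[OF T elim, of h] by (simp add: F_def)
      then show ?case using U_pos[of "T * t"] by simp
    qed
  qed
qed

text \<open>Zero mean replaces \<open>l \<bullet> clip t h\<close> by minus the overshoot
  \<open>l \<bullet> (h /\<^sub>R t) - l \<bullet> clip t h\<close>, which vanishes for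
  \<open>norm h \<le> t\<close> but is unbounded. Stopped at radius \<open>T * t\<close> it
  converges to the excess at \<open>T\<close>; the rest is at most
  \<open>2 * norm l * C * T powr (1 - \<alpha>)\<close> relative to \<open>U t\<close>. Large
  \<open>T\<close> makes this small and removes \<open>T powr (1 - \<alpha>)\<close> from the
  formula for the excess.\<close>

lemma linear_limit:
  assumes \<alpha>: "1 < \<alpha>" and mean: "has_bochner_integral N (\<lambda>h. h) 0"
  shows "((\<lambda>t. (LINT h|N. l \<bullet> clip t h) / U t) \<longlongrightarrow> - (direction_integral l / (\<alpha> - 1) / mass)) at_top"
proof -
  let ?A = "\<lambda>t. (LINT h|N. l \<bullet> (h /\<^sub>R t) - l \<bullet> clip t h)" and ?B = "\<lambda>T t. (LINT h|N. l \<bullet> (T *\<^sub>R clip (T * t) h - clip t h))"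
  let ?d = "\<lambda>T t h. (l \<bullet> (h /\<^sub>R t) - l \<bullet> clip t h) - l \<bullet> (T *\<^sub>R clip (T * t) h - clip t h)"
  let ?E = "direction_integral l / (\<alpha> - 1) / mass" and ?D = "\<lambda>T. (1 - T powr (1 - \<alpha>)) / (\<alpha> - 1) * direction_integral l / mass"
  have intid: "integrable N (\<lambda>h. h)" and mean0: "(LINT h|N. h) = 0"
    using mean by (auto simp: has_bochner_integral_iff)
  have intn: "integrable N (\<lambda>h. norm h)" using intid by (rule integrable_norm)
  obtain C t0 where C: "C > 0" "t0 > 0"
    "\<And>t. t \<ge> t0 \<Longrightarrow> (LINT h|N. norm h * indicator {h. norm h > t} h) \<le> C * t * U t"
    using tail_moment_bound[OF \<alpha> intn] by metis
  have intclip: "integrable N (\<lambda>h. l \<bullet> clip t h)" if "t > 0" for t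
  proof (rule integrable_N_bounded[of _ "norm l"])
    show "\<bar>l \<bullet> clip t h\<bar> \<le> norm l" for h
      using Cauchy_Schwarz_ineq2[of l "clip t h"] norm_clip_le_1[OF that, of h]
      by (meson mult_left_le norm_ge_zero order_trans)
  qed auto
  have intl: "integrable N (\<lambda>h. l \<bullet> (h /\<^sub>R t))" for t using intid by auto
  have "((\<lambda>t. ?A t / U t) \<longlongrightarrow> ?E) at_top"
  proof (rule tendsto_by_approximation)
    fix e :: real assume e: "e > 0"
    have z: "((\<lambda>T. T powr (1 - \<alpha>)) \<longlongrightarrow> 0) at_top" using \<alpha> by (intro tendsto_neg_powr filterlim_ident) auto
    have "((\<lambda>T. norm l * C * 2 * T powr (1 - \<alpha>)) \<longlongrightarrow> norm l * C * 2 * 0) at_top"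
      by (intro tendsto_intros z)
    then have ev1: "\<forall>\<^sub>F T in at_top. norm l * C * 2 * T powr (1 - \<alpha>) < e"
      using e by (intro order_tendstoD(2)) auto
    have "((\<lambda>T. ?D T)
        \<longlongrightarrow> (1 - 0) / (\<alpha> - 1) * direction_integral l / mass) at_top"
      using \<alpha> mass_pos by (intro tendsto_intros z) auto
    then have ev2: "\<forall>\<^sub>F T in at_top. \<bar>?E
        - ?D T\<bar> < e"
      using e by (auto dest!: tendstoD[where e = e] simp: dist_real_def abs_minus_commute)
    have "\<forall>\<^sub>F T in at_top. norm l * C * 2 * T powr (1 - \<alpha>) < e \<and> \<bar>?E
        - ?D T\<bar> < e \<and> T \<ge> (1::real)"
      using ev1 ev2 eventually_ge_at_top[of "1::real"] by eventually_elim simp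
    then obtain T where T: "T \<ge> 1" "norm l * C * 2 * T powr (1 - \<alpha>) < e"
      "\<bar>?E - excess l T / mass\<bar> < e"
      using eventually_happens[of _ "at_top :: real filter"] excess_eq[OF \<alpha>] by force
    have "T powr (- \<alpha>) < 2 * T powr (- \<alpha>)" using T by simp
    then have "\<forall>\<^sub>F t in at_top. U (T * t) / U t < 2 * T powr (- \<alpha>)"
      using T by (intro order_tendstoD(2)[OF U_regularly_varying]) auto
    then have "\<forall>\<^sub>F t in at_top. \<bar>?A t / U t
        - ?B T t / U t\<bar> \<le> e"
      using eventually_gt_at_top[of 0] eventually_ge_at_top[of t0]
    proof eventually_elim
      case (elim t)
      have "1 * t \<le> T * t" using elim T by (intro mult_right_mono) auto
      then have t: "t > 0" "T * t > 0" "T * t \<ge> t0" using elim by linarith+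
      have iT: "integrable N (\<lambda>h. l \<bullet> (T *\<^sub>R clip (T * t) h - clip t h))"
        using intclip[OF t(1)] intclip[OF t(2)] by (simp add: inner_diff_right)
      have "\<bar>?A t - ?B T t\<bar>
          = \<bar>LINT h|N. ?d T t h\<bar>"
        using iT intl intclip[OF t(1)]
        by (subst Bochner_Integration.integral_diff[of N "\<lambda>h. l \<bullet> (h /\<^sub>R t) - l \<bullet> clip t h"]) auto
      also have "\<dots> \<le> (LINT h|N. \<bar>?d T t h\<bar>)"
        by (rule integral_abs_bound)
      also have "\<dots> \<le> (LINT h|N. norm l / t * (norm h * indicator {h. norm h > T * t} h))"
      proof (rule integral_mono)
        show "integrable N (\<lambda>h. \<bar>?d T t h\<bar>)"
          using iT intl intclip[OF t(1)] by auto
        show "integrable N (\<lambda>h. norm l / t * (norm h * indicator {h. norm h > T * t} h))"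
          by (intro integrable_mult_right Bochner_Integration.integrable_bound[OF intn])
            (auto simp: indicator_def)
        fix h :: 'a
        have "?d T t h
            = l \<bullet> (h /\<^sub>R t - T *\<^sub>R clip (T * t) h)"
          by (simp add: inner_diff_right)
        also have "\<bar>\<dots>\<bar> \<le> norm l * norm (h /\<^sub>R t - T *\<^sub>R clip (T * t) h)"
          by (rule Cauchy_Schwarz_ineq2)
        also have "\<dots> \<le> norm l * (norm h / t * indicator {h. norm h > T * t} h)"
        proof (rule mult_left_mono)
          show "norm (h /\<^sub>R t - T *\<^sub>R clip (T * t) h) \<le> norm h / t * indicator {h. norm h > T * t} h"
          proof (cases "norm h > T * t")
            case True
            have "h /\<^sub>R t - T *\<^sub>R clip (T * t) h = (1 / t - T / norm h) *\<^sub>R h"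
              using True t by (simp add: clip_outside scaleR_left_diff_distrib divide_inverse)
            moreover have "\<bar>1 / t - T / norm h\<bar> \<le> 1 / t"
            proof -
              have "norm h > 0" using True t by linarith
              then have "T / norm h \<le> 1 / t" "0 \<le> T / norm h"
                using True t T by (auto simp: field_simps)
              then show ?thesis by linarith
            qed
            ultimately show ?thesis using True by (simp add: mult_right_mono[of _ "1 / t" "norm h", simplified])
          next
            case False
            then show ?thesis using t T by (simp add: clip_inside)
          qed
        qed simp
        finally show "\<bar>?d T t h\<bar>
            \<le> norm l / t * (norm h * indicator {h. norm h > T * t} h)" by simp
      qed
      also have "\<dots> = norm l / t * (LINT h|N. norm h * indicator {h. norm h > T * t} h)" by simp
      also have "\<dots> \<le> norm l / t * (C * (T * t) * U (T * t))"
        using t by (intro mult_left_mono C(3)) auto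
      also have "\<dots> = norm l * C * T * U (T * t)" using t by simp
      also have "\<dots> \<le> norm l * C * T * (2 * T powr (- \<alpha>) * U t)"
        using elim(1) C T U_pos[of t] by (intro mult_left_mono) (auto simp: divide_less_eq)
      also have "\<dots> = norm l * C * 2 * T powr (1 - \<alpha>) * U t"
        using T by (simp add: powr_diff powr_minus divide_inverse)
      also have "\<dots> \<le> e * U t" using T U_nonneg by (intro mult_right_mono) auto
      finally have "\<bar>?A t - ?B T t\<bar> \<le> e * U t" .
      then show ?case using U_pos[of t] by (simp add: abs_diff_divide pos_divide_le_eq)
    qed
    then show "\<exists>A' B'. (A' \<longlongrightarrow> B') at_top
        \<and> (\<forall>\<^sub>F t in at_top. \<bar>?A t / U t - A' t\<bar> \<le> e)
        \<and> \<bar>?E - B'\<bar> \<le> e"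
      using excess_limit[OF T(1), of l] T(3)
      by (intro exI[of _ "\<lambda>t. ?B T t / U t"]
          exI[of _ "excess l T / mass"]) auto
  qed
  then have "((\<lambda>t. - (?A t / U t))
      \<longlongrightarrow> - (?E)) at_top"
    by (rule tendsto_minus)
  then show ?thesis
  proof (rule Lim_transform_eventually)
    show "\<forall>\<^sub>F t in at_top. - (?A t / U t) = (LINT h|N. l \<bullet> clip t h) / U t"
      using eventually_gt_at_top[of 0]
    proof eventually_elim
      case (elim t)
      have "(LINT h|N. l \<bullet> h) = l \<bullet> (LINT h|N. h)"
        by (rule integral_inner_right) (rule intid)
      moreover have "(LINT h|N. l \<bullet> (h /\<^sub>R t)) = inverse t * (LINT h|N. l \<bullet> h)"
        unfolding inner_scaleR_right by (rule integral_mult_right_zero)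
      ultimately have "(LINT h|N. l \<bullet> (h /\<^sub>R t)) = 0" using mean0 by simp
      moreover have "?A t
          = (LINT h|N. l \<bullet> (h /\<^sub>R t)) - (LINT h|N. l \<bullet> clip t h)"
        by (rule Bochner_Integration.integral_diff[OF intl intclip[OF elim]])
      ultimately show ?case using elim by simp
    qed
  qed
qed

section \<open>The limiting cumulant generating function\<close>

lemma emeasure_mu_outside: "emeasure \<mu> (- cball 0 1) = ennreal mass"
proof -
  have *: "- cball 0 1 = {x::'a. norm x > 1}" by auto
  show ?thesis unfolding * by (rule emeasure_mu_unit_tail)
qed

lemma spectral_measure_eq:
  "spectral_measure \<mu> = scale_measure (ennreal (1 / mass))
     (distr (restrict_space \<mu> {x. norm x \<ge> 1}) (restrict_space borel (sphere 0 1)) (\<lambda>x. x /\<^sub>R norm x))"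
    (is "_ = ?\<sigma>")
  and measurable_direction:
  "(\<lambda>x. x /\<^sub>R norm x) \<in> measurable (restrict_space \<mu> {x. norm x \<ge> 1}) (restrict_space borel (sphere 0 1))"
proof -
  show meas: "(\<lambda>x. x /\<^sub>R norm x) \<in> measurable (restrict_space \<mu> {x. norm x \<ge> 1}) (restrict_space borel (sphere 0 1))"
  proof (rule measurable_restrict_space2)
    show "(\<lambda>x. x /\<^sub>R norm x) \<in> space (restrict_space \<mu> {x. norm x \<ge> 1}) \<rightarrow> sphere 0 1"
      by (auto simp: space_restrict_space space_mu)
    show "(\<lambda>x. x /\<^sub>R norm x) \<in> borel_measurable (restrict_space \<mu> {x. norm x \<ge> 1})"
      by (intro measurable_restrict_space1 measurable_mu) measurable
  qed
  show "spectral_measure \<mu> = ?\<sigma>"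
    unfolding spectral_measure_def
  proof (rule measure_of_restrict_borel_eq)
    show "space ?\<sigma> = sphere 0 1" by (simp add: space_scale_measure space_restrict_space)
    fix A assume "A \<in> sets ?\<sigma>"
    then have A: "A \<in> sets (restrict_space borel (sphere 0 1))" by simp
    have "emeasure ?\<sigma> A = ennreal (1 / mass) * emeasure (restrict_space \<mu> {x. norm x \<ge> 1})
        ((\<lambda>x. x /\<^sub>R norm x) -` A \<inter> space (restrict_space \<mu> {x. norm x \<ge> 1}))"
      using meas A by (simp add: emeasure_distr)
    also have "(\<lambda>x. x /\<^sub>R norm x) -` A \<inter> space (restrict_space \<mu> {x. norm x \<ge> 1})
        = {x. norm x \<ge> 1 \<and> x /\<^sub>R norm x \<in> A}"
      by (auto simp: space_restrict_space space_mu)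
    also have "emeasure (restrict_space \<mu> {x. norm x \<ge> 1}) {x. norm x \<ge> 1 \<and> x /\<^sub>R norm x \<in> A}
        = emeasure \<mu> {x. norm x \<ge> 1 \<and> x /\<^sub>R norm x \<in> A}"
      by (intro emeasure_restrict_space) (auto simp: space_mu in_sets_mu)
    finally show "emeasure \<mu> {x. 1 \<le> norm x \<and> x /\<^sub>R norm x \<in> A} / emeasure \<mu> (- cball 0 1) = emeasure ?\<sigma> A"
      using mass_pos
      by (simp add: emeasure_mu_outside divide_ennreal_def inverse_ennreal mult.commute divide_inverse)
  qed simp
qed

lemma integral_spectral:
  "(LINT s|spectral_measure \<mu>. l \<bullet> s) = direction_integral l / mass"
proof -
  have fm: "(\<lambda>s. l \<bullet> s) \<in> borel_measurable (restrict_space borel (sphere 0 1))"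
    by (intro measurable_restrict_space1) measurable
  have "(LINT s|spectral_measure \<mu>. l \<bullet> s)
      = 1 / mass * (LINT s|distr (restrict_space \<mu> {x. norm x \<ge> 1}) (restrict_space borel (sphere 0 1)) (\<lambda>x. x /\<^sub>R norm x). l \<bullet> s)"
    unfolding spectral_measure_eq using mass_pos fm by (intro integral_scale_measure) auto
  also have "(LINT s|distr (restrict_space \<mu> {x. norm x \<ge> 1}) (restrict_space borel (sphere 0 1)) (\<lambda>x. x /\<^sub>R norm x). l \<bullet> s)
      = (LINT x|restrict_space \<mu> {x. norm x \<ge> 1}. l \<bullet> (x /\<^sub>R norm x))"
    by (rule integral_distr[OF measurable_direction fm])
  also have "\<dots> = (LINT x|\<mu>. indicator {x. norm x \<ge> 1} x *\<^sub>R (l \<bullet> (x /\<^sub>R norm x)))"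
    by (intro integral_restrict_space) (auto simp: space_mu in_sets_mu)
  also have "\<dots> = direction_integral l"
    unfolding direction_integral_def
  proof (rule integral_cong_AE)
    show "AE x in \<mu>. indicator {x. norm x \<ge> 1} x *\<^sub>R (l \<bullet> (x /\<^sub>R norm x))
        = indicator {x. norm x > 1} x * (l \<bullet> (x /\<^sub>R norm x))"
      using AE_norm_neq_1 by eventually_elim (auto simp: indicator_def)
  qed (auto intro!: measurable_mu)
  finally show ?thesis by simp
qed

text \<open>Clipping at 1 fixes the closed unit ball and collapses its complement radially onto the
  sphere, and the preimage of a set splits accordingly. Integrals against \<nu> thereby take the
  form in which the limits of clipped expectations appear.\<close>

lemma nu_measure_eq:
  "nu_measure \<mu> = scale_measure (ennreal (1 / mass)) (distr \<mu> (restrict_space borel (- {0})) (clip 1))"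
    (is "_ = ?\<nu>")
  and measurable_clip_mu: "clip 1 \<in> measurable \<mu> (restrict_space borel (- {0}))"
proof -
  show meas: "clip 1 \<in> measurable \<mu> (restrict_space borel (- {0}))"
  proof (rule measurable_restrict_space2)
    show "clip 1 \<in> space \<mu> \<rightarrow> - {0}" by (auto simp: space_mu clip_def max_def)
    show "clip 1 \<in> borel_measurable \<mu>" by (rule measurable_mu) measurable
  qed
  show "nu_measure \<mu> = ?\<nu>"
    unfolding nu_measure_def
  proof (rule measure_of_restrict_borel_eq)
    show "space ?\<nu> = - {0}" by (simp add: space_scale_measure space_restrict_space)
    fix A assume "A \<in> sets ?\<nu>"
    then have A': "A \<in> sets (restrict_space borel (- {0}))" by simp
    then have A: "A \<in> sets borel" "0 \<notin> A"
      by (auto simp: sets_restrict_space_iff in_sets_mu[unfolded sets_mu])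
    \<comment> \<open>\<open>B\<close> is the part of the preimage outside the closed ball,
      \<open>B'\<close> what the spectral measure counts; they differ only on the null unit
      sphere.\<close>
    define B where "B = {x. norm x > 1 \<and> x /\<^sub>R norm x \<in> A}"
    define B' where "B' = {x. norm x \<ge> 1 \<and> x /\<^sub>R norm x \<in> A \<inter> sphere 0 1}"
    have BB: "B \<in> sets \<mu>" "B' \<in> sets \<mu>"
      using A by (auto simp: B_def B'_def in_sets_mu)
    have inv: "inverse (norm x) * norm x = 1" if "1 \<le> norm x" for x :: 'a
    proof -
      have "x \<noteq> 0" using that by auto
      then show ?thesis by simp
    qed
    have "emeasure \<mu> B = emeasure \<mu> B'"
    proof (rule emeasure_eq_AE[OF _ BB])
      show "AE x in \<mu>. (x \<in> B) = (x \<in> B')"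
        using AE_norm_neq_1 by eventually_elim (auto simp: B_def B'_def less_le inv)
    qed
    moreover have "emeasure (spectral_measure \<mu>) (A \<inter> sphere 0 1) = ennreal (1 / mass) * emeasure \<mu> B'"
    proof -
      have S: "A \<inter> sphere 0 1 \<in> sets (restrict_space borel (sphere 0 1))"
        using A by (simp add: sets_restrict_space_iff)
      have "emeasure (spectral_measure \<mu>) (A \<inter> sphere 0 1) = ennreal (1 / mass) * emeasure (restrict_space \<mu> {x. norm x \<ge> 1})
          ((\<lambda>x. x /\<^sub>R norm x) -` (A \<inter> sphere 0 1) \<inter> space (restrict_space \<mu> {x. norm x \<ge> 1}))"
        unfolding spectral_measure_eq using measurable_direction S by (simp add: emeasure_distr)
      also have "(\<lambda>x. x /\<^sub>R norm x) -` (A \<inter> sphere 0 1) \<inter> space (restrict_space \<mu> {x. norm x \<ge> 1}) = B'"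
        by (auto simp: space_restrict_space space_mu B'_def)
      also have "emeasure (restrict_space \<mu> {x. norm x \<ge> 1}) B' = emeasure \<mu> B'"
        by (intro emeasure_restrict_space) (auto simp: space_mu in_sets_mu B'_def)
      finally show ?thesis .
    qed
    ultimately have spec: "emeasure (spectral_measure \<mu>) (A \<inter> sphere 0 1) = ennreal (1 / mass) * emeasure \<mu> B"
      by simp
    have "emeasure ?\<nu> A = ennreal (1 / mass) * emeasure \<mu> (clip 1 -` A \<inter> space \<mu>)"
      using meas A' by (simp add: emeasure_distr)
    also have "clip 1 -` A \<inter> space \<mu> = (A \<inter> cball 0 1) \<union> B"
    proof (intro set_eqI)
      fix x
      show "x \<in> clip 1 -` A \<inter> space \<mu> \<longleftrightarrow> x \<in> (A \<inter> cball 0 1) \<union> B"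
        using A by (cases "norm x \<le> 1") (auto simp: space_mu B_def clip_inside clip_outside)
    qed
    also have "emeasure \<mu> ((A \<inter> cball 0 1) \<union> B) = emeasure \<mu> (A \<inter> cball 0 1) + emeasure \<mu> B"
      using A BB by (intro plus_emeasure[symmetric]) (auto simp: in_sets_mu B_def)
    finally show "emeasure \<mu> (A \<inter> cball 0 1) / emeasure \<mu> (- cball 0 1)
        + emeasure (spectral_measure \<mu>) (A \<inter> sphere 0 1) = emeasure ?\<nu> A"
      using mass_pos unfolding spec
      by (simp add: emeasure_mu_outside divide_ennreal_def inverse_ennreal mult.commute divide_inverse distrib_left)
  qed simp
qed

lemma integral_nu:
  fixes f :: "'a \<Rightarrow> real"
  assumes [measurable]: "f \<in> borel_measurable borel"
  shows "(LINT x|nu_measure \<mu>. f x) = (LINT x|\<mu>. f (clip 1 x)) / mass"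
proof -
  have fm: "f \<in> borel_measurable (restrict_space borel (- {0}))"
    by (intro measurable_restrict_space1) measurable
  have "(LINT x|nu_measure \<mu>. f x) = 1 / mass * (LINT x|distr \<mu> (restrict_space borel (- {0})) (clip 1). f x)"
    unfolding nu_measure_eq using mass_pos fm by (intro integral_scale_measure) auto
  also have "\<dots> = 1 / mass * (LINT x|\<mu>. f (clip 1 x))"
    by (subst integral_distr[OF measurable_clip_mu fm]) simp
  finally show ?thesis by simp
qed

section \<open>Exponential integrals against the limit measure\<close>

text \<open>Shared regularity of the three forms of \<open>\<Lambda>\<close>: \<open>p = 0\<close> for \<open>exp u - 1\<close> and \<open>p = 1\<close> for
  \<open>exp u - 1 - u\<close>.\<close>

context
  fixes \<psi> \<psi>' :: "real \<Rightarrow> real" and p :: nat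
  assumes \<psi>: "\<And>u. (\<psi> has_real_derivative \<psi>' u) (at u)" and \<psi>0: "\<psi> 0 = 0"
    and \<psi>': "continuous_on UNIV \<psi>'" and \<psi>'_bound: "\<And>u. \<bar>\<psi>' u\<bar> \<le> exp \<bar>u\<bar> * \<bar>u\<bar> ^ p"
    and p: "\<alpha> < real (Suc p)"
begin

text \<open>A mean value estimate with arguments of size at most \<open>R * norm y\<close>. The
  weight \<open>norm y ^ Suc p\<close> is \<mu>-integrable after clipping, so this single bound
  gives integrability, local Lipschitz continuity in \<open>l\<close>, and a dominating function for
  difference quotients.\<close>

lemma psi_increment:
  assumes y: "norm y \<le> 1" and l: "norm l \<le> R" "norm l' \<le> R"
  shows "\<bar>\<psi> (l \<bullet> y) - \<psi> (l' \<bullet> y)\<bar> \<le> exp R * R ^ p * norm (l - l') * norm y ^ Suc p"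
proof -
  have R: "R \<ge> 0" using l norm_ge_zero[of l] by linarith
  let ?I = "cball 0 (R * norm y) :: real set"
  have "\<bar>l \<bullet> y\<bar> \<le> R * norm y" "\<bar>l' \<bullet> y\<bar> \<le> R * norm y"
    using Cauchy_Schwarz_ineq2[of l y] Cauchy_Schwarz_ineq2[of l' y] l
    by (meson mult_right_mono norm_ge_zero order_trans)+
  then have I: "l \<bullet> y \<in> ?I" "l' \<bullet> y \<in> ?I" by auto
  have "norm (\<psi> (l \<bullet> y) - \<psi> (l' \<bullet> y)) \<le> (exp R * (R * norm y) ^ p) * norm (l \<bullet> y - l' \<bullet> y)"
  proof (rule field_differentiable_bound[OF convex_cball _ _ I, of \<psi> \<psi>'])
    fix u assume u: "u \<in> ?I"
    show "(\<psi> has_field_derivative \<psi>' u) (at u within ?I)"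
      using \<psi> by (rule has_field_derivative_at_within)
    have u': "\<bar>u\<bar> \<le> R * norm y" using u by simp
    also have "\<dots> \<le> R * 1" using y R by (intro mult_left_mono) auto
    finally have "\<bar>u\<bar> \<le> R" by simp
    have "\<bar>\<psi>' u\<bar> \<le> exp \<bar>u\<bar> * \<bar>u\<bar> ^ p" by (rule \<psi>'_bound)
    also have "\<dots> \<le> exp R * (R * norm y) ^ p"
      using u' \<open>\<bar>u\<bar> \<le> R\<close> by (intro mult_mono power_mono) auto
    finally show "norm (\<psi>' u) \<le> exp R * (R * norm y) ^ p" by simp
  qed
  also have "norm (l \<bullet> y - l' \<bullet> y) \<le> norm (l - l') * norm y"
    using Cauchy_Schwarz_ineq2[of "l - l'" y] by (simp add: inner_diff_left)
  finally have "\<bar>\<psi> (l \<bullet> y) - \<psi> (l' \<bullet> y)\<bar> \<le> exp R * (R * norm y) ^ p * (norm (l - l') * norm y)"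
    using R by (simp add: mult_left_mono)
  then show ?thesis by (simp add: power_mult_distrib mult_ac)
qed

lemma psi_growth:
  "norm y \<le> 1 \<Longrightarrow> \<bar>\<psi> (l \<bullet> y)\<bar> \<le> exp (norm l) * norm l ^ p * norm l * norm y ^ Suc p"
  using psi_increment[of y l "norm l" 0] by (simp add: \<psi>0)

lemma psi_continuous: "continuous_on UNIV \<psi>"
  using \<psi> DERIV_isCont by (intro continuous_at_imp_continuous_on) blast

lemma psi_inner_continuous: "continuous_on UNIV (\<lambda>y. \<psi> (l \<bullet> y))"
  by (rule continuous_on_compose2[OF psi_continuous]) (auto intro!: continuous_intros)

lemma psi_inner_measurable [measurable]: "(\<lambda>y. \<psi> (l \<bullet> y)) \<in> borel_measurable borel"
  by (rule borel_measurable_continuous_onI[OF psi_inner_continuous])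

lemma integrable_psi_mu: "integrable \<mu> (\<lambda>x. \<psi> (l \<bullet> clip 1 x))"
  by (rule integrable_mu_clip[OF psi_inner_continuous psi_growth p])

lemma psi_limit:
  "((\<lambda>t. (LINT h|N. \<psi> (l \<bullet> clip t h)) / U t) \<longlongrightarrow> (LINT x|nu_measure \<mu>. \<psi> (l \<bullet> x))) at_top"
  using clip_limit[OF psi_inner_continuous psi_growth p] integral_nu[OF psi_inner_measurable] by simp

lemma psi_integral_continuous:
  "continuous_on UNIV (\<lambda>l. LINT x|nu_measure \<mu>. \<psi> (l \<bullet> x))"
proof (rule continuous_at_imp_continuous_on, intro ballI)
  fix l :: 'a
  let ?G = "\<lambda>l. LINT x|nu_measure \<mu>. \<psi> (l \<bullet> x)"
  \<comment> \<open>One radius for all points within distance 1 of \<open>l\<close> gives a common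
    Lipschitz constant \<open>D\<close> there.\<close>
  define R where "R = norm l + 1"
  define D where "D = exp R * R ^ p * (LINT x|\<mu>. norm (clip 1 x) ^ Suc p) / mass"
  have le: "\<bar>?G k - ?G l\<bar> \<le> D * norm (k - l)" if k: "norm k \<le> R" for k
  proof -
    have "?G k - ?G l = (LINT x|\<mu>. \<psi> (k \<bullet> clip 1 x) - \<psi> (l \<bullet> clip 1 x)) / mass"
      using integrable_psi_mu
      by (simp add: integral_nu Bochner_Integration.integral_diff diff_divide_distrib)
    also have "\<bar>\<dots>\<bar> = \<bar>LINT x|\<mu>. \<psi> (k \<bullet> clip 1 x) - \<psi> (l \<bullet> clip 1 x)\<bar> / mass"
      using mass_pos by (simp add: abs_divide)
    also have "\<dots> \<le> (LINT x|\<mu>. \<bar>\<psi> (k \<bullet> clip 1 x) - \<psi> (l \<bullet> clip 1 x)\<bar>) / mass"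
      using mass_pos by (intro divide_right_mono integral_abs_bound) auto
    also have "(LINT x|\<mu>. \<bar>\<psi> (k \<bullet> clip 1 x) - \<psi> (l \<bullet> clip 1 x)\<bar>)
        \<le> (LINT x|\<mu>. exp R * R ^ p * norm (k - l) * norm (clip 1 x) ^ Suc p)"
    proof (rule integral_mono)
      show "integrable \<mu> (\<lambda>x. \<bar>\<psi> (k \<bullet> clip 1 x) - \<psi> (l \<bullet> clip 1 x)\<bar>)"
        using integrable_psi_mu by auto
      show "integrable \<mu> (\<lambda>x. exp R * R ^ p * norm (k - l) * norm (clip 1 x) ^ Suc p)"
        using integrable_mu_clip_power[OF p] by (rule integrable_mult_right)
      show "\<bar>\<psi> (k \<bullet> clip 1 x) - \<psi> (l \<bullet> clip 1 x)\<bar> \<le> exp R * R ^ p * norm (k - l) * norm (clip 1 x) ^ Suc p" for x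
        using k by (intro psi_increment norm_clip_le_1) (auto simp: R_def)
    qed
    also have "(LINT x|\<mu>. exp R * R ^ p * norm (k - l) * norm (clip 1 x) ^ Suc p) / mass = D * norm (k - l)"
      by (simp add: D_def)
    finally show ?thesis using mass_pos by (simp add: divide_right_mono)
  qed
  have "\<forall>\<^sub>F k in at l. norm (k - l) < 1"
    using eventually_at_ball[of 1 l UNIV] by (auto simp: dist_norm norm_minus_commute)
  then have ev: "\<forall>\<^sub>F k in at l. norm (?G k - ?G l) \<le> D * norm (k - l)"
  proof eventually_elim
    case (elim k)
    have "norm k \<le> R" using elim norm_triangle_sub[of k l] by (simp add: R_def)
    then show ?case using le by simp
  qed
  have "((\<lambda>k. D * norm (k - l)) \<longlongrightarrow> D * norm (l - l)) (at l)"
    by (intro tendsto_intros)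
  then have "((\<lambda>k. D * norm (k - l)) \<longlongrightarrow> 0) (at l)" by simp
  with ev have "((\<lambda>k. ?G k - ?G l) \<longlongrightarrow> 0) (at l)"
    by (rule Lim_null_comparison)
  then show "isCont ?G l" by (simp add: isCont_def LIM_zero_iff)
qed

lemma psi_integral_differentiable:
  "(\<lambda>t. LINT x|nu_measure \<mu>. \<psi> ((l + t *\<^sub>R u) \<bullet> x)) differentiable (at 0)"
proof -
  let ?G = "\<lambda>t. LINT x|\<mu>. \<psi> ((l + t *\<^sub>R u) \<bullet> clip 1 x)"
  define R where "R = norm l + norm u"
  let ?D = "LINT x|\<mu>. \<psi>' (l \<bullet> clip 1 x) * (u \<bullet> clip 1 x)" and ?w = "\<lambda>x. exp R * R ^ p * norm u * norm (clip 1 x) ^ Suc p"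
  have m': "\<psi>' \<in> borel_measurable borel" using \<psi>' by (rule borel_measurable_continuous_onI)
  have "((\<lambda>t. (?G t - ?G 0) / t) \<longlongrightarrow> ?D) (at 0)"
    unfolding tendsto_at_iff_sequentially
  proof (intro allI impI)
    fix X :: "nat \<Rightarrow> real" assume X: "\<forall>i. X i \<in> UNIV - {0}" "X \<longlonglongrightarrow> 0"
    have "\<forall>\<^sub>F n in sequentially. \<bar>X n\<bar> < 1"
      using tendstoD[OF X(2), of 1] by simp
    \<comment> \<open>Domination is required at every index, so the initial segment with
      \<open>\<bar>X n\<bar> \<ge> 1\<close> is discarded and the shift undone at the end.\<close>
    then obtain n0 where n0: "\<And>n. n \<ge> n0 \<Longrightarrow> \<bar>X n\<bar> < 1" by (auto simp: eventually_sequentially)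
    define Y where "Y n = X (n + n0)" for n
    have Y: "Y n \<noteq> 0" "\<bar>Y n\<bar> < 1" for n using X n0 by (auto simp: Y_def)
    have Y0: "Y \<longlonglongrightarrow> 0" unfolding Y_def using X(2) by (rule LIMSEQ_ignore_initial_segment)
    let ?q = "\<lambda>n x. (\<psi> ((l + Y n *\<^sub>R u) \<bullet> clip 1 x) - \<psi> (l \<bullet> clip 1 x)) / Y n"
    have "(\<lambda>n. LINT x|\<mu>. ?q n x)
        \<longlonglongrightarrow> ?D"
    proof (rule integral_dominated_convergence[where w = "\<lambda>x. ?w x"])
      show "integrable \<mu> (\<lambda>x. ?w x)"
        using integrable_mu_clip_power[OF p] by (rule integrable_mult_right)
      show "(\<lambda>x. ?q n x) \<in> borel_measurable \<mu>" for n
        using integrable_psi_mu[THEN borel_measurable_integrable] by auto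
      show "(\<lambda>x. \<psi>' (l \<bullet> clip 1 x) * (u \<bullet> clip 1 x)) \<in> borel_measurable \<mu>"
        using m' by (intro measurable_mu borel_measurable_times measurable_compose[OF _ m']) measurable
      show "AE x in \<mu>. (\<lambda>n. ?q n x)
          \<longlonglongrightarrow> \<psi>' (l \<bullet> clip 1 x) * (u \<bullet> clip 1 x)"
      proof (rule AE_I2)
        fix x
        let ?v = "l \<bullet> clip 1 x" and ?w = "u \<bullet> clip 1 x"
        have "((\<lambda>t. \<psi> (?v + t * ?w)) has_real_derivative \<psi>' (?v + 0 * ?w) * ?w) (at 0)"
          by (rule DERIV_chain2[OF \<psi>]) (auto intro!: derivative_eq_intros)
        then have "((\<lambda>t. (\<psi> (?v + t * ?w) - \<psi> ?v) / t) \<longlongrightarrow> \<psi>' ?v * ?w) (at 0)"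
          by (simp add: has_field_derivative_iff)
        moreover have "filterlim Y (at 0) sequentially" using Y Y0 by (intro filterlim_atI) auto
        ultimately have "(\<lambda>n. (\<psi> (?v + Y n * ?w) - \<psi> ?v) / Y n) \<longlonglongrightarrow> \<psi>' ?v * ?w"
          by (rule filterlim_compose)
        then show "(\<lambda>n. (\<psi> ((l + Y n *\<^sub>R u) \<bullet> clip 1 x) - \<psi> ?v) / Y n) \<longlonglongrightarrow> \<psi>' ?v * ?w"
          by (simp add: inner_add_left)
      qed
      show "AE x in \<mu>. norm (?q n x)
          \<le> ?w x" for n
      proof (rule AE_I2)
        fix x
        have "norm (l + Y n *\<^sub>R u) \<le> norm l + norm (Y n *\<^sub>R u)" by (rule norm_triangle_ineq)
        also have "\<dots> \<le> R" using Y(2)[of n] by (simp add: R_def mult_left_le_one_le)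
        finally have "\<bar>\<psi> ((l + Y n *\<^sub>R u) \<bullet> clip 1 x) - \<psi> (l \<bullet> clip 1 x)\<bar>
            \<le> exp R * R ^ p * norm ((l + Y n *\<^sub>R u) - l) * norm (clip 1 x) ^ Suc p"
          by (intro psi_increment norm_clip_le_1) (auto simp: R_def)
        then have "\<bar>\<psi> ((l + Y n *\<^sub>R u) \<bullet> clip 1 x) - \<psi> (l \<bullet> clip 1 x)\<bar>
            \<le> \<bar>Y n\<bar> * (?w x)"
          by (simp add: mult_ac)
        then show "norm (?q n x)
          \<le> ?w x"
          using Y(1)[of n] by (simp add: abs_divide pos_divide_le_eq mult.commute)
      qed
    qed
    moreover have "(LINT x|\<mu>. ?q n x) = (?G (Y n) - ?G 0) / Y n" for n
      using integrable_psi_mu by (simp add: Bochner_Integration.integral_diff)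
    ultimately have "(\<lambda>n. (?G (Y n) - ?G 0) / Y n)
        \<longlonglongrightarrow> ?D"
      by (simp only:)
    then have "(\<lambda>n. (?G (X (n + n0)) - ?G 0) / X (n + n0))
        \<longlonglongrightarrow> ?D"
      unfolding Y_def .
    then show "((\<lambda>t. (?G t - ?G 0) / t) \<circ> X) \<longlonglongrightarrow> ?D"
      unfolding comp_def by (rule LIMSEQ_offset)
  qed
  then have "(?G has_real_derivative ?D) (at 0)"
    by (simp add: has_field_derivative_iff)
  then have "((\<lambda>t. ?G t / mass) has_real_derivative ?D / mass) (at 0)"
    by (rule DERIV_cdivide)
  then show ?thesis
    by (auto simp: integral_nu real_differentiable_def)
qed

end

lemma exp_minus_1_bound: "\<bar>exp u - 1\<bar> \<le> exp \<bar>u\<bar> * \<bar>u\<bar>" for u :: real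
proof -
  have "norm (exp u - exp 0) \<le> exp \<bar>u\<bar> * norm (u - 0)"
    by (rule field_differentiable_bound[of "{- \<bar>u\<bar>..\<bar>u\<bar>}" exp exp]) (auto intro!: derivative_eq_intros)
  then show ?thesis by simp
qed

lemma exp_minus_1_facts:
  "((\<lambda>u::real. exp u - 1) has_real_derivative exp v) (at v)" "exp 0 - 1 = (0::real)"
  "continuous_on UNIV (exp :: real \<Rightarrow> real)" "\<bar>exp v\<bar> \<le> exp \<bar>v\<bar> * \<bar>v::real\<bar> ^ 0"
  by (auto intro!: derivative_eq_intros continuous_intros)

lemma exp_minus_1_minus_facts:
  "((\<lambda>u::real. exp u - 1 - u) has_real_derivative (exp v - 1)) (at v)" "exp 0 - 1 - 0 = (0::real)"
  "continuous_on UNIV (\<lambda>u::real. exp u - 1)" "\<bar>exp v - 1\<bar> \<le> exp \<bar>v\<bar> * \<bar>v::real\<bar> ^ Suc 0"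
  using exp_minus_1_bound[of v] by (auto intro!: derivative_eq_intros continuous_intros)

lemmas exp_minus_1_integral =
  psi_limit[of "\<lambda>u. exp u - 1" exp 0, OF exp_minus_1_facts]
  psi_integral_continuous[of "\<lambda>u. exp u - 1" exp 0, OF exp_minus_1_facts]
  psi_integral_differentiable[of "\<lambda>u. exp u - 1" exp 0, OF exp_minus_1_facts]

lemmas exp_minus_1_minus_integral =
  psi_limit[of "\<lambda>u. exp u - 1 - u" "\<lambda>u. exp u - 1" "Suc 0", OF exp_minus_1_minus_facts]
  psi_integral_continuous[of "\<lambda>u. exp u - 1 - u" "\<lambda>u. exp u - 1" "Suc 0", OF exp_minus_1_minus_facts]
  psi_integral_differentiable[of "\<lambda>u. exp u - 1 - u" "\<lambda>u. exp u - 1" "Suc 0", OF exp_minus_1_minus_facts]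

section \<open>Regularity of the limit and convergence of clipped moments\<close>

lemma Lambda_small: "\<alpha> < 1 \<Longrightarrow> Lambda \<alpha> \<mu> = (\<lambda>l. LINT x|nu_measure \<mu>. exp (l \<bullet> x) - 1)"
  by (simp add: Lambda_def fun_eq_iff)

lemma Lambda_large:
  "\<not> \<alpha> < 1 \<Longrightarrow> Lambda \<alpha> \<mu> = (\<lambda>l. (LINT x|nu_measure \<mu>. exp (l \<bullet> x) - 1 - l \<bullet> x)
     - (if \<alpha> = 1 then 0 else direction_integral l / mass / (\<alpha> - 1)))"
  by (auto simp: Lambda_def fun_eq_iff integral_spectral)

lemma direction_integral_linear:
  "direction_integral (l + t *\<^sub>R u) = direction_integral l + t * direction_integral u"
proof -
  have i: "integrable \<mu> (\<lambda>x. indicator {x. norm x > 1} x * (l \<bullet> (x /\<^sub>R norm x)))" for l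
  proof (rule integrable_mu_bounded[where s = 1 and C = "norm l"])
    fix x :: 'a
    have "\<bar>l \<bullet> (x /\<^sub>R norm x)\<bar> \<le> norm l * norm (x /\<^sub>R norm x)" by (rule Cauchy_Schwarz_ineq2)
    also have "\<dots> \<le> norm l * 1"
      by (intro mult_left_mono) (cases "x = 0", auto)
    finally show "\<bar>indicator {x. norm x > 1} x * (l \<bullet> (x /\<^sub>R norm x))\<bar> \<le> norm l * indicator {x. norm x > 1} x"
      by (auto simp: indicator_def)
  qed auto
  have "direction_integral (l + t *\<^sub>R u) = (LINT x|\<mu>. indicator {x. norm x > 1} x * (l \<bullet> (x /\<^sub>R norm x))
      + t * (indicator {x. norm x > 1} x * (u \<bullet> (x /\<^sub>R norm x))))"
    unfolding direction_integral_def
    by (intro Bochner_Integration.integral_cong) (auto simp: inner_add_left algebra_simps)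
  also have "\<dots> = direction_integral l + t * direction_integral u"
    unfolding direction_integral_def using i by (subst Bochner_Integration.integral_add) auto
  finally show ?thesis .
qed

lemma direction_integral_continuous: "continuous_on UNIV direction_integral"
proof -
  have "linear direction_integral"
  proof (rule linearI)
    show "direction_integral (x + y) = direction_integral x + direction_integral y" for x y
      using direction_integral_linear[of x 1 y] by simp
    have "direction_integral 0 = 0" by (simp add: direction_integral_def)
    then show "direction_integral (c *\<^sub>R x) = c *\<^sub>R direction_integral x" for c x
      using direction_integral_linear[of 0 c x] by simp
  qed
  then show ?thesis by (simp add: linear_continuous_on linear_conv_bounded_linear)
qed

lemma Lambda_continuous:
  assumes "\<alpha> < 2"
  shows "continuous_on UNIV (Lambda \<alpha> \<mu>)"
proof (cases "\<alpha> < 1")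
  case True
  then show ?thesis unfolding Lambda_small[OF True]
    by (intro exp_minus_1_integral) simp
next
  case False
  have "continuous_on UNIV (\<lambda>l. LINT x|nu_measure \<mu>. exp (l \<bullet> x) - 1 - l \<bullet> x)"
    using assms by (intro exp_minus_1_minus_integral) simp
  then show ?thesis unfolding Lambda_large[OF False]
    using mass_pos False
    by (cases "\<alpha> = 1") (auto intro!: continuous_intros direction_integral_continuous)
qed

lemma Lambda_differentiable:
  assumes "\<alpha> < 2"
  shows "(\<lambda>t. Lambda \<alpha> \<mu> (l + t *\<^sub>R u)) differentiable (at 0)"
proof (cases "\<alpha> < 1")
  case True
  then show ?thesis unfolding Lambda_small[OF True]
    by (intro exp_minus_1_integral) simp
next
  case False
  have d1: "(\<lambda>t. LINT x|nu_measure \<mu>. exp ((l + t *\<^sub>R u) \<bullet> x) - 1 - (l + t *\<^sub>R u) \<bullet> x) differentiable (at 0)"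
    using assms by (intro exp_minus_1_minus_integral) simp
  have d2: "(\<lambda>t. direction_integral (l + t *\<^sub>R u) / mass / (\<alpha> - 1)) differentiable (at 0)"
    unfolding direction_integral_linear divide_inverse by simp
  show ?thesis
  proof (cases "\<alpha> = 1")
    case True
    then show ?thesis unfolding Lambda_large[OF False] using d1 by (simp only: simp_thms if_True diff_zero)
  next
    case neq: False
    show ?thesis unfolding Lambda_large[OF False] if_not_P[OF neq]
      by (rule differentiable_diff[OF d1 d2])
  qed
qed

lemma clipped_mgf_limit:
  assumes \<alpha>: "\<alpha> < 2"
    and symmetric: "\<alpha> = 1 \<Longrightarrow> distr N N uminus = N"
    and centered: "\<alpha> > 1 \<Longrightarrow> has_bochner_integral N (\<lambda>h. h) 0"
  shows "((\<lambda>t. (LINT h|N. exp (l \<bullet> clip t h) - 1) / U t) \<longlongrightarrow> Lambda \<alpha> \<mu> l) at_top"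
proof (cases "\<alpha> < 1")
  case True
  then show ?thesis unfolding Lambda_small[OF True]
    by (intro exp_minus_1_integral) simp
next
  case False
  have lim2: "((\<lambda>t. (LINT h|N. exp (l \<bullet> clip t h) - 1 - l \<bullet> clip t h) / U t)
      \<longlongrightarrow> (LINT x|nu_measure \<mu>. exp (l \<bullet> x) - 1 - l \<bullet> x)) at_top"
    using \<alpha> by (intro exp_minus_1_minus_integral) simp
  have lim1: "((\<lambda>t. (LINT h|N. l \<bullet> clip t h) / U t)
      \<longlongrightarrow> - (if \<alpha> = 1 then 0 else direction_integral l / mass / (\<alpha> - 1))) at_top"
  proof (cases "\<alpha> = 1")
    case True
    have "(LINT h|N. l \<bullet> clip t h) = 0" for t
    proof -
      have "(LINT h|N. l \<bullet> clip t h) = (LINT h|distr N N uminus. l \<bullet> clip t h)"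
        using symmetric[OF True] by simp
      also have "\<dots> = (LINT h|N. l \<bullet> clip t (- h))"
        by (rule integral_distr) measurable
      also have "\<dots> = - (LINT h|N. l \<bullet> clip t h)"
        by (simp add: clip_minus)
      finally show ?thesis by simp
    qed
    then show ?thesis using True by simp
  next
    case neq: False
    then show ?thesis using linear_limit[of l] centered False by (simp add: mult.commute)
  qed
  have "((\<lambda>t. (LINT h|N. exp (l \<bullet> clip t h) - 1 - l \<bullet> clip t h) / U t + (LINT h|N. l \<bullet> clip t h) / U t)
      \<longlongrightarrow> Lambda \<alpha> \<mu> l) at_top"
    unfolding Lambda_large[OF False] using tendsto_add[OF lim2 lim1] by simp
  then show ?thesis
  proof (rule Lim_transform_eventually)
    show "\<forall>\<^sub>F t in at_top. (LINT h|N. exp (l \<bullet> clip t h) - 1 - l \<bullet> clip t h) / U t + (LINT h|N. l \<bullet> clip t h) / U t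
        = (LINT h|N. exp (l \<bullet> clip t h) - 1) / U t"
      using eventually_gt_at_top[of 0]
    proof eventually_elim
      case (elim t)
      have lc: "\<bar>l \<bullet> clip t h\<bar> \<le> norm l" for h
        using Cauchy_Schwarz_ineq2[of l "clip t h"] norm_clip_le_1[OF elim, of h]
        by (meson mult_left_le norm_ge_zero order_trans)
      have 1: "integrable N (\<lambda>h. l \<bullet> clip t h)" using lc by (intro integrable_N_bounded[of _ "norm l"]) auto
      have "integrable N (\<lambda>h. exp (l \<bullet> clip t h))"
        using lc by (intro integrable_N_bounded[of _ "exp (norm l)"]) (auto simp: abs_le_iff)
      then have 2: "integrable N (\<lambda>h. exp (l \<bullet> clip t h) - 1)" by simp
      show ?case using 1 2 by (simp add: Bochner_Integration.integral_diff diff_divide_distrib)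
    qed
  qed
qed

section \<open>Truncated sums\<close>

lemma truncate_vec_clip:
  "t > 0 \<Longrightarrow> truncate_vec t h x /\<^sub>R t = clip t h + (x / t * indicator {h. norm h > t} h) *\<^sub>R clip t h"
proof (cases "norm h \<le> t")
  case False
  assume t: "t > 0"
  have "truncate_vec t h x /\<^sub>R t = ((t + x) / t) *\<^sub>R (h /\<^sub>R norm h)"
    using False by (simp add: truncate_vec_def divide_inverse)
  also have "(t + x) / t = 1 + x / t" using t by (simp add: add_divide_distrib)
  also have "h /\<^sub>R norm h = clip t h" using False t by (simp add: clip_outside)
  finally show ?thesis using False by (simp add: scaleR_left_distrib)
qed (simp add: truncate_vec_def clip_inside)

text \<open>\<open>L\<close> acts only on \<open>norm h > t\<close>, an event of probability
  \<open>U t\<close>, and there changes the exponential by at most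
  \<open>exp (norm l) * g t x\<close>. By independence the total error is
  \<open>exp (norm l) * U t * G t\<close>, and \<open>G t\<close> tends to 0, so the division by
  \<open>U t\<close> is harmless.\<close>

lemma truncated_mgf_limit:
  fixes Q :: "real measure"
  assumes Q: "prob_space Q" and sets_Q [measurable_cong]: "sets Q = sets borel"
    and \<epsilon>: "\<epsilon> > 0" and exp_int: "integrable Q (\<lambda>x. exp (\<epsilon> * \<bar>x\<bar>))"
    and lim: "((\<lambda>t. (LINT h|N. exp (l \<bullet> clip t h) - 1) / U t) \<longlongrightarrow> \<Lambda>) at_top"
  shows "\<forall>\<^sub>F t in at_top. integrable (N \<Otimes>\<^sub>M Q) (\<lambda>z. exp (l \<bullet> (truncate_vec t (fst z) (snd z) /\<^sub>R t)))"
    and "((\<lambda>t. ((LINT z|(N \<Otimes>\<^sub>M Q). exp (l \<bullet> (truncate_vec t (fst z) (snd z) /\<^sub>R t))) - 1) / U t) \<longlongrightarrow> \<Lambda>) at_top"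
proof -
  interpret Q: prob_space Q by fact
  interpret NQ: pair_prob_space N Q ..
  let ?f = "\<lambda>t z. exp (l \<bullet> (truncate_vec t (fst z) (snd z) /\<^sub>R t))"
  let ?R = "N \<Otimes>\<^sub>M Q" and ?e = "\<lambda>t z. exp (l \<bullet> clip t (fst z))"
  let ?F = "\<lambda>t. (LINT z|(N \<Otimes>\<^sub>M Q). ?f t z)" and ?I = "\<lambda>t. (LINT h|N. exp (l \<bullet> clip t h) - 1)"
  define g where "g t x = exp (norm l * \<bar>x\<bar> / t) - 1" for t x :: real
  define G where "G t = (LINT x|Q. g t x)" for t
  have g0: "g t x \<ge> 0" if "t > 0" for t x using that by (simp add: g_def)
  have [measurable]: "g t \<in> borel_measurable borel" for t unfolding g_def by measurable
  \<comment> \<open>From \<open>t = norm l / \<epsilon>\<close> on, the exponent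
    \<open>norm l * \<bar>x\<bar> / t\<close> is at most \<open>\<epsilon> * \<bar>x\<bar>\<close>,
    so the assumed exponential moment dominates.\<close>
  have g_le: "\<bar>g t x\<bar> \<le> exp (\<epsilon> * \<bar>x\<bar>)" if "t > 0" "t \<ge> norm l / \<epsilon>" for t x
  proof -
    have "norm l \<le> \<epsilon> * t" using that \<epsilon> by (simp add: field_simps)
    then have "norm l * \<bar>x\<bar> \<le> \<epsilon> * t * \<bar>x\<bar>" by (rule mult_right_mono) simp
    then have "norm l * \<bar>x\<bar> / t \<le> \<epsilon> * \<bar>x\<bar>" using that by (simp add: field_simps)
    then have "exp (norm l * \<bar>x\<bar> / t) \<le> exp (\<epsilon> * \<bar>x\<bar>)" by simp
    then show ?thesis using g0[OF that(1), of x] unfolding g_def by linarith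
  qed
  have g_int: "integrable Q (g t)" if "t > 0" "t \<ge> norm l / \<epsilon>" for t
    by (rule Bochner_Integration.integrable_bound[OF exp_int]) (use g_le[OF that] in auto)
  have G_lim: "(G \<longlongrightarrow> 0) at_top"
  proof -
    have "((\<lambda>t. LINT x|Q. g t x) \<longlongrightarrow> (LINT x|Q. 0)) at_top"
    proof (rule integral_dominated_convergence_at_top[where w = "\<lambda>x. exp (\<epsilon> * \<bar>x\<bar>)"])
      show "\<forall>\<^sub>F t in at_top. AE x in Q. norm (g t x) \<le> exp (\<epsilon> * \<bar>x\<bar>)"
        using eventually_gt_at_top[of 0] eventually_ge_at_top[of "norm l / \<epsilon>"]
        by eventually_elim (use g_le in auto)
      show "AE x in Q. ((\<lambda>t. g t x) \<longlongrightarrow> 0) at_top"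
      proof (rule AE_I2)
        fix x
        have "((\<lambda>t. norm l * \<bar>x\<bar> / t) \<longlongrightarrow> 0) at_top"
          by (rule tendsto_divide_0[OF tendsto_const filterlim_at_top_imp_at_infinity[OF filterlim_ident]])
        then have "((\<lambda>t. exp (norm l * \<bar>x\<bar> / t) - 1) \<longlongrightarrow> exp 0 - 1) at_top"
          by (intro tendsto_intros)
        then show "((\<lambda>t. g t x) \<longlongrightarrow> 0) at_top" by (simp add: g_def)
      qed
    qed (use exp_int in auto)
    then show ?thesis by (simp add: G_def[abs_def])
  qed
  have lc: "\<bar>l \<bullet> clip t h\<bar> \<le> norm l" if "t > 0" for t h
    using Cauchy_Schwarz_ineq2[of l "clip t h"] norm_clip_le_1[OF that, of h]
    by (meson mult_left_le norm_ge_zero order_trans)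
  define W where "W t z = exp (norm l) * (indicator {h. norm h > t} (fst z) * g t (snd z))" for t and z :: "'a \<times> real"
  have bound: "\<bar>?f t z - ?e t z\<bar> \<le> W t z" if t: "t > 0" for t z
  proof (cases "norm (fst z) > t")
    case True
    let ?v = "l \<bullet> clip t (fst z)"
    define w where "w = snd z / t * ?v"
    have f: "?f t z = exp ?v * exp w"
      using True t by (simp add: truncate_vec_clip w_def inner_add_right flip: exp_add)
    have "\<bar>w\<bar> = \<bar>snd z\<bar> / t * \<bar>?v\<bar>" using t by (simp add: w_def abs_mult)
    also have "\<dots> \<le> \<bar>snd z\<bar> / t * norm l" using t lc by (intro mult_left_mono) auto
    finally have w: "\<bar>w\<bar> \<le> norm l * \<bar>snd z\<bar> / t" by (simp add: mult.commute)
    have "\<bar>exp w - 1\<bar> \<le> exp \<bar>w\<bar> - 1"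
    proof (cases "w \<ge> 0")
      case False
      \<comment> \<open>For negative \<open>w\<close> the claim reads
        \<open>1 - exp w \<le> exp (- w) - 1\<close>, which is the inequality of arithmetic and
        geometric means.\<close>
      have "2 \<le> exp w + exp (- w)"
      proof -
        have "0 \<le> (exp (w / 2) - exp (- w / 2))\<^sup>2" by simp
        also have "\<dots> = exp w + exp (- w) - 2"
          by (simp add: power2_eq_square algebra_simps flip: exp_add)
        finally show ?thesis by simp
      qed
      then show ?thesis using False by simp
    qed simp
    also have "\<dots> \<le> g t (snd z)" using w by (simp add: g_def)
    finally have w1: "\<bar>exp w - 1\<bar> \<le> g t (snd z)" .
    have "exp ?v * exp w - exp ?v = exp ?v * (exp w - 1)" by (simp add: right_diff_distrib)
    then have "\<bar>exp ?v * exp w - exp ?v\<bar> = exp ?v * \<bar>exp w - 1\<bar>" by (simp add: abs_mult)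
    also have "\<dots> \<le> exp ?v * g t (snd z)" using w1 by (rule mult_left_mono) simp
    also have "\<dots> \<le> exp (norm l) * g t (snd z)"
      using lc[OF t, of "fst z"] g0[OF t] by (intro mult_right_mono) auto
    finally show ?thesis unfolding f W_def using True by simp
  next
    case False
    then show ?thesis using t by (simp add: truncate_vec_clip W_def del: inner_scaleR_right)
  qed
  have W_int: "integrable (?R) (W t)" and W_eq: "(LINT z|(?R). W t z) = exp (norm l) * (U t * G t)"
    if t: "t > 0" "t \<ge> norm l / \<epsilon>" for t
  proof -
    have [measurable]: "W t \<in> borel_measurable (?R)" unfolding W_def by measurable
    show W_int: "integrable (?R) (W t)"
    proof (rule NQ.Fubini_integrable)
      have "norm (W t (h, x)) = exp (norm l) * indicator {h. norm h > t} h * g t x" for h x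
        using g0[OF t(1)] by (simp add: W_def abs_mult)
      then have "(LINT x|Q. norm (W t (h, x))) = exp (norm l) * G t * indicator {h. norm h > t} h" for h
        by (simp add: G_def)
      then show "integrable N (\<lambda>h. LINT x|Q. norm (W t (h, x)))"
        by (auto intro!: integrable_mult_right integrable_N_bounded[of _ 1])
      show "AE h in N. integrable Q (\<lambda>x. W t (h, x))"
        using g_int[OF t] by (simp add: W_def)
    qed simp
    have "(LINT z|(?R). W t z) = (LINT h|N. LINT x|Q. W t (h, x))"
      by (rule NQ.integral_fst'[OF W_int, symmetric])
    also have "\<dots> = exp (norm l) * (U t * G t)"
      by (simp add: W_def U_def G_def)
    finally show "(LINT z|(?R). W t z) = exp (norm l) * (U t * G t)" .
  qed
  have e_meas [measurable]: "(\<lambda>h. exp (l \<bullet> clip t h)) \<in> borel_measurable borel" for t by measurable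
  have f_meas [measurable]: "?f t \<in> borel_measurable (?R)" for t
    unfolding truncate_vec_def by measurable
  have e_int: "integrable (?R) (\<lambda>z. ?e t z)"
    and e_eq: "(LINT z|(?R). ?e t z) = (LINT h|N. exp (l \<bullet> clip t h))"
    and e_int1: "integrable N (\<lambda>h. exp (l \<bullet> clip t h))"
    if t: "t > 0" for t
  proof -
    show "integrable N (\<lambda>h. exp (l \<bullet> clip t h))"
      using lc[OF t] by (intro integrable_N_bounded[of _ "exp (norm l)"]) (auto simp: abs_le_iff)
    show e: "integrable (?R) (\<lambda>z. ?e t z)"
      using lc[OF t] by (intro NQ.P.integrable_const_bound[of _ "exp (norm l)"]) (auto simp: abs_le_iff)
    show "(LINT z|(?R). ?e t z) = (LINT h|N. exp (l \<bullet> clip t h))"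
      using NQ.integral_fst'[OF e] by (simp add: Q.prob_space)
  qed
  have f_int: "integrable (?R) (?f t)" if t: "t > 0" "t \<ge> norm l / \<epsilon>" for t
  proof (rule Bochner_Integration.integrable_bound)
    show "integrable (?R) (\<lambda>z. W t z + ?e t z)"
      using W_int[OF t] e_int[OF t(1)] by auto
    show "AE z in ?R. norm (?f t z) \<le> norm (W t z + ?e t z)"
    proof (rule AE_I2)
      fix z
      show "norm (?f t z) \<le> norm (W t z + ?e t z)"
        using bound[OF t(1), of z] by (simp add: abs_le_iff del: inner_scaleR_right)
    qed
  qed (rule f_meas)
  have ev: "\<forall>\<^sub>F t in at_top. t > 0 \<and> t \<ge> norm l / \<epsilon>"
    by (intro eventually_conj eventually_gt_at_top eventually_ge_at_top)
  then show "\<forall>\<^sub>F t in at_top. integrable (?R) (?f t)"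
    by eventually_elim (use f_int in auto)
  have close: "\<forall>\<^sub>F t in at_top. norm ((?F t - 1) / U t - ?I t / U t)
      \<le> exp (norm l) * G t"
    using ev
  proof eventually_elim
    case (elim t)
    have "?I t = (LINT z|(?R). ?e t z) - 1"
      using elim e_int1 by (simp add: e_eq Bochner_Integration.integral_diff)
    then have "(?F t - 1) / U t - ?I t / U t
        = (?F t - (LINT z|(?R). ?e t z)) / U t"
      by (simp add: diff_divide_distrib)
    also have "\<dots> = (LINT z|(?R). ?f t z - ?e t z) / U t"
      using elim by (subst Bochner_Integration.integral_diff[OF f_int e_int]) auto
    also have "norm \<dots> = \<bar>LINT z|(?R). ?f t z - ?e t z\<bar> / U t"
      using U_pos[of t] by (simp add: abs_divide)
    also have "\<dots> \<le> (LINT z|(?R). W t z) / U t"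
    proof (rule divide_right_mono[OF order_trans[OF integral_abs_bound]])
      show "(LINT z|(?R). \<bar>?f t z - ?e t z\<bar>) \<le> (LINT z|(?R). W t z)"
        using elim bound W_int f_int e_int by (intro integral_mono) auto
    qed (rule U_nonneg)
    also have "\<dots> = exp (norm l) * G t" using elim U_pos[of t] by (simp add: W_eq)
    finally show ?case .
  qed
  have "((\<lambda>t. exp (norm l) * G t) \<longlongrightarrow> 0) at_top"
    using tendsto_mult[OF tendsto_const G_lim, of "exp (norm l)"] by simp
  with close have "((\<lambda>t. (?F t - 1) / U t - ?I t / U t) \<longlongrightarrow> 0) at_top"
    by (rule Lim_null_comparison)
  from tendsto_add[OF this lim]
  show "((\<lambda>t. (?F t - 1) / U t) \<longlongrightarrow> \<Lambda>) at_top" by simp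
qed

end

text \<open>The bound \<open>ln x \<le> x - 1\<close>, applied to \<open>1 + u t * y t\<close> and
  to its inverse, squeezes the quotient between \<open>y t / (1 + u t * y t)\<close> and
  \<open>y t\<close>.\<close>

lemma ln_one_plus_limit:
  fixes u y :: "'b \<Rightarrow> real"
  assumes u: "(u \<longlongrightarrow> 0) F" "\<And>t. u t > 0" and y: "(y \<longlongrightarrow> L) F"
  shows "((\<lambda>t. ln (1 + u t * y t) / u t) \<longlongrightarrow> L) F"
proof -
  have uy: "((\<lambda>t. 1 + u t * y t) \<longlongrightarrow> 1) F"
    using tendsto_add[OF tendsto_const tendsto_mult[OF u(1) y], of 1] by simp
  then have ev: "\<forall>\<^sub>F t in F. 1 + u t * y t > 0" by (rule order_tendstoD(1)) simp
  show ?thesis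
  proof (rule real_tendsto_sandwich)
    show "\<forall>\<^sub>F t in F. y t / (1 + u t * y t) \<le> ln (1 + u t * y t) / u t"
      using ev
    proof eventually_elim
      case (elim t)
      have "ln (inverse (1 + u t * y t)) \<le> inverse (1 + u t * y t) - 1"
        using elim by (intro ln_le_minus_one) simp
      then have "1 - inverse (1 + u t * y t) \<le> ln (1 + u t * y t)"
        using elim by (simp add: ln_inverse)
      moreover have "1 - inverse (1 + u t * y t) = u t * (y t / (1 + u t * y t))"
        using elim by (simp add: field_simps)
      ultimately show ?case using u(2)[of t] by (simp add: pos_le_divide_eq mult.commute)
    qed
    show "\<forall>\<^sub>F t in F. ln (1 + u t * y t) / u t \<le> y t"
      using ev
    proof eventually_elim
      case (elim t)
      have "ln (1 + u t * y t) \<le> 1 + u t * y t - 1" using elim by (rule ln_le_minus_one)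
      then show ?case using u(2)[of t] by (simp add: pos_divide_le_eq mult.commute)
    qed
    show "((\<lambda>t. y t / (1 + u t * y t)) \<longlongrightarrow> L) F"
      using tendsto_divide[OF y uy] by simp
  qed (rule y)
qed

section \<open>Factorisation over independent pairs\<close>

context prob_space begin

text \<open>Brings events of a finite block under the independence of the two whole families, which
  is stated for sequences.\<close>

lemma restrict_vimage_generated:
  fixes X :: "nat \<Rightarrow> 'a \<Rightarrow> 'b::topological_space"
  assumes A: "A \<in> sets (PiM J (\<lambda>_. borel))"
  shows "(\<lambda>\<omega>. \<lambda>j\<in>J. X j \<omega>) -` A \<inter> space M \<in> generated_events M X"
proof -
  have "(\<lambda>x. restrict x J) \<in> measurable (PiM UNIV (\<lambda>_::nat. borel :: 'b measure)) (PiM J (\<lambda>_. borel))"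
    by (rule measurable_restrict_subset) simp
  from measurable_sets[OF this A]
  have B: "(\<lambda>x. restrict x J) -` A \<in> sets (PiM UNIV (\<lambda>_::nat. borel :: 'b measure))"
    by (simp add: space_PiM)
  have "(\<lambda>\<omega>. \<lambda>j\<in>J. X j \<omega>) -` A = (\<lambda>\<omega> j. X j \<omega>) -` ((\<lambda>x. restrict x J) -` A)" by auto
  then show ?thesis unfolding generated_events_def using B by blast
qed

text \<open>Three independence statements, within \<open>X\<close>, within \<open>Y\<close> and
  between the families, identify the joint law of two finite blocks as a product of two product
  measures; rectangles suffice. Tonelli then factors the integral, first over \<open>Y\<close> and
  then over \<open>X\<close>.\<close>

lemma nn_integral_prod_iid_pairs:
  fixes X :: "nat \<Rightarrow> 'a \<Rightarrow> 'b::euclidean_space" and Y :: "nat \<Rightarrow> 'a \<Rightarrow> real"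
    and f :: "'b \<times> real \<Rightarrow> ennreal"
  assumes X [measurable]: "\<And>j. X j \<in> borel_measurable M" and Y [measurable]: "\<And>j. Y j \<in> borel_measurable M"
    and iX: "indep_vars (\<lambda>_. borel) X {1..}" and iY: "indep_vars (\<lambda>_. borel) Y UNIV"
    and X_ident: "\<And>j. distr M borel (X j) = distr M borel (X 0)"
    and Y_ident: "\<And>j. distr M borel (Y j) = distr M borel (Y 0)"
    and XY: "indep_set (generated_events M X) (generated_events M Y)"
    and f [measurable]: "f \<in> borel_measurable borel"
    and n: "n \<ge> 1"
  shows "(\<integral>\<^sup>+\<omega>. (\<Prod>j\<in>{1..n}. f (X j \<omega>, Y j \<omega>)) \<partial>M)
     = (\<integral>\<^sup>+z. f z \<partial>(distr M borel (X 0) \<Otimes>\<^sub>M distr M borel (Y 0))) ^ n"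
proof -
  define N where "N = distr M borel (X 0)"
  define Q where "Q = distr M borel (Y 0)"
  have sN [measurable_cong]: "sets N = sets borel" and sQ [measurable_cong]: "sets Q = sets borel"
    by (simp_all add: N_def Q_def)
  interpret N: prob_space N unfolding N_def by (rule prob_space_distr) simp
  interpret Q: prob_space Q unfolding Q_def by (rule prob_space_distr) simp
  interpret pN: product_sigma_finite "\<lambda>_::nat. N" ..
  interpret pQ: product_sigma_finite "\<lambda>_::nat. Q" ..
  \<comment> \<open>The block starts at index 1: \<open>X 0\<close> represents the generic vector
    and is not assumed independent of its copies.\<close>
  define J where "J = {1..n}"
  have J: "finite J" "J \<noteq> {}" "card J = n" using n by (auto simp: J_def)
  interpret NJ: prob_space "PiM J (\<lambda>_. N)" by (rule prob_space_PiM) (rule N.prob_space_axioms)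
  interpret QJ: prob_space "PiM J (\<lambda>_. Q)" by (rule prob_space_PiM) (rule Q.prob_space_axioms)
  let ?BX = "PiM J (\<lambda>_. borel :: 'b measure)" and ?BY = "PiM J (\<lambda>_. borel :: real measure)"
  let ?X = "\<lambda>\<omega>. \<lambda>j\<in>J. X j \<omega>" and ?Y = "\<lambda>\<omega>. \<lambda>j\<in>J. Y j \<omega>"
  let ?NJ = "PiM J (\<lambda>_. N)" and ?QJ = "PiM J (\<lambda>_. Q)"
  let ?XY = "distr M (?BX \<Otimes>\<^sub>M ?BY) (\<lambda>\<omega>. (?X \<omega>, ?Y \<omega>))"
  let ?vX = "\<lambda>A. ?X -` A \<inter> space M" and ?vY = "\<lambda>B. ?Y -` B \<inter> space M"
  have f' [measurable]: "f \<in> borel_measurable (borel \<Otimes>\<^sub>M borel)" using f by (simp add: borel_prod)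
  have rX: "?X \<in> measurable M ?BX" and rY: "?Y \<in> measurable M ?BY"
    by (auto intro!: measurable_restrict)
  have "PiM J (\<lambda>j. distr M borel (X j)) = ?NJ"
    unfolding N_def by (intro PiM_cong refl X_ident)
  moreover have "indep_vars (\<lambda>_. borel) X J"
    using indep_vars_subset[OF iX, of J] by (auto simp: J_def)
  ultimately have dX: "distr M ?BX ?X = ?NJ"
    using indep_vars_iff_distr_eq_PiM[OF J(2), where X = X and M' = "\<lambda>_. borel"] by simp
  have "PiM J (\<lambda>j. distr M borel (Y j)) = ?QJ"
    unfolding Q_def by (intro PiM_cong refl Y_ident)
  moreover have "indep_vars (\<lambda>_. borel) Y J"
    using indep_vars_subset[OF iY, of J] by (auto simp: J_def)
  ultimately have dY: "distr M ?BY ?Y = ?QJ"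
    using indep_vars_iff_distr_eq_PiM[OF J(2), where X = Y and M' = "\<lambda>_. borel"] by simp
  have rXY: "(\<lambda>\<omega>. (?X \<omega>, ?Y \<omega>)) \<in> measurable M (?BX \<Otimes>\<^sub>M ?BY)"
    by (intro measurable_Pair rX rY)
  have sNJ: "sets (?NJ) = sets ?BX" and sQJ: "sets (?QJ) = sets ?BY"
    by (intro sets_PiM_cong refl sN sQ)+
  have sNQ: "sets (?NJ \<Otimes>\<^sub>M ?QJ) = sets (?BX \<Otimes>\<^sub>M ?BY)"
    by (intro sets_pair_measure_cong sNJ sQJ)
  have joint: "?NJ \<Otimes>\<^sub>M ?QJ = ?XY"
  proof (rule pair_measure_eqI)
    show "sigma_finite_measure (?NJ)" "sigma_finite_measure (?QJ)"
      by (rule NJ.sigma_finite_measure_axioms QJ.sigma_finite_measure_axioms)+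
    show "sets (?NJ \<Otimes>\<^sub>M ?QJ) = sets (?XY)"
      using sNQ by simp
    fix A B assume "A \<in> sets (?NJ)" "B \<in> sets (?QJ)"
    then have AB: "A \<in> sets ?BX" "B \<in> sets ?BY" using sNJ sQJ by auto
    have "emeasure (?NJ) A * emeasure (?QJ) B
        = emeasure M (?vX A) * emeasure M (?vY B)"
      unfolding dX[symmetric] dY[symmetric] using AB rX rY by (simp add: emeasure_distr)
    also have "\<dots> = ennreal (prob (?vX A) * prob (?vY B))"
      by (simp add: emeasure_eq_measure ennreal_mult)
    also have "prob (?vX A) * prob (?vY B)
        = prob ((?vX A) \<inter> (?vY B))"
      by (rule indep_setD[OF XY restrict_vimage_generated[OF AB(1)] restrict_vimage_generated[OF AB(2)], symmetric])
    also have "(?vX A) \<inter> (?vY B) = (\<lambda>\<omega>. (?X \<omega>, ?Y \<omega>)) -` (A \<times> B) \<inter> space M"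
      by auto
    also have "ennreal (prob \<dots>) = emeasure (?XY) (A \<times> B)"
      using AB by (subst emeasure_distr[OF rXY]) (auto simp: emeasure_eq_measure)
    finally show "emeasure (?NJ) A * emeasure (?QJ) B
        = emeasure (?XY) (A \<times> B)" .
  qed
  let ?g = "\<lambda>z. \<Prod>j\<in>J. f (fst z j, snd z j)"
  have gm: "?g \<in> borel_measurable (?BX \<Otimes>\<^sub>M ?BY)"
  proof (rule borel_measurable_prod_ennreal)
    fix j assume j: "j \<in> J"
    have "(\<lambda>z. (fst z j, snd z j)) \<in> measurable (?BX \<Otimes>\<^sub>M ?BY) (borel \<Otimes>\<^sub>M borel)"
      by (intro measurable_Pair measurable_compose[OF measurable_fst] measurable_compose[OF measurable_snd]
          measurable_component_singleton j)
    then show "(\<lambda>z. f (fst z j, snd z j)) \<in> borel_measurable (?BX \<Otimes>\<^sub>M ?BY)"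
      by (rule measurable_compose[OF _ f'])
  qed
  have gm': "?g \<in> borel_measurable (?NJ \<Otimes>\<^sub>M ?QJ)"
    using gm measurable_cong_sets[OF sNQ refl] by blast
  have "(\<integral>\<^sup>+\<omega>. (\<Prod>j\<in>J. f (X j \<omega>, Y j \<omega>)) \<partial>M) = (\<integral>\<^sup>+\<omega>. ?g (?X \<omega>, ?Y \<omega>) \<partial>M)"
    by (intro nn_integral_cong prod.cong) auto
  also have "\<dots> = (\<integral>\<^sup>+z. ?g z \<partial>?XY)"
    by (rule nn_integral_distr[OF rXY, symmetric]) (use gm in simp)
  also have "\<dots> = (\<integral>\<^sup>+z. ?g z \<partial>(?NJ \<Otimes>\<^sub>M ?QJ))" unfolding joint[symmetric] ..
  also have "\<dots> = (\<integral>\<^sup>+x. \<integral>\<^sup>+y. ?g (x, y) \<partial>?QJ \<partial>?NJ)"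
    by (rule QJ.nn_integral_fst[OF gm', symmetric])
  also have "\<dots> = (\<integral>\<^sup>+x. (\<Prod>j\<in>J. \<integral>\<^sup>+y. f (x j, y) \<partial>Q) \<partial>?NJ)"
  proof (rule nn_integral_cong)
    fix x
    have "(\<integral>\<^sup>+y. ?g (x, y) \<partial>?QJ) = (\<integral>\<^sup>+y. (\<Prod>j\<in>J. f (x j, y j)) \<partial>?QJ)" by simp
    also have "\<dots> = (\<Prod>j\<in>J. \<integral>\<^sup>+y. f (x j, y) \<partial>Q)"
      by (rule pQ.product_nn_integral_prod[OF J(1)]) measurable
    finally show "(\<integral>\<^sup>+y. ?g (x, y) \<partial>?QJ) = (\<Prod>j\<in>J. \<integral>\<^sup>+y. f (x j, y) \<partial>Q)" .
  qed
  also have "\<dots> = (\<Prod>j\<in>J. \<integral>\<^sup>+x. \<integral>\<^sup>+y. f (x, y) \<partial>Q \<partial>N)"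
    by (rule pN.product_nn_integral_prod[OF J(1)]) measurable
  also have "\<dots> = (\<integral>\<^sup>+z. f z \<partial>(N \<Otimes>\<^sub>M Q)) ^ n"
    by (simp add: J Q.nn_integral_fst)
  finally show ?thesis by (simp add: J_def N_def Q_def)
qed

lemma expectation_prod_iid_pairs:
  fixes X :: "nat \<Rightarrow> 'a \<Rightarrow> 'b::euclidean_space" and Y :: "nat \<Rightarrow> 'a \<Rightarrow> real"
    and f :: "'b \<times> real \<Rightarrow> real"
  assumes X [measurable]: "\<And>j. X j \<in> borel_measurable M" and Y [measurable]: "\<And>j. Y j \<in> borel_measurable M"
    and indep: "indep_vars (\<lambda>_. borel) X {1..}" "indep_vars (\<lambda>_. borel) Y UNIV"
      "\<And>j. distr M borel (X j) = distr M borel (X 0)" "\<And>j. distr M borel (Y j) = distr M borel (Y 0)"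
      "indep_set (generated_events M X) (generated_events M Y)"
    and f [measurable]: "f \<in> borel_measurable borel" and f0: "\<And>z. f z \<ge> 0"
    and int: "integrable (distr M borel (X 0) \<Otimes>\<^sub>M distr M borel (Y 0)) f" and n: "n \<ge> 1"
  shows "integrable M (\<lambda>\<omega>. \<Prod>j\<in>{1..n}. f (X j \<omega>, Y j \<omega>))"
    and "expectation (\<lambda>\<omega>. \<Prod>j\<in>{1..n}. f (X j \<omega>, Y j \<omega>))
      = (LINT z|(distr M borel (X 0) \<Otimes>\<^sub>M distr M borel (Y 0)). f z) ^ n"
proof -
  let ?R = "distr M borel (X 0) \<Otimes>\<^sub>M distr M borel (Y 0)"
  have f' [measurable]: "f \<in> borel_measurable (borel \<Otimes>\<^sub>M borel)" using f by (simp add: borel_prod)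
  have meas: "(\<lambda>\<omega>. \<Prod>j\<in>{1..n}. f (X j \<omega>, Y j \<omega>)) \<in> borel_measurable M" by measurable
  have "(\<integral>\<^sup>+\<omega>. ennreal (\<Prod>j\<in>{1..n}. f (X j \<omega>, Y j \<omega>)) \<partial>M)
      = (\<integral>\<^sup>+\<omega>. (\<Prod>j\<in>{1..n}. ennreal (f (X j \<omega>, Y j \<omega>))) \<partial>M)"
    using f0 by (simp add: prod_ennreal)
  also have "\<dots> = (\<integral>\<^sup>+z. ennreal (f z) \<partial>?R) ^ n"
    by (rule nn_integral_prod_iid_pairs[OF X Y indep _ n]) measurable
  also have "(\<integral>\<^sup>+z. ennreal (f z) \<partial>?R) = ennreal (LINT z|?R. f z)"
    using int f0 by (intro nn_integral_eq_integral) auto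
  also have "\<dots> ^ n = ennreal ((LINT z|?R. f z) ^ n)"
    using f0 by (simp add: ennreal_power)
  finally have *: "(\<integral>\<^sup>+\<omega>. ennreal (\<Prod>j\<in>{1..n}. f (X j \<omega>, Y j \<omega>)) \<partial>M) = ennreal ((LINT z|?R. f z) ^ n)" .
  show "integrable M (\<lambda>\<omega>. \<Prod>j\<in>{1..n}. f (X j \<omega>, Y j \<omega>))"
    using * f0 by (intro integrableI_nonneg meas) (auto intro!: prod_nonneg)
  show "expectation (\<lambda>\<omega>. \<Prod>j\<in>{1..n}. f (X j \<omega>, Y j \<omega>)) = (LINT z|?R. f z) ^ n"
    using * f0 meas by (subst integral_eq_nn_integral) (auto intro!: prod_nonneg)
qed

end

(* H 0 and L 0 are the generic variables H and L; H 1, H 2, ... and L 1, L 2, ... are the copies. *)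
theorem theorem3p1:
  fixes P :: "'w measure"
    and H :: "nat \<Rightarrow> 'w \<Rightarrow> 'a::euclidean_space"
    and L :: "nat \<Rightarrow> 'w \<Rightarrow> real"
    and \<mu> :: "'a measure"
    and a M :: "nat \<Rightarrow> real"
    and \<alpha> :: real
  assumes "prob_space P"
    and "\<And>j. H j \<in> borel_measurable P"
    and "\<And>j. L j \<in> borel_measurable P"
    and mu_radon: "radon_measure_on (- {0}) \<mu>"
    and mu_nonnull: "emeasure \<mu> (space \<mu>) \<noteq> 0"
    and a_lim: "filterlim a at_top sequentially"
    and vague: "vaguely_converges_on punctured_compactification
                  (\<lambda>n. extend_measure0 (scaled_law P (H 0) n (a n))) (extend_measure0 \<mu>)"
    and alpha: "0 < \<alpha>" "\<alpha> < 2"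
    and mu_scaling: "\<And>c A. c > 0 \<Longrightarrow> A \<in> sets \<mu> \<Longrightarrow>
                  emeasure \<mu> ((*\<^sub>R) c ` A) = ennreal (c powr (- \<alpha>)) * emeasure \<mu> A"
    and symmetric: "\<alpha> = 1 \<Longrightarrow> distr P borel (H 0) = distr P borel (\<lambda>\<omega>. - H 0 \<omega>)"
    and centered: "\<alpha> > 1 \<Longrightarrow> has_bochner_integral P (H 0) 0"
    and H_indep: "prob_space.indep_vars P (\<lambda>_. borel) H {1..}"
    and H_ident: "\<And>j. distr P borel (H j) = distr P borel (H 0)"
    and L_indep: "prob_space.indep_vars P (\<lambda>_. borel) L UNIV"
    and L_ident: "\<And>j. distr P borel (L j) = distr P borel (L 0)"
    and L_nonneg: "\<And>j \<omega>. \<omega> \<in> space P \<Longrightarrow> L j \<omega> \<ge> 0"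
    and HL_indep: "prob_space.indep_set P (generated_events P H) (generated_events P L)"
    and L_exp: "\<exists>\<epsilon>>0. integrable P (\<lambda>\<omega>. exp (\<epsilon> * L 0 \<omega>))"
    and M_pos: "\<And>n. n \<ge> 1 \<Longrightarrow> M n > 0"
    and M_lim: "filterlim M at_top sequentially"
    and hard: "filterlim (\<lambda>n. real n * measure P {\<omega>\<in>space P. norm (H 0 \<omega>) > M n}) at_top sequentially"
  shows "follows_LDP P
           (\<lambda>n \<omega>. truncated_sum M H L n \<omega>
                     /\<^sub>R (real n * M n * measure P {\<omega>\<in>space P. norm (H 0 \<omega>) > M n}))
           (\<lambda>n. real n * measure P {\<omega>\<in>space P. norm (H 0 \<omega>) > M n})
           (fenchel_legendre (Lambda \<alpha> \<mu>))"
proof -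
  interpret P: prob_space P by fact
  have Hm [measurable]: "H j \<in> borel_measurable P" and Lm [measurable]: "L j \<in> borel_measurable P" for j
    by fact+
  define N where "N = distr P borel (H 0)"
  define Q where "Q = distr P borel (L 0)"
  have N: "prob_space N" unfolding N_def by (rule P.prob_space_distr) simp
  have Q: "prob_space Q" unfolding Q_def by (rule P.prob_space_distr) simp
  have sN: "sets N = sets borel" and sQ: "sets Q = sets borel" by (simp_all add: N_def Q_def)
  have law: "scaled_law P (H 0) n (a n) = scaled_law N (\<lambda>h. h) n (a n)" for n
    unfolding scaled_law_def N_def by (subst distr_distr) (auto simp: comp_def)
  interpret regularly_varying_law N \<mu> a \<alpha>
    using N sN mu_radon mu_nonnull a_lim vague alpha mu_scaling
    by (intro regularly_varying_law.intro regularly_varying_law_axioms.intro) (auto simp: law)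
  have U_eq: "U t = measure P {\<omega>\<in>space P. norm (H 0 \<omega>) > t}" for t
  proof -
    have "U t = measure N {h. norm h > t}" by (rule U_def)
    also have "\<dots> = measure P {\<omega>\<in>space P. norm (H 0 \<omega>) > t}"
      unfolding N_def by (subst measure_distr) (auto simp: vimage_def Int_def conj_commute)
    finally show ?thesis .
  qed
  let ?c = "\<lambda>n. real n * U (M n)"
  let ?Z = "\<lambda>n \<omega>. truncated_sum M H L n \<omega> /\<^sub>R (real n * M n * U (M n))"
  have sym: "distr N N uminus = N" if "\<alpha> = 1"
  proof -
    have "distr N N uminus = distr N borel uminus" by (rule distr_cong) (simp_all add: sN)
    also have "\<dots> = distr P borel (\<lambda>\<omega>. - H 0 \<omega>)"
      unfolding N_def by (subst distr_distr) (auto simp: comp_def)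
    finally show ?thesis using symmetric[OF that] by (simp add: N_def)
  qed
  have cen: "has_bochner_integral N (\<lambda>h. h) 0" if "\<alpha> > 1"
    unfolding N_def using centered[OF that] by (intro has_bochner_integral_distr) auto
  obtain \<epsilon> where \<epsilon>: "\<epsilon> > 0" "integrable P (\<lambda>\<omega>. exp (\<epsilon> * L 0 \<omega>))" using L_exp by blast
  have "integrable P (\<lambda>\<omega>. exp (\<epsilon> * \<bar>L 0 \<omega>\<bar>))"
    using \<epsilon>(2) L_nonneg by (subst Bochner_Integration.integrable_cong[OF refl, of _ _ "\<lambda>\<omega>. exp (\<epsilon> * L 0 \<omega>)"]) auto
  then have exp_int: "integrable Q (\<lambda>x. exp (\<epsilon> * \<bar>x\<bar>))"
    unfolding Q_def by (subst integrable_distr_eq) auto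
  let ?f = "\<lambda>l t z. exp (l \<bullet> (truncate_vec t (fst z) (snd z) /\<^sub>R t))"
  let ?m = "\<lambda>l t. LINT z|(N \<Otimes>\<^sub>M Q). ?f l t z"
  have fm: "?f l t \<in> borel_measurable borel" for l :: 'a and t
    unfolding borel_prod[symmetric] truncate_vec_def by measurable
  have clip_lim: "((\<lambda>t. (LINT h|N. exp (l \<bullet> clip t h) - 1) / U t) \<longlongrightarrow> Lambda \<alpha> \<mu> l) at_top" for l
    using alpha(2) sym cen by (rule clipped_mgf_limit)
  have int_ev: "\<forall>\<^sub>F n in sequentially. integrable (N \<Otimes>\<^sub>M Q) (?f l (M n))" for l
    using eventually_compose_filterlim[OF truncated_mgf_limit(1)[OF Q sQ \<epsilon>(1) exp_int clip_lim] M_lim] .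
  have m_lim: "(\<lambda>n. (?m l (M n) - 1) / U (M n)) \<longlonglongrightarrow> Lambda \<alpha> \<mu> l" for l
    using filterlim_compose[OF truncated_mgf_limit(2)[OF Q sQ \<epsilon>(1) exp_int clip_lim] M_lim] .
  \<comment> \<open>The speed cancels the normalisation: the exponent is
    \<open>l \<bullet> S / M n\<close> with \<open>S\<close> the truncated sum, a sum of one term
    per pair.\<close>
  have exp_eq: "exp (?c n * (l \<bullet> ?Z n \<omega>)) = (\<Prod>j\<in>{1..n}. ?f l (M n) (H j \<omega>, L j \<omega>))" if "n \<ge> 1" for n l \<omega>
  proof -
    have "?c n * (l \<bullet> ?Z n \<omega>) = (\<Sum>j\<in>{1..n}. l \<bullet> (truncate_vec (M n) (H j \<omega>) (L j \<omega>) /\<^sub>R M n))"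
      using U_pos[of "M n"] M_pos[OF that] that
      by (simp add: truncated_sum_def inner_sum_right sum_distrib_left field_simps)
    then show ?thesis by (simp add: exp_sum)
  qed
  note pairs = P.expectation_prod_iid_pairs[OF Hm Lm H_indep L_indep H_ident L_ident HL_indep fm exp_ge_zero,
      folded N_def Q_def]
  interpret GE: gaertner_ellis P ?Z ?c "Lambda \<alpha> \<mu>"
  proof
    show "?Z n \<in> borel_measurable P" for n
      unfolding truncated_sum_def truncate_vec_def by measurable
    show "filterlim ?c at_top sequentially" using hard by (simp add: U_eq)
    fix l :: 'a
    show "\<forall>\<^sub>F n in sequentially. integrable P (\<lambda>\<omega>. exp (?c n * (l \<bullet> ?Z n \<omega>)))"
      using int_ev[of l] eventually_ge_at_top[of 1]
      by eventually_elim (use pairs(1) in \<open>simp only: exp_eq\<close>)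
    have "(\<lambda>n. ln (1 + U (M n) * ((?m l (M n) - 1) / U (M n))) / U (M n)) \<longlonglongrightarrow> Lambda \<alpha> \<mu> l"
      by (rule ln_one_plus_limit[OF filterlim_compose[OF U_tendsto_0 M_lim] U_pos m_lim])
    then show "(\<lambda>n. ln (P.expectation (\<lambda>\<omega>. exp (?c n * (l \<bullet> ?Z n \<omega>)))) / ?c n) \<longlonglongrightarrow> Lambda \<alpha> \<mu> l"
    proof (rule Lim_transform_eventually)
      \<comment> \<open>The one-step generating function tends to 1, hence is eventually positive,
        as the logarithm of its power requires.\<close>
      have pos: "\<forall>\<^sub>F n in sequentially. ?m l (M n) > 0"
      proof -
        have "(\<lambda>n. U (M n) * ((?m l (M n) - 1) / U (M n))) \<longlonglongrightarrow> 0 * Lambda \<alpha> \<mu> l"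
          by (intro tendsto_mult filterlim_compose[OF U_tendsto_0 M_lim] m_lim)
        then have "\<forall>\<^sub>F n in sequentially. - 1 < U (M n) * ((?m l (M n) - 1) / U (M n))"
          by (intro order_tendstoD(1)) auto
        then show ?thesis
          by eventually_elim (use U_pos in \<open>simp add: less_imp_neq[symmetric]\<close>)
      qed
      show "\<forall>\<^sub>F n in sequentially. ln (1 + U (M n) * ((?m l (M n) - 1) / U (M n))) / U (M n)
          = ln (P.expectation (\<lambda>\<omega>. exp (?c n * (l \<bullet> ?Z n \<omega>)))) / ?c n"
        using int_ev[of l] eventually_ge_at_top[of 1] pos
      proof eventually_elim
        case (elim n)
        have "P.expectation (\<lambda>\<omega>. exp (?c n * (l \<bullet> ?Z n \<omega>))) = ?m l (M n) ^ n"
          unfolding exp_eq[OF elim(2)] using elim by (intro pairs(2)) auto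
        then have "ln (P.expectation (\<lambda>\<omega>. exp (?c n * (l \<bullet> ?Z n \<omega>)))) = real n * ln (?m l (M n))"
          using elim by (simp add: ln_realpow)
        moreover have "1 + U (M n) * ((?m l (M n) - 1) / U (M n)) = ?m l (M n)"
          using U_pos[of "M n"] by simp
        ultimately show ?case using elim by simp
      qed
    qed
  qed
  have "follows_LDP P ?Z ?c (fenchel_legendre (Lambda \<alpha> \<mu>))"
    using alpha(2) by (intro GE.LDP Lambda_continuous Lambda_differentiable)
  then show ?thesis by (simp only: U_eq)
qed

end
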